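(* Let $s\in(0,1)$, $N>2s$, let $\Omega\subset\mathbb{R}^N$ be a smooth bounded domain, and let $f:\overline\Omega\times\mathbb{R}\to\mathbb{R}$ be locally Lipschitz with $$\limsup_{\xi\to-\infty}\frac{f(x,\xi)}{\xi}<\lambda_1^s<\liminf_{\xi\to+\infty}\frac{f(x,\xi)}{\xi}\quad\text{uniformly for a.e. }x\in\Omega.$$ Then there exists $\tau\in\mathbb{R}$ (independent of $h$) such that for every $h\in L^\infty(\Omega)$ with $\int_\Omega h\varphi_1\,dx=0$ and every $t>\tau$, the problem $$-\operatorname{div}(y^{1-2s}\nabla U)=0\ \text{in }\mathcal{C},\quad U=0\ \text{on }\partial_L\mathcal{C},\quad \frac{\partial U}{\partial\nu^{1-2s}}=\kappa_s[f(x,u)+t\varphi_1+h]\ \text{on }\Omega\times\{0\}$$ has no weak solution $U\in H^1_{0,L}(\mathcal{C})$.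
   Context: $(\lambda_k,\varphi_k)$ are the Dirichlet eigenvalues and $L^2(\Omega)$-orthonormal eigenfunctions of $-\Delta$ in $\Omega$, $\varphi_1>0$. $\mathcal{C}=\Omega\times(0,\infty)$ has points $(x,y)$, $\partial_L\mathcal{C}=\partial\Omega\times[0,\infty)$; $H^1_{0,L}(\mathcal{C})$ is the completion of $C_c^\infty(\Omega\times[0,\infty))$ under the norm $\left(\iint_{\mathcal{C}}y^{1-2s}|\nabla U|^2dxdy\right)^{1/2}$. The lower-case letter denotes the trace on $\Omega\times\{0\}$ ($u$ of $U$, $\psi$ of $\Psi$). $\frac{\partial U}{\partial\nu^{1-2s}}=-\lim_{y\to0^+}y^{1-2s}U_y$. The constant $\kappa_s>0$ is $\kappa_s=-\lim_{y\to0^+}y^{1-2s}\theta'(y)$ where $\theta\in H^1(\mathbb{R}_+,y^{1-2s})$ solves $\theta''+\frac{1-2s}{y}\theta'-\theta=0$, $\theta(0)=1$ (explicitly $\kappa_s=2^{1-2s}\Gamma(1-s)/\Gamma(s)$). Weak solution: $\kappa_s^{-1}\iint_{\mathcal{C}}y^{1-2s}\nabla U\cdot\nabla\Psi\,dxdy=\int_\Omega[f(x,u)+t\varphi_1+h]\psi\,dx$ for all $\Psi\in H^1_{0,L}(\mathcal{C})$ (with $f(\cdot,u)\psi$ integrable for all such $\Psi$). The uniform limsup/liminf condition means: there exist $a<\lambda_1^s<b$ and $R>0$ such that $f(x,\xi)/\xi\le a$ for $\xi\le-R$ and $f(x,\xi)/\xi\ge b$ for $\xi\ge R$, for a.e.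 $x\in\Omega$. *)

theory Defs
  imports "HOL-Analysis.Analysis"
begin

text \<open>Iterated directional derivatives; in finite dimension and on an open set this is the usual
  class of $k$ times continuously differentiable functions.\<close>

primrec Ck_on ::
  "nat \<Rightarrow> 'a::euclidean_space set \<Rightarrow> ('a \<Rightarrow> real) \<Rightarrow> bool" where
  "Ck_on 0 S f \<longleftrightarrow> continuous_on S f"
| "Ck_on (Suc k) S f \<longleftrightarrow>
     (\<forall>x\<in>S. f differentiable (at x)) \<and>
     (\<forall>v. Ck_on k S (\<lambda>x. frechet_derivative f (at x) v))"

definition smooth_on :: "'a::euclidean_space set \<Rightarrow> ('a \<Rightarrow> real) \<Rightarrow> bool" where
  "smooth_on S f \<longleftrightarrow> (\<forall>k. Ck_on k S f)"

definition grad :: "('a::euclidean_space \<Rightarrow> real) \<Rightarrow> 'a \<Rightarrow> 'a" where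
  "grad f x = (\<Sum>b\<in>Basis. frechet_derivative f (at x) b *\<^sub>R b)"

text \<open>Near each boundary point the domain is, in suitable orthonormal coordinates, the strict
  supergraph of a smooth function.  The function \<open>\<gamma>\<close> of the coordinates orthogonal to \<open>e\<close> is
  encoded as a function on the whole space that is constant along \<open>e\<close>.\<close>

definition smooth_bounded_domain :: "'a::euclidean_space set \<Rightarrow> bool" where
  "smooth_bounded_domain \<Omega> \<longleftrightarrow>
     open \<Omega> \<and> connected \<Omega> \<and> \<Omega> \<noteq> {} \<and> bounded \<Omega> \<and>
     (\<forall>p\<in>frontier \<Omega>. \<exists>r>0. \<exists>e \<gamma>. norm e = 1 \<and> smooth_on UNIV \<gamma> \<and>
        (\<forall>x t. \<gamma> (x + t *\<^sub>R e) = \<gamma> x) \<and>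
        \<Omega> \<inter> ball p r = {x \<in> ball p r. \<gamma> x < x \<bullet> e})"

text \<open>Convergence in $L^2(M)$; the limit is an arbitrary measurable representative.\<close>

definition L2_tendsto ::
  "'a measure \<Rightarrow> (nat \<Rightarrow> 'a \<Rightarrow> 'b::euclidean_space) \<Rightarrow> ('a \<Rightarrow> 'b) \<Rightarrow> bool" where
  "L2_tendsto M F g \<longleftrightarrow>
     (\<forall>n. F n \<in> borel_measurable M) \<and> g \<in> borel_measurable M \<and>
     (\<lambda>n. \<integral>\<^sup>+ x. ennreal ((norm (F n x - g x))\<^sup>2) \<partial>M) \<longlonglongrightarrow> 0"

definition Linfty :: "'a::euclidean_space set \<Rightarrow> ('a \<Rightarrow> real) set" where
  "Linfty \<Omega> = {h. h \<in> borel_measurable (lebesgue_on \<Omega>) \<and>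
                   (\<exists>M. AE x in lebesgue_on \<Omega>. \<bar>h x\<bar> \<le> M)}"

definition Cc_infty :: "'a::euclidean_space set \<Rightarrow> ('a \<Rightarrow> real) set" where
  "Cc_infty \<Omega> = {\<phi>. smooth_on UNIV \<phi> \<and>
     (\<exists>K. compact K \<and> K \<subseteq> \<Omega> \<and> (\<forall>x. x \<notin> K \<longrightarrow> \<phi> x = 0))}"

text \<open>\<open>H10 \<Omega> v g\<close>: the function \<open>v\<close> belongs to $H^1_0(\Omega)$, the closure of
  $C_c^\infty(\Omega)$ in $H^1(\Omega)$, and has weak gradient \<open>g\<close>.\<close>

definition H10 :: "'a::euclidean_space set \<Rightarrow> ('a \<Rightarrow> real) \<Rightarrow> ('a \<Rightarrow> 'a) \<Rightarrow> bool" where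
  "H10 \<Omega> v g \<longleftrightarrow> (\<exists>\<Phi>. (\<forall>n. \<Phi> n \<in> Cc_infty \<Omega>) \<and>
     L2_tendsto (lebesgue_on \<Omega>) \<Phi> v \<and>
     L2_tendsto (lebesgue_on \<Omega>) (\<lambda>n. grad (\<Phi> n)) g)"

definition dirichlet_eigenpair ::
  "'a::euclidean_space set \<Rightarrow> real \<Rightarrow> ('a \<Rightarrow> real) \<Rightarrow> bool" where
  "dirichlet_eigenpair \<Omega> \<mu> v \<longleftrightarrow>
     \<not> (AE x in lebesgue_on \<Omega>. v x = 0) \<and>
     (\<exists>g. H10 \<Omega> v g \<and>
        (\<forall>w gw. H10 \<Omega> w gw \<longrightarrow>
           (\<integral>x. g x \<bullet> gw x \<partial>(lebesgue_on \<Omega>)) = \<mu> * (\<integral>x. v x * w x \<partial>(lebesgue_on \<Omega>))))"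

text \<open>The eigenvalues are indexed from 1, in nondecreasing order and repeated according to
  multiplicity: this is what completeness of the orthonormal system expresses.\<close>

definition dirichlet_eigensystem ::
  "'a::euclidean_space set \<Rightarrow> (nat \<Rightarrow> real) \<Rightarrow> (nat \<Rightarrow> 'a \<Rightarrow> real) \<Rightarrow> bool" where
  "dirichlet_eigensystem \<Omega> lam \<phi> \<longleftrightarrow>
     (\<forall>k\<ge>1. dirichlet_eigenpair \<Omega> (lam k) (\<phi> k)) \<and>
     (\<forall>j k. 1 \<le> j \<and> j \<le> k \<longrightarrow> lam j \<le> lam k) \<and>
     (\<forall>j\<ge>1. \<forall>k\<ge>1. (\<integral>x. \<phi> j x * \<phi> k x \<partial>(lebesgue_on \<Omega>)) = (if j = k then 1 else 0)) \<and>
     (\<forall>v \<in> borel_measurable (lebesgue_on \<Omega>).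
        integrable (lebesgue_on \<Omega>) (\<lambda>x. (v x)\<^sup>2) \<and>
        (\<forall>k\<ge>1. (\<integral>x. v x * \<phi> k x \<partial>(lebesgue_on \<Omega>)) = 0) \<longrightarrow>
        (AE x in lebesgue_on \<Omega>. v x = 0)) \<and>
     (AE x in lebesgue_on \<Omega>. \<phi> 1 x > 0)"

definition extension_profile :: "real \<Rightarrow> (real \<Rightarrow> real) \<Rightarrow> bool" where
  "extension_profile s \<theta> \<longleftrightarrow>
     continuous_on {0..} \<theta> \<and> \<theta> 0 = 1 \<and>
     (\<forall>y>0. \<theta> field_differentiable (at y) \<and> deriv \<theta> field_differentiable (at y) \<and>
        deriv (deriv \<theta>) y + (1 - 2 * s) / y * deriv \<theta> y - \<theta> y = 0) \<and>
     set_integrable lborel {0<..} (\<lambda>y. y powr (1 - 2 * s) * ((\<theta> y)\<^sup>2 + (deriv \<theta> y)\<^sup>2))"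

definition kappa :: "real \<Rightarrow> real" where
  "kappa s = (THE k. \<exists>\<theta>. extension_profile s \<theta> \<and>
     ((\<lambda>y. - (y powr (1 - 2 * s) * deriv \<theta> y)) \<longlongrightarrow> k) (at_right 0))"

definition half_cylinder :: "'a set \<Rightarrow> ('a \<times> real) set" where
  "half_cylinder \<Omega> = \<Omega> \<times> {0<..}"

definition cyl_measure :: "real \<Rightarrow> 'a::euclidean_space set \<Rightarrow> ('a \<times> real) measure" where
  "cyl_measure s \<Omega> =
     density (lebesgue_on (half_cylinder \<Omega>)) (\<lambda>p. ennreal (snd p powr (1 - 2 * s)))"

text \<open>$C_c^\infty(\Omega\times[0,\infty))$: smooth up to $y = 0$ (written as restrictions of
  functions that are smooth on the whole space, whose values for $y < 0$ are irrelevant) and not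
  required to vanish at $y = 0$.\<close>

definition Cc_infty_cyl :: "'a::euclidean_space set \<Rightarrow> ('a \<times> real \<Rightarrow> real) set" where
  "Cc_infty_cyl \<Omega> = {\<Phi>. smooth_on UNIV \<Phi> \<and>
     (\<exists>K. compact K \<and> K \<subseteq> \<Omega> \<times> {0..} \<and> (\<forall>x y. 0 \<le> y \<and> (x, y) \<notin> K \<longrightarrow> \<Phi> (x, y) = 0))}"

text \<open>\<open>H10L s \<Omega> U G u\<close>: the function \<open>U\<close> belongs to $H^1_{0,L}(\mathcal{C})$, has weak gradient
  \<open>G\<close> and trace \<open>u\<close> on $\Omega\times\{0\}$.  The space is the completion of
  \<open>Cc_infty_cyl\<close> under the weighted norm of the gradient, realised as a space of functions.  As
  \<open>\<Omega>\<close> is bounded, the Poincare inequality on the slices $y = \mathrm{const}$ and the trace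
  inequality bound the weighted $L^2$ norm of $\Phi$ and the $L^2(\Omega)$ norm of
  $\Phi(\cdot,0)$ by the weighted $L^2$ norm of $\nabla\Phi$; hence every sequence that is Cauchy
  in the norm of the space converges in all three senses below, and the limits are determined (up
  to null sets) by the element of the completion.\<close>

definition H10L ::
  "real \<Rightarrow> 'a::euclidean_space set \<Rightarrow> ('a \<times> real \<Rightarrow> real) \<Rightarrow> ('a \<times> real \<Rightarrow> 'a \<times> real) \<Rightarrow>
   ('a \<Rightarrow> real) \<Rightarrow> bool" where
  "H10L s \<Omega> U G u \<longleftrightarrow> (\<exists>\<Phi>. (\<forall>n. \<Phi> n \<in> Cc_infty_cyl \<Omega>) \<and>
     L2_tendsto (cyl_measure s \<Omega>) (\<lambda>n. grad (\<Phi> n)) G \<and>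
     L2_tendsto (cyl_measure s \<Omega>) \<Phi> U \<and>
     L2_tendsto (lebesgue_on \<Omega>) (\<lambda>n x. \<Phi> n (x, 0)) u)"

text \<open>Weak solutions of the problem with right-hand side
  $\kappa_s\,[f(x,u) + t\,\varphi_1 + h]$; the parameter \<open>\<phi>1\<close> is the first eigenfunction.\<close>

definition weak_solution ::
  "real \<Rightarrow> 'a::euclidean_space set \<Rightarrow> ('a \<Rightarrow> real \<Rightarrow> real) \<Rightarrow> ('a \<Rightarrow> real) \<Rightarrow> real \<Rightarrow> ('a \<Rightarrow> real) \<Rightarrow>
   ('a \<times> real \<Rightarrow> real) \<Rightarrow> bool" where
  "weak_solution s \<Omega> f \<phi>1 t h U \<longleftrightarrow>
     (\<exists>G u. H10L s \<Omega> U G u \<and>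
        (\<forall>\<Psi> H \<psi>. H10L s \<Omega> \<Psi> H \<psi> \<longrightarrow>
           integrable (lebesgue_on \<Omega>) (\<lambda>x. f x (u x) * \<psi> x) \<and>
           inverse (kappa s) * (\<integral>p. G p \<bullet> H p \<partial>(cyl_measure s \<Omega>)) =
             (\<integral>x. (f x (u x) + t * \<phi>1 x + h x) * \<psi> x \<partial>(lebesgue_on \<Omega>))))"

definition locally_lipschitz_on :: "'a::metric_space set \<Rightarrow> ('a \<Rightarrow> 'b::metric_space) \<Rightarrow> bool" where
  "locally_lipschitz_on S g \<longleftrightarrow> (\<forall>p\<in>S. \<exists>e>0. \<exists>L. L-lipschitz_on (ball p e \<inter> S) g)"

text \<open>The uniform condition
  $\limsup_{\xi\to-\infty} f(x,\xi)/\xi < c < \liminf_{\xi\to+\infty} f(x,\xi)/\xi$ for a.e. $x$.\<close>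

definition uniform_slopes_separated_by ::
  "'a::euclidean_space set \<Rightarrow> ('a \<Rightarrow> real \<Rightarrow> real) \<Rightarrow> real \<Rightarrow> bool" where
  "uniform_slopes_separated_by \<Omega> f c \<longleftrightarrow>
     (\<exists>a b R. a < c \<and> c < b \<and> R > 0 \<and>
        (AE x in lebesgue_on \<Omega>.
           (\<forall>\<xi>. \<xi> \<le> - R \<longrightarrow> f x \<xi> / \<xi> \<le> a) \<and>
           (\<forall>\<xi>. \<xi> \<ge> R \<longrightarrow> f x \<xi> / \<xi> \<ge> b)))"

end

theory Submission
  imports Defs
begin

text \<open>Test the equation against
  \<open>\<phi>\<^sub>1(x) \<theta>(\<surd>\<lambda>\<^sub>1 y)\<close>, where \<open>\<theta>\<close> is the decaying solution of the profile equation.  The weak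
  eigenvalue equation on horizontal slices and the profile equation on vertical lines reduce the
  left-hand side to \<open>\<lambda>\<^sub>1\<^sup>s \<integral> u \<phi>\<^sub>1\<close>, hence
  \<open>t = \<integral> (\<lambda>\<^sub>1\<^sup>s u - f(x, u)) \<phi>\<^sub>1\<close>.  The slope condition bounds \<open>\<lambda>\<^sub>1\<^sup>s \<xi> - f(x, \<xi>)\<close> from above by a
  constant \<open>C\<close> independent of \<open>h\<close>, so no solution exists for \<open>t > C \<integral> \<phi>\<^sub>1\<close>.\<close>

section \<open>Smooth functions\<close>

text \<open>The test function is never shown to lie in the space: \<open>H10L\<close> asks for
  approximation by functions smooth up to y = 0, while \<theta> behaves like 1 - c y^(2s) there and
  has unbounded support. Two facts get round this. The right-hand side of the weak formulation sees
  a test function \<eta>(y) v(x) only through \<eta>(0), so smooth compactly supported \<eta> with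
  \<eta>(0) -> 1 have a trivial limit on that side, although f(x, u) is only known to be integrable
  against traces. On the left, dominated convergence asks for no more than square integrability of
  the fields. To obtain such \<eta>, \<theta> is built explicitly as a(y) - y^(2s) e(y) with a and e
  power series in y^2, and only the factor y^(2s) has to be regularised. The constant
  \<open>kappa s\<close> is a definite description, so it cancels only after a profile has been
  constructed and its flux at 0 shown to be unique. The second-order profile equation is replaced by
  the system \<theta>' = y^(2s-1) q, q' = \<mu> y^(1-2s) \<theta>, because the flux q stays
  continuous at y = 0, where \<theta>' may blow up.\<close>

lemma Ck_on_SucI:
  assumes "\<And>x. (f has_derivative f' x) (at x)" "\<And>v. Ck_on k UNIV (\<lambda>x. f' x v)"
  shows "Ck_on (Suc k) UNIV f"
proof -
  have "frechet_derivative f (at x) = f' x" for x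
    using frechet_derivative_at[OF assms(1)] by simp
  then show ?thesis using assms by (auto simp: differentiable_def)
qed

lemma Ck_on_has_derivative:
  "Ck_on (Suc k) UNIV f \<Longrightarrow> (f has_derivative frechet_derivative f (at x)) (at x)"
  by (auto simp: frechet_derivative_works)

lemma Ck_on_SucD: "Ck_on (Suc k) UNIV f \<Longrightarrow> Ck_on k UNIV f"
proof (induction k arbitrary: f)
  case 0
  then show ?case
    by (auto intro!: continuous_at_imp_continuous_on differentiable_imp_continuous_within)
next
  case (Suc k)
  then have "\<forall>v. Ck_on k UNIV (\<lambda>x. frechet_derivative f (at x) v)"
    by (metis Ck_on.simps(2))
  then show ?case using Suc.prems by simp
qed

lemma Ck_on_const: "Ck_on k UNIV (\<lambda>x. c)"
proof (induction k arbitrary: c)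
  case (Suc k)
  show ?case by (rule Ck_on_SucI[where f'="\<lambda>x v. 0"]) (auto simp: Suc)
qed simp

lemma Ck_on_add: "Ck_on k UNIV f \<Longrightarrow> Ck_on k UNIV g \<Longrightarrow> Ck_on k UNIV (\<lambda>x. f x + g x)"
proof (induction k arbitrary: f g)
  case (Suc k)
  show ?case
    by (rule Ck_on_SucI[OF has_derivative_add[OF Ck_on_has_derivative[OF Suc.prems(1)]
        Ck_on_has_derivative[OF Suc.prems(2)]]])
      (use Suc in auto)
qed (auto intro: continuous_intros)

lemma Ck_on_mult: "Ck_on k UNIV f \<Longrightarrow> Ck_on k UNIV g \<Longrightarrow> Ck_on k UNIV (\<lambda>x. f x * g x)"
proof (induction k arbitrary: f g)
  case (Suc k)
  show ?case
    by (rule Ck_on_SucI[OF has_derivative_mult[OF Ck_on_has_derivative[OF Suc.prems(1)]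
        Ck_on_has_derivative[OF Suc.prems(2)]]])
      (use Suc Ck_on_SucD[OF Suc.prems(1)] Ck_on_SucD[OF Suc.prems(2)] in \<open>auto intro!: Ck_on_add\<close>)
qed (auto intro: continuous_intros)

text \<open>An affine inner map has constant derivative, so the induction closes without higher
  chain rule formulas. Projections, slices and the rescaling in \<open>cutoff\<close> are all of
  this kind.\<close>

lemma Ck_on_affine_compose:
  fixes L :: "'a::euclidean_space \<Rightarrow> 'b::euclidean_space"
  assumes "bounded_linear L"
  shows "Ck_on k UNIV f \<Longrightarrow> Ck_on k UNIV (\<lambda>x. f (L x + c))"
proof (induction k arbitrary: f)
  case 0
  then show ?case
    by (auto intro!: continuous_on_compose2[of UNIV f] continuous_intros
        bounded_linear.continuous_on[OF assms])
next
  case (Suc k)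
  have L: "((\<lambda>x. L x + c) has_derivative L) (at x)" for x
    using bounded_linear_imp_has_derivative[OF assms] by (auto intro!: derivative_eq_intros)
  show ?case
    by (rule Ck_on_SucI[OF has_derivative_compose[OF L Ck_on_has_derivative[OF Suc.prems]]])
      (use Suc in auto)
qed

lemma smooth_on_const: "smooth_on UNIV (\<lambda>x. c)"
  by (simp add: smooth_on_def Ck_on_const)

lemma smooth_on_add: "smooth_on UNIV f \<Longrightarrow> smooth_on UNIV g \<Longrightarrow> smooth_on UNIV (\<lambda>x. f x + g x)"
  by (simp add: smooth_on_def Ck_on_add)

lemma smooth_on_mult: "smooth_on UNIV f \<Longrightarrow> smooth_on UNIV g \<Longrightarrow> smooth_on UNIV (\<lambda>x. f x * g x)"
  by (simp add: smooth_on_def Ck_on_mult)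

lemma smooth_on_diff: "smooth_on UNIV f \<Longrightarrow> smooth_on UNIV g \<Longrightarrow> smooth_on UNIV (\<lambda>x. f x - g x)"
  using smooth_on_add[OF _ smooth_on_mult[OF smooth_on_const[of "-1"]], of f g] by simp

lemma smooth_on_affine_compose:
  fixes L :: "'a::euclidean_space \<Rightarrow> 'b::euclidean_space"
  assumes "bounded_linear L" "smooth_on UNIV f"
  shows "smooth_on UNIV (\<lambda>x. f (L x + c))"
  using assms by (simp add: smooth_on_def Ck_on_affine_compose)

lemma smooth_on_fst:
  fixes f :: "'a::euclidean_space \<Rightarrow> real"
  shows "smooth_on UNIV f \<Longrightarrow> smooth_on UNIV (\<lambda>p::'a \<times> 'b::euclidean_space. f (fst p))"
  using smooth_on_affine_compose[OF bounded_linear_fst, of f 0] by simp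

lemma smooth_on_snd:
  fixes f :: "'b::euclidean_space \<Rightarrow> real"
  shows "smooth_on UNIV f \<Longrightarrow> smooth_on UNIV (\<lambda>p::'a::euclidean_space \<times> 'b. f (snd p))"
  using smooth_on_affine_compose[OF bounded_linear_snd, of f 0] by simp

lemma smooth_on_slice:
  fixes f :: "'a::euclidean_space \<times> 'b::euclidean_space \<Rightarrow> real"
  assumes "smooth_on UNIV f"
  shows "smooth_on UNIV (\<lambda>x. f (x, y))"
proof -
  have "bounded_linear (\<lambda>x::'a. (x, 0::'b))" by (intro bounded_linear_intros)
  from smooth_on_affine_compose[OF this assms, of "(0, y)"] show ?thesis by simp
qed

lemma smooth_on_id: "smooth_on UNIV (\<lambda>x::real. x)"
  unfolding smooth_on_def
proof
  show "Ck_on k UNIV (\<lambda>x::real. x)" for k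
  proof (cases k)
    case (Suc m)
    show ?thesis unfolding Suc
      by (rule Ck_on_SucI[where f' = "\<lambda>x v. v"]) (auto simp: Ck_on_const)
  qed simp
qed

lemma Ck_on_real_SucI:
  fixes f :: "real \<Rightarrow> real"
  assumes "\<And>x. (f has_real_derivative f' x) (at x)" "Ck_on k UNIV f'"
  shows "Ck_on (Suc k) UNIV f"
  by (rule Ck_on_SucI[where f' = "\<lambda>x v. f' x * v"])
    (use assms in \<open>auto simp: has_field_derivative_def intro!: Ck_on_mult Ck_on_const\<close>)

text \<open>A family closed under differentiation, up to smooth coefficients, gains one order of
  regularity for all its members at once. The index is the exponent m for \<open>flat\<close>, the
  shift of the parameter for \<open>hyp01\<close>, and a real exponent for the powers of y^2 +
  \<epsilon>.\<close>

lemma smooth_on_realI: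
  fixes f :: "'i \<Rightarrow> real \<Rightarrow> real"
  assumes "\<And>i x. (f i has_real_derivative (\<Sum>j\<in>J i. c i j x * f j x)) (at x)"
    and "\<And>i j. smooth_on UNIV (c i j)" and "\<And>i. finite (J i)"
  shows "smooth_on UNIV (f i)"
  unfolding smooth_on_def
proof
  fix k
  have sum: "Ck_on k UNIV (\<lambda>x. \<Sum>j\<in>A. g j x)"
    if "finite A" "\<And>j. Ck_on k UNIV (g j)" for A :: "'i set" and g :: "'i \<Rightarrow> real \<Rightarrow> real" and k
    using that(1) by induction (auto intro!: Ck_on_add that(2) Ck_on_const)
  show "Ck_on k UNIV (f i)"
  proof (induction k arbitrary: i)
    case 0
    then show ?case using assms(1)
      by (auto intro!: continuous_at_imp_continuous_on DERIV_isCont)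
  next
    case (Suc k)
    show ?case
      by (rule Ck_on_real_SucI[OF assms(1)])
        (use assms Suc in \<open>auto intro!: sum Ck_on_mult simp: smooth_on_def\<close>)
  qed
qed

lemma smooth_on_differentiable: "smooth_on UNIV f \<Longrightarrow> f differentiable (at x)"
  unfolding smooth_on_def by (metis Ck_on.simps(2) UNIV_I)

lemma smooth_on_continuous: "smooth_on UNIV f \<Longrightarrow> continuous_on UNIV f"
  unfolding smooth_on_def by (metis Ck_on.simps(1))

lemma smooth_on_continuous_frechet_derivative:
  "smooth_on UNIV f \<Longrightarrow> continuous_on UNIV (\<lambda>x. frechet_derivative f (at x) v)"
  unfolding smooth_on_def by (metis Ck_on.simps)

lemma smooth_on_continuous_grad: "smooth_on UNIV f \<Longrightarrow> continuous_on UNIV (grad f)"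
  unfolding grad_def by (intro continuous_intros smooth_on_continuous_frechet_derivative)

lemma smooth_on_real_deriv:
  fixes f :: "real \<Rightarrow> real"
  assumes "smooth_on UNIV f"
  shows "(f has_real_derivative deriv f x) (at x)" and "continuous_on UNIV (deriv f)"
proof -
  have d: "(f has_real_derivative deriv f x) (at x)" for x
    using smooth_on_differentiable[OF assms, of x] DERIV_deriv_iff_real_differentiable by blast
  then show "(f has_real_derivative deriv f x) (at x)" .
  have "frechet_derivative f (at x) 1 = deriv f x" for x
    using frechet_derivative_at[of f "(*) (deriv f x)" x] d[of x]
    by (metis has_field_derivative_def mult.right_neutral)
  then show "continuous_on UNIV (deriv f)"
    using smooth_on_continuous_frechet_derivative[OF assms, of 1] by simp
qed

section \<open>Gradients on slices and of products of functions of separate variables\<close>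

lemma inner_grad:
  assumes "f differentiable (at x)"
  shows "grad f x \<bullet> v = frechet_derivative f (at x) v"
proof -
  interpret linear "frechet_derivative f (at x)"
    using assms linear_frechet_derivative by blast
  have "frechet_derivative f (at x) v = frechet_derivative f (at x) (\<Sum>b\<in>Basis. (v \<bullet> b) *\<^sub>R b)"
    by (simp add: euclidean_representation)
  also have "\<dots> = (\<Sum>b\<in>Basis. (v \<bullet> b) * frechet_derivative f (at x) b)"
    by (simp add: sum scale)
  also have "\<dots> = grad f x \<bullet> v"
    unfolding grad_def inner_sum_left by (intro sum.cong refl) (simp add: inner_commute mult.commute)
  finally show ?thesis by simp
qed

lemma grad_eqI:
  assumes "(f has_derivative (\<lambda>v. g \<bullet> v)) (at x)"
  shows "grad f x = g"
proof -
  have "f differentiable (at x)" using assms by (auto simp: differentiable_def)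
  moreover have "frechet_derivative f (at x) = (\<lambda>v. g \<bullet> v)"
    using frechet_derivative_at[OF assms] by simp
  ultimately show ?thesis
    by (intro vector_eq_rdot[THEN iffD1]) (simp add: inner_grad)
qed

lemma has_derivative_grad:
  assumes "f differentiable (at x)"
  shows "(f has_derivative (\<lambda>v. grad f x \<bullet> v)) (at x)"
proof -
  have "frechet_derivative f (at x) = (\<lambda>v. grad f x \<bullet> v)"
    using inner_grad[OF assms] by auto
  then show ?thesis
    using assms frechet_derivative_works by metis
qed

lemma grad_slice:
  fixes f :: "'a::euclidean_space \<times> real \<Rightarrow> real"
  assumes "f differentiable (at (x, y))"
  shows "grad (\<lambda>x. f (x, y)) x = fst (grad f (x, y))"
    and "((\<lambda>y. f (x, y)) has_real_derivative snd (grad f (x, y))) (at y)"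
proof -
  note f = has_derivative_grad[OF assms]
  have "((\<lambda>x. (x, y)) has_derivative (\<lambda>v. (v, 0))) (at x)"
    by (auto intro!: derivative_eq_intros)
  from has_derivative_compose[OF this f] show "grad (\<lambda>x. f (x, y)) x = fst (grad f (x, y))"
    by (intro grad_eqI) (simp add: inner_prod_def)
  have "((\<lambda>y. (x, y)) has_derivative (\<lambda>v. (0, v))) (at y)"
    by (auto intro!: derivative_eq_intros)
  from has_derivative_compose[OF this f]
  show "((\<lambda>y. f (x, y)) has_real_derivative snd (grad f (x, y))) (at y)"
    by (simp add: inner_prod_def has_field_derivative_def)
qed

lemma grad_tensor:
  fixes f :: "'a::euclidean_space \<Rightarrow> real" and \<eta> :: "real \<Rightarrow> real"
  assumes "f differentiable (at (fst p))" and "(\<eta> has_real_derivative d) (at (snd p))"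
  shows "grad (\<lambda>p. f (fst p) * \<eta> (snd p)) p = (\<eta> (snd p) *\<^sub>R grad f (fst p), f (fst p) * d)"
proof -
  have f: "((\<lambda>p. f (fst p)) has_derivative (\<lambda>v. grad f (fst p) \<bullet> fst v)) (at p)"
    by (rule has_derivative_compose[where f=fst and g=f, OF _ has_derivative_grad[OF assms(1)]])
      (auto intro!: derivative_eq_intros)
  have \<eta>: "((\<lambda>p. \<eta> (snd p)) has_derivative (\<lambda>v. d * snd v)) (at p)"
    by (rule has_derivative_compose[where f=snd and g=\<eta>, OF _ assms(2)[unfolded has_field_derivative_def]])
      (auto intro!: derivative_eq_intros)
  show ?thesis
    by (rule grad_eqI, rule has_derivative_eq_rhs[OF has_derivative_mult[OF f \<eta>]])
      (auto simp: inner_prod_def fun_eq_iff algebra_simps)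
qed

text \<open>The derivatives of \<open>exp (-1/x)\<close> are combinations of the functions \<open>exp (-1/x) / x ^ m\<close>.\<close>

definition flat :: "nat \<Rightarrow> real \<Rightarrow> real" where
  "flat m x = (if x > 0 then exp (- (1 / x)) / x ^ m else 0)"

text \<open>The single term (1/x)^m / m! is at most the whole exponential series at 1/x.\<close>

lemma flat_le: "x > 0 \<Longrightarrow> flat m x \<le> fact m"
proof -
  assume x: "x > 0"
  have "(1/x)^m / fact m \<le> exp (1/x)"
  proof -
    have e: "(\<lambda>n. (1/x)^n / fact n) sums exp (1/x)"
      using exp_converges[of "1/x"] by (simp add: divide_inverse mult.commute)
    have "(\<Sum>n\<in>{m}. (1/x)^n / fact n) \<le> exp (1/x)"
      unfolding sums_unique[OF e]
      using x by (intro sum_le_suminf sums_summable[OF e]) auto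
    then show ?thesis by simp
  qed
  then show ?thesis using x by (simp add: flat_def exp_minus field_simps)
qed

lemma flat_nonneg: "flat m x \<ge> 0"
  by (simp add: flat_def)

lemma flat_Suc: "flat m x = x * flat (Suc m) x"
  by (simp add: flat_def)

lemma flat_DERIV:
  "(flat m has_real_derivative (- real m * flat (Suc m) x + flat (Suc (Suc m)) x)) (at x)"
proof (cases x "0::real" rule: linorder_cases)
  case less
  have "((\<lambda>x. 0) has_real_derivative 0) (at x)" by simp
  then have "(flat m has_real_derivative 0) (at x)"
    by (rule has_field_derivative_transform_within_open[of _ _ _ "{..<0}"])
      (use less in \<open>auto simp: flat_def\<close>)
  then show ?thesis using less by (simp add: flat_def)
next
  case greater
  have "((\<lambda>x. exp (- (1 / x)) / x ^ m) has_real_derivative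
      (- real m * flat (Suc m) x + flat (Suc (Suc m)) x)) (at x)"
    using greater
    by (auto intro!: derivative_eq_intros simp: flat_def power2_eq_square divide_simps)
      (cases m; simp add: field_simps)
  then show ?thesis
    by (rule has_field_derivative_transform_within_open[of _ _ _ "{0<..}"])
      (use greater in \<open>auto simp: flat_def\<close>)
next
  case equal
  \<comment> \<open>Two factors h come out of \<open>flat m h\<close>, leaving the bounded
    \<open>flat (Suc (Suc m)) h\<close>; one of them survives the division, so the difference
    quotient at 0 is O(|h|).\<close>
  have b: "\<bar>flat m h / h\<bar> \<le> fact (Suc (Suc m)) * \<bar>h\<bar>" for h
  proof (cases "h > 0")
    case True
    have "flat m h = h * h * flat (Suc (Suc m)) h" using flat_Suc[of m] flat_Suc[of "Suc m"] by simp
    then have "\<bar>flat m h / h\<bar> = h * flat (Suc (Suc m)) h"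
      using True flat_nonneg by (simp add: abs_mult)
    also have "\<dots> \<le> h * fact (Suc (Suc m))"
      by (intro mult_left_mono flat_le) (use True in auto)
    finally show ?thesis using True by (simp add: mult.commute)
  next
    case False
    have "0 \<le> fact (Suc (Suc m)) * \<bar>h\<bar>" by (intro mult_nonneg_nonneg) auto
    then show ?thesis using False by (simp add: flat_def)
  qed
  have lim: "((\<lambda>h. fact (Suc (Suc m)) * \<bar>h\<bar>) \<longlongrightarrow> (0::real)) (at 0)"
    by (auto intro!: tendsto_eq_intros)
  have "((\<lambda>h. flat m h / h) \<longlongrightarrow> 0) (at 0)"
    by (rule Lim_null_comparison[OF _ lim]) (use b in \<open>auto intro!: always_eventually\<close>)
  then show ?thesis
    using equal by (simp add: has_field_derivative_iff flat_def)
qed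

lemma smooth_on_flat: "smooth_on UNIV (flat m)"
proof -
  have "(flat i has_real_derivative
     (\<Sum>j\<in>{Suc i, Suc (Suc i)}. (if j = Suc i then - real i else 1) * flat j x)) (at x)" for i x
    using flat_DERIV[of i x] by simp
  then show ?thesis
    by (rule smooth_on_realI[where c="\<lambda>i j x. if j = Suc i then - real i else 1"]) 
      (auto simp: smooth_on_const)
qed

section \<open>The extension profile\<close>

text \<open>The confluent hypergeometric limit function 0F1(; a; z). It is the power series part of
  the modified Bessel functions with the fractional power split off, hence smooth on the whole line
  when z is a multiple of y^2.\<close>

definition hyp01 :: "real \<Rightarrow> real \<Rightarrow> real" where
  "hyp01 a z = (\<Sum>k. inverse (fact k * pochhammer a k) * z ^ k)"

lemma summable_hyp01:
  fixes a z :: real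
  assumes a: "a > 0"
  shows "summable (\<lambda>k. inverse (fact k * pochhammer a k) * z ^ k)"
\<comment> \<open>The ratio of consecutive terms is |z| / ((n + 1)(a + n)), which is at most 1/2
  once n a >= 2 |z|.\<close>
proof (rule summable_ratio_test[where c="1/2" and N="nat \<lceil>2 * \<bar>z\<bar> / a\<rceil>"])
  fix n assume n: "nat \<lceil>2 * \<bar>z\<bar> / a\<rceil> \<le> n"
  define D where "D = fact n * pochhammer a n"
  have D: "D > 0" using a by (auto simp: D_def pochhammer_pos)
  have "2 * \<bar>z\<bar> / a \<le> n" using n by linarith
  then have "2 * \<bar>z\<bar> \<le> n * a" using a by (simp add: field_simps)
  also have "\<dots> \<le> (n + 1) * (a + n)" using a by (simp add: algebra_simps)
  finally have z: "2 * \<bar>z\<bar> \<le> (n + 1) * (a + n)" .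
  have p: "0 < (real n + 1) * (a + n)" using a by simp
  have e: "fact (Suc n) * pochhammer a (Suc n) = ((real n + 1) * (a + n)) * D"
    by (simp add: D_def pochhammer_Suc algebra_simps)
  have "norm (inverse (fact (Suc n) * pochhammer a (Suc n)) * z ^ Suc n)
      = (\<bar>z\<bar> / ((real n + 1) * (a + n))) * (inverse D * \<bar>z\<bar> ^ n)"
    unfolding e using D a by (simp add: abs_mult power_abs field_simps)
  also have "\<dots> \<le> (1/2) * (inverse D * \<bar>z\<bar> ^ n)"
    using z p D by (intro mult_right_mono) (auto simp: field_simps)
  finally show "norm (inverse (fact (Suc n) * pochhammer a (Suc n)) * z ^ Suc n)
      \<le> 1/2 * norm (inverse (fact n * pochhammer a n) * z ^ n)"
    using D pochhammer_pos[OF a, of n] by (simp add: D_def abs_mult power_abs)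
qed auto

lemma hyp01_DERIV:
  assumes a: "a > 0"
  shows "(hyp01 a has_real_derivative hyp01 (a + 1) z / a) (at z)"
proof -
  have "diffs (\<lambda>k. inverse (fact k * pochhammer a k)) n = inverse (fact n * pochhammer (a + 1) n) / a"
    for n
  proof -
    have "x * inverse (x * y * (a * z)) = inverse (y * z) / a" if "x > 0" for x y z :: real
      using that a by (simp add: field_simps)
    from this[of "real (Suc n)" "fact n" "pochhammer (a + 1) n"] show ?thesis
      by (simp add: diffs_def pochhammer_rec del: of_nat_Suc)
  qed
  then have "(\<Sum>n. diffs (\<lambda>k. inverse (fact k * pochhammer a k)) n * z ^ n)
      = (\<Sum>n. inverse (fact n * pochhammer (a + 1) n) * z ^ n / a)" by simp
  also have "\<dots> = hyp01 (a + 1) z / a"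
    unfolding hyp01_def using a by (intro suminf_divide summable_hyp01) auto
  finally show ?thesis
    using termdiffs_strong_converges_everywhere[OF summable_hyp01[OF a], of z]
    by (simp add: hyp01_def[abs_def])
qed

text \<open>This is the differential equation z w'' + a w' = w of w = 0F1(; a; z), since w' and w''
  are the multiples of \<open>hyp01 (a + 1)\<close> and \<open>hyp01 (a + 2)\<close> given by
  \<open>hyp01_DERIV\<close>. Coefficients are compared after splitting off the common term of
  degree 0.\<close>

lemma hyp01_contiguous:
  assumes a: "a > 0"
  shows "hyp01 a z = hyp01 (a + 1) z + z * hyp01 (a + 2) z / (a * (a + 1))"
proof -
  let ?c = "\<lambda>a k. inverse (fact k * pochhammer a k) :: real"
  have s: "summable (\<lambda>k. ?c a k * z^k - ?c (a+1) k * z^k)"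
    using a by (intro summable_diff summable_hyp01) auto
  have d: "?c a (Suc k) - ?c (a+1) (Suc k) = ?c (a+2) k / (a * (a+1))" for k
  proof -
    have p: "pochhammer a (Suc k) = a * pochhammer (a+1) k"
      "pochhammer (a+1) (Suc k) = pochhammer (a+1) k * (a + 1 + k)"
      "pochhammer (a+1) (Suc k) = (a+1) * pochhammer (a+2) k"
      using pochhammer_rec[of "a+1" k]
      by (simp_all add: pochhammer_rec[of a] pochhammer_Suc[of "a+1" k] add.assoc)
    define P where "P = pochhammer (a+1) k"
    have P: "P > 0" using a by (simp add: P_def pochhammer_pos)
    have P2: "pochhammer (a+2) k = P * (a + 1 + k) / (a + 1)"
      using p(2,3) a by (simp add: P_def field_simps)
    have pos: "a + 1 + k > 0" using a by simp
    show ?thesis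
      unfolding P2 p(1,2) P_def[symmetric] using P a pos by (simp add: divide_simps)
  qed
  have "hyp01 a z - hyp01 (a+1) z = (\<Sum>k. ?c a k * z^k - ?c (a+1) k * z^k)"
    unfolding hyp01_def using a by (intro suminf_diff summable_hyp01) auto
  also have "\<dots> = (\<Sum>k. ?c a (Suc k) * z^Suc k - ?c (a+1) (Suc k) * z^Suc k)"
    using suminf_split_head[OF s] by simp
  also have "\<dots> = (\<Sum>k. (?c (a+2) k * z^k) * (z / (a * (a+1))))"
    by (intro arg_cong[where f=suminf] ext, simp only: left_diff_distrib[symmetric] d) simp
  also have "\<dots> = hyp01 (a+2) z * (z / (a * (a+1)))"
    unfolding hyp01_def using a by (intro suminf_mult2[symmetric] summable_hyp01) auto
  finally show ?thesis by (simp add: algebra_simps)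
qed

lemma hyp01_ge:
  assumes "a > 0" "z \<ge> 0"
  shows "1 + z / a \<le> hyp01 a z"
proof -
  have "(\<Sum>k<2. inverse (fact k * pochhammer a k) * z ^ k) \<le> hyp01 a z"
    unfolding hyp01_def using assms
    by (intro sum_le_suminf summable_hyp01) (auto simp: pochhammer_pos less_imp_le)
  then show ?thesis by (simp add: numeral_2_eq_2 field_simps)
qed

lemma hyp01_0: "hyp01 a 0 = 1"
  unfolding hyp01_def using powser_zero[of "\<lambda>k. inverse (fact k * pochhammer a k)"] by simp

lemma hyp01_sq_DERIV:
  assumes "a > 0"
  shows "((\<lambda>y. hyp01 a (m * y\<^sup>2)) has_real_derivative (2 * m * y / a) * hyp01 (a + 1) (m * y\<^sup>2)) (at y)"
proof -
  have "((\<lambda>y. m * y\<^sup>2) has_real_derivative (2 * m * y)) (at y)"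
    by (auto intro!: derivative_eq_intros)
  from DERIV_chain2[OF hyp01_DERIV[OF assms] this] show ?thesis by (simp add: mult_ac)
qed

lemma smooth_on_hyp01_sq:
  assumes "a > 0"
  shows "smooth_on UNIV (\<lambda>y. hyp01 a (m * y\<^sup>2))"
proof -
  let ?f = "\<lambda>n y. hyp01 (a + real n) (m * y\<^sup>2)"
  have "(?f n has_real_derivative (\<Sum>j\<in>{Suc n}. (2 * m / (a + real n)) * y * ?f j y)) (at y)" for n y
    using hyp01_sq_DERIV[of "a + real n" m y] assms by (simp add: add_ac)
  then have "smooth_on UNIV (?f 0)"
    by (rule smooth_on_realI[where c="\<lambda>n j y. (2 * m / (a + real n)) * y"])
      (auto intro!: smooth_on_mult[OF smooth_on_const smooth_on_id] simp del: times_divide_eq_left)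
  then show ?thesis by simp
qed

text \<open>With \<open>z = y\<^sup>2 / 4\<close>, the functions \<open>hyp01 (1 - s) z\<close> and \<open>y powr (2 * s) * hyp01 (1 + s) z\<close>
  are multiples of \<open>y\<^sup>s I\<^bsub>-s\<^esub>(y)\<close> and \<open>y\<^sup>s I\<^bsub>s\<^esub>(y)\<close>; \<open>profile_flux\<close> is \<open>y powr (1 - 2 * s)\<close> times
  the derivative of \<open>profile\<close>.\<close>

definition profile :: "real \<Rightarrow> real \<Rightarrow> real \<Rightarrow> real" where
  "profile s c y = hyp01 (1 - s) (1/4 * y\<^sup>2) - c * (y powr (2 * s) * hyp01 (1 + s) (1/4 * y\<^sup>2))"

definition profile_flux :: "real \<Rightarrow> real \<Rightarrow> real \<Rightarrow> real" where
  "profile_flux s c y = y powr (2 - 2 * s) / (2 * (1 - s)) * hyp01 (2 - s) (1/4 * y\<^sup>2)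
     - c * (2 * s * hyp01 (1 + s) (1/4 * y\<^sup>2) + y\<^sup>2 / (2 * (1 + s)) * hyp01 (2 + s) (1/4 * y\<^sup>2))"

context
  fixes s :: real
  assumes s: "0 < s" "s < 1"
begin

lemma profile_A_DERIV:
  assumes "y > 0"
  shows "((\<lambda>y. hyp01 (1 - s) (1/4 * y\<^sup>2)) has_real_derivative
    y powr (2 * s - 1) * (y powr (2 - 2 * s) / (2 * (1 - s)) * hyp01 (2 - s) (1/4 * y\<^sup>2))) (at y)"
proof -
  have "y powr (2 * s - 1) * y powr (2 - 2 * s) = y"
    using assms by (simp add: powr_add[symmetric])
  then have e: "y powr (2 * s - 1) * (y powr (2 - 2 * s) / (2 * (1 - s)) * hyp01 (2 - s) (1/4 * y\<^sup>2))
     = (2 * (1/4) * y / (1 - s)) * hyp01 (1 - s + 1) (1/4 * y\<^sup>2)"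
    by (simp add: mult.assoc[symmetric] algebra_simps)
  show ?thesis unfolding e using s by (intro hyp01_sq_DERIV) simp
qed

lemma profile_A_flux_DERIV:
  assumes "y > 0"
  shows "((\<lambda>y. y powr (2 - 2 * s) / (2 * (1 - s)) * hyp01 (2 - s) (1/4 * y\<^sup>2)) has_real_derivative
    y powr (1 - 2 * s) * hyp01 (1 - s) (1/4 * y\<^sup>2)) (at y)"
proof -
  have p: "y powr (2 - 2 * s) = y * y powr (1 - 2 * s)"
    using assms powr_add[of y 1 "1 - 2 * s"] by simp
  have c: "hyp01 (1 - s) (1/4 * y\<^sup>2) = hyp01 (2 - s) (1/4 * y\<^sup>2)
      + y\<^sup>2 / 4 * hyp01 (3 - s) (1/4 * y\<^sup>2) / ((1 - s) * (2 - s))"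
    using hyp01_contiguous[of "1 - s" "1/4 * y\<^sup>2"] s by (simp add: algebra_simps)
  have d: "((\<lambda>y. y powr (2 - 2 * s) / (2 * (1 - s))) has_real_derivative y powr (1 - 2 * s)) (at y)"
  proof -
    have "((\<lambda>y. y powr (2 - 2 * s)) has_real_derivative (2 * (1 - s)) * y powr (1 - 2 * s)) (at y)"
      using assms by (auto intro!: derivative_eq_intros)
    from DERIV_cdivide[OF this, of "2 * (1 - s)"] show ?thesis using s by simp
  qed
  have "2 - s > 0" using s by simp
  from DERIV_mult[OF d hyp01_sq_DERIV[OF this, of "1/4" y]]
  have "((\<lambda>y. y powr (2 - 2 * s) / (2 * (1 - s)) * hyp01 (2 - s) (1/4 * y\<^sup>2)) has_real_derivative
     y powr (1 - 2 * s) * hyp01 (2 - s) (1/4 * y\<^sup>2)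
     + (2 * (1/4) * y / (2 - s) * hyp01 (3 - s) (1/4 * y\<^sup>2)) * (y powr (2 - 2 * s) / (2 * (1 - s)))) (at y)"
    by (simp add: add_ac)
  then show ?thesis
    by (rule DERIV_cong) (unfold c p, use s in \<open>simp add: field_simps power2_eq_square\<close>)
qed

lemma profile_B_DERIV:
  assumes "y > 0"
  shows "((\<lambda>y. y powr (2 * s) * hyp01 (1 + s) (1/4 * y\<^sup>2)) has_real_derivative
    y powr (2 * s - 1) * (2 * s * hyp01 (1 + s) (1/4 * y\<^sup>2) + y\<^sup>2 / (2 * (1 + s)) * hyp01 (2 + s) (1/4 * y\<^sup>2))) (at y)"
proof -
  have p: "y powr (2 * s) = y * y powr (2 * s - 1)"
    using assms powr_add[of y 1 "2 * s - 1"] by simp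
  have d: "((\<lambda>y. y powr (2 * s)) has_real_derivative 2 * s * y powr (2 * s - 1)) (at y)"
    using assms s by (auto intro!: derivative_eq_intros)
  have "1 + s > 0" using s by simp
  from DERIV_mult[OF d hyp01_sq_DERIV[OF this, of "1/4" y]] show ?thesis
    by (rule DERIV_cong) (unfold p, use s in \<open>simp add: field_simps power2_eq_square add_ac\<close>)
qed

lemma profile_B_flux_DERIV:
  "((\<lambda>y. 2 * s * hyp01 (1 + s) (1/4 * y\<^sup>2) + y\<^sup>2 / (2 * (1 + s)) * hyp01 (2 + s) (1/4 * y\<^sup>2)) has_real_derivative
    y * hyp01 (1 + s) (1/4 * y\<^sup>2)) (at y)"
proof -
  have c: "hyp01 (1 + s) (1/4 * y\<^sup>2) = hyp01 (2 + s) (1/4 * y\<^sup>2)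
      + y\<^sup>2 / 4 * hyp01 (3 + s) (1/4 * y\<^sup>2) / ((1 + s) * (2 + s))"
    using hyp01_contiguous[of "1 + s" "1/4 * y\<^sup>2"] s by (simp add: algebra_simps)
  have p: "1 + s > 0" "2 + s > 0" using s by auto
  have id: "2 * (\<sigma> - 1) * (2 * (1/4) * y / \<sigma> * P) + (y / \<sigma> * P + 2 * (1/4) * y / \<tau> * Q * (y\<^sup>2 / (2 * \<sigma>)))
      = y * (P + y\<^sup>2 / 4 * Q / (\<sigma> * \<tau>))" if "\<sigma> > 0" "\<tau> > 0" for \<sigma> \<tau> y P Q :: real
    using that by (simp add: field_simps power2_eq_square)
  have d: "((\<lambda>y. y\<^sup>2 / (2 * (1 + s))) has_real_derivative y / (1 + s)) (at y)"
  proof -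
    have "((\<lambda>y. y\<^sup>2) has_real_derivative 2 * y) (at y)"
      by (auto intro!: derivative_eq_intros)
    from DERIV_cdivide[OF this, of "2 * (1 + s)"] show ?thesis
      by (rule DERIV_cong) (use s in \<open>simp add: field_simps\<close>)
  qed
  from DERIV_add[OF DERIV_cmult[OF hyp01_sq_DERIV[OF p(1), of "1/4" y], of "2 * s"] 
      DERIV_mult[OF d hyp01_sq_DERIV[OF p(2), of "1/4" y]]] 
  show ?thesis
  proof (rule DERIV_cong)
    have "2 + s + 1 = 3 + s" "1 + s + 1 = 2 + s" by auto
    then show "2 * s * (2 * (1 / 4) * y / (1 + s) * hyp01 (1 + s + 1) (1 / 4 * y\<^sup>2)) +
    (y / (1 + s) * hyp01 (2 + s) (1 / 4 * y\<^sup>2) +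
     2 * (1 / 4) * y / (2 + s) * hyp01 (2 + s + 1) (1 / 4 * y\<^sup>2) * (y\<^sup>2 / (2 * (1 + s)))) =
    y * hyp01 (1 + s) (1 / 4 * y\<^sup>2)" 
      using id[of "1 + s" "2 + s" y "hyp01 (2 + s) (1 / 4 * y\<^sup>2)" "hyp01 (3 + s) (1 / 4 * y\<^sup>2)"] p
      unfolding c by (simp only:) simp
  qed
qed

text \<open>Together with \<open>profile_flux_DERIV\<close> this is the equation (y^(1-2s)
  \<theta>')' = y^(1-2s) \<theta> written as a first-order system; both unknowns extend continuously
  to y = 0.\<close>

lemma profile_DERIV:
  "y > 0 \<Longrightarrow> (profile s c has_real_derivative y powr (2 * s - 1) * profile_flux s c y) (at y)"
  unfolding profile_def[abs_def] profile_flux_def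
  by (rule DERIV_cong[OF DERIV_diff[OF profile_A_DERIV DERIV_cmult[OF profile_B_DERIV]]])
    (auto simp: algebra_simps)

lemma profile_flux_DERIV:
  "y > 0 \<Longrightarrow> (profile_flux s c has_real_derivative y powr (1 - 2 * s) * profile s c y) (at y)"
proof -
  assume y: "y > 0"
  have "y powr (1 - 2 * s) * y powr (2 * s) = y"
    using y by (simp add: powr_add[symmetric])
  then have *: "y powr (1 - 2 * s) * (y powr (2 * s) * x) = y * x" for x by (metis mult.assoc)
  show ?thesis
    unfolding profile_def profile_flux_def[abs_def]
    by (rule DERIV_cong[OF DERIV_diff[OF profile_A_flux_DERIV[OF y] DERIV_cmult[OF profile_B_flux_DERIV]]])
      (simp add: right_diff_distrib * mult.left_commute[of _ c])
qed

lemma continuous_on_hyp01_sq: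
  assumes "a > 0"
  shows "continuous_on S (\<lambda>y. hyp01 a (m * y\<^sup>2))"
  using smooth_on_continuous[OF smooth_on_hyp01_sq[OF assms]] continuous_on_subset by blast

lemma profile_0: "profile s c 0 = 1"
  using s by (simp add: profile_def hyp01_0)

lemma profile_flux_0: "profile_flux s c 0 = - (2 * s * c)"
  using s by (simp add: profile_flux_def hyp01_0)

lemma continuous_on_profile: "continuous_on {0..} (profile s c)"
  unfolding profile_def[abs_def] using s
  by (intro continuous_intros continuous_on_hyp01_sq continuous_on_powr') auto

lemma borel_measurable_profile:
  "profile s c \<in> borel_measurable borel" "profile_flux s c \<in> borel_measurable borel"
proof -
  have [measurable]: "(\<lambda>y. hyp01 a (1/4 * y\<^sup>2)) \<in> borel_measurable borel" if "a > 0" for a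
    by (rule borel_measurable_continuous_onI[OF continuous_on_hyp01_sq[OF that]])
  have "0 < 1 - s" "0 < 1 + s" "0 < 2 - s" "0 < 2 + s" using s by auto
  note [measurable] = this
  show "profile s c \<in> borel_measurable borel" "profile_flux s c \<in> borel_measurable borel"
    unfolding profile_def[abs_def] profile_flux_def[abs_def] by measurable
qed

lemma continuous_on_profile_flux: "continuous_on {0..} (profile_flux s c)"
  unfolding profile_flux_def[abs_def] using s
  by (intro continuous_intros continuous_on_hyp01_sq continuous_on_powr') auto

end

text \<open>Here q stands for y^(1-2s) \<theta>'. At infinity only the product of q and \<theta> has
  to vanish, so that the constant profile 1 with zero flux qualifies for \<mu> = 0.\<close>

definition decaying_profile :: "real \<Rightarrow> real \<Rightarrow> real \<Rightarrow> (real \<Rightarrow> real) \<Rightarrow> (real \<Rightarrow> real) \<Rightarrow> bool" where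
  "decaying_profile s \<kappa> \<mu> \<theta> q \<longleftrightarrow>
     \<theta> \<in> borel_measurable borel \<and> q \<in> borel_measurable borel \<and> \<theta> 0 = 1 \<and> q 0 = - (\<kappa> * \<mu> powr s) \<and>
     continuous_on {0..} \<theta> \<and> continuous_on {0..} q \<and>
     (\<forall>y>0. (\<theta> has_real_derivative y powr (2 * s - 1) * q y) (at y)) \<and>
     (\<forall>y>0. (q has_real_derivative \<mu> * y powr (1 - 2 * s) * \<theta> y) (at y)) \<and>
     (\<forall>y\<ge>0. 0 \<le> \<theta> y \<and> \<theta> y \<le> 1) \<and> (\<forall>y\<ge>0. - (\<kappa> * \<mu> powr s) \<le> q y \<and> q y \<le> 0) \<and>
     ((\<lambda>y. q y * \<theta> y) \<longlongrightarrow> 0) at_top"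

text \<open>Two solutions have constant Wronskian, so the quotient of the two Bessel-type solutions
  decreases; subtracting the right multiple leaves the decaying solution.\<close>

lemma profile_decay_exists:
  assumes s: "0 < s" "s < 1"
  shows "\<exists>c K. \<forall>y>0. 0 \<le> profile s c y \<and> profile s c y \<le> K / y\<^sup>2"
proof -
  define A where "A = (\<lambda>y. hyp01 (1 - s) (1/4 * y\<^sup>2))"
  define E where "E = (\<lambda>y. hyp01 (1 + s) (1/4 * y\<^sup>2))"
  define B where "B = (\<lambda>y. y powr (2 * s) * E y)"
  define qA where "qA = (\<lambda>y. y powr (2 - 2 * s) / (2 * (1 - s)) * hyp01 (2 - s) (1/4 * y\<^sup>2))"
  define qB where "qB = (\<lambda>y. 2 * s * E y + y\<^sup>2 / (2 * (1 + s)) * hyp01 (2 + s) (1/4 * y\<^sup>2))"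
  have ge1: "hyp01 a (1/4 * y\<^sup>2) \<ge> 1" if "a > 0" for a y
  proof -
    have "0 \<le> 1/4 * y\<^sup>2 / a" using that by (intro divide_nonneg_pos) auto
    then show ?thesis using hyp01_ge[OF that, of "1/4 * y\<^sup>2"] by fastforce
  qed
  have dA: "(A has_real_derivative y powr (2 * s - 1) * qA y) (at y)" if "y > 0" for y
    using profile_A_DERIV[OF s that] by (simp add: A_def qA_def)
  have dqA: "(qA has_real_derivative y powr (1 - 2 * s) * A y) (at y)" if "y > 0" for y
    using profile_A_flux_DERIV[OF s that] by (simp add: A_def qA_def)
  have dB: "(B has_real_derivative y powr (2 * s - 1) * qB y) (at y)" if "y > 0" for y
    using profile_B_DERIV[OF s that] by (simp add: B_def qB_def E_def)
  have dqB: "(qB has_real_derivative y powr (1 - 2 * s) * B y) (at y)" if "y > 0" for y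
  proof -
    have "y powr (1 - 2 * s) * y powr (2 * s) = y"
      using that by (simp add: powr_add[symmetric])
    then have "y powr (1 - 2 * s) * B y = y * E y" by (simp add: B_def mult.assoc[symmetric])
    then show ?thesis using profile_B_flux_DERIV[OF s, of y] by (simp add: qB_def E_def)
  qed
  have cA: "continuous_on {0..} A" and cB: "continuous_on {0..} B"
    and cqA: "continuous_on {0..} qA" and cqB: "continuous_on {0..} qB"
    unfolding A_def B_def E_def qA_def qB_def using s
    by (intro continuous_intros continuous_on_hyp01_sq[OF s] continuous_on_powr'; simp)+
  \<comment> \<open>The Wronskian is written with fluxes, which are continuous up to y = 0; its
    constant value is read off there from A = 1, B = 0, qA = 0, qB = 2s.\<close>
  have W: "qA y * B y - A y * qB y = - 2 * s" if "y > 0" for y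
  proof -
    have cont: "continuous_on {0..y} (\<lambda>y. qA y * B y - A y * qB y)"
      using cA cB cqA cqB by (auto intro!: continuous_intros elim: continuous_on_subset)
    have "((\<lambda>y. qA y * B y - A y * qB y) has_real_derivative 0) (at x)" if "0 < x" for x
      by (rule DERIV_cong[OF DERIV_diff[OF DERIV_mult[OF dqA dB] DERIV_mult[OF dA dqB]]])
        (use that in \<open>auto simp: algebra_simps\<close>)
    from DERIV_isconst_end[OF that cont] this
    have "qA y * B y - A y * qB y = qA 0 * B 0 - A 0 * qB 0" by auto
    also have "\<dots> = - 2 * s" by (simp add: A_def qA_def B_def qB_def E_def hyp01_0)
    finally show ?thesis .
  qed
  have A1: "A y \<ge> 1" for y unfolding A_def using s by (intro ge1) auto
  have E1: "E y \<ge> 1 + y\<^sup>2 / (4 * (1 + s))" for y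
    using hyp01_ge[of "1 + s" "1/4 * y\<^sup>2"] s by (simp add: E_def)
  have Bpos: "B y > 0" if "y > 0" for y
    using that ge1[of "1 + s" y] s by (auto simp: B_def E_def intro!: mult_pos_pos)
  define C where "C = 1 / (4 * (1 + s))"
  have C: "C > 0" using s by (simp add: C_def)
  have Blow: "B y \<ge> C * (y powr (2 * s) * y\<^sup>2)" if "y > 0" for y
  proof -
    have "y powr (2 * s) * (C * y\<^sup>2) \<le> y powr (2 * s) * E y"
      using E1[of y] by (intro mult_left_mono) (auto simp: C_def)
    then show ?thesis by (simp add: B_def mult_ac)
  qed
  have qBpos: "qB y \<ge> 0" if "y > 0" for y
    using ge1[of "1 + s" y] ge1[of "2 + s" y] s by (auto simp: qB_def E_def)
  have Bmono: "B y \<le> B t" if "0 < y" "y \<le> t" for y t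
  proof (rule DERIV_nonneg_imp_nondecreasing[OF that(2)])
    fix z assume "y \<le> z" "z \<le> t"
    with that dB[of z] qBpos[of z] show "\<exists>d. (B has_real_derivative d) (at z) \<and> 0 \<le> d"
      by (auto intro!: exI[of _ "z powr (2 * s - 1) * qB z"])
  qed
  define r where "r = (\<lambda>y. A y / B y)"
  have dr: "(r has_real_derivative - (2 * s * y powr (2 * s - 1) / (B y * B y))) (at y)" if "y > 0" for y
  proof -
    have "(y powr (2 * s - 1) * qA y) * B y - A y * (y powr (2 * s - 1) * qB y)
        = y powr (2 * s - 1) * (qA y * B y - A y * qB y)" by (simp add: algebra_simps)
    also have "\<dots> = - (2 * s * y powr (2 * s - 1))" unfolding W[OF that] by simp
    finally have e: "(y powr (2 * s - 1) * qA y) * B y - A y * (y powr (2 * s - 1) * qB y)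
      = - (2 * s * y powr (2 * s - 1))" .
    show ?thesis
      unfolding r_def
      by (rule DERIV_cong[OF DERIV_divide[OF dA[OF that] dB[OF that]]])
        (use Bpos[OF that] in \<open>auto simp: e\<close>)
  qed
  have rpos: "r y > 0" if "y > 0" for y
    using A1[of y] Bpos[OF that] by (simp add: r_def)
  have rmono: "r t \<le> r y" if "0 < y" "y \<le> t" for y t
  proof (rule DERIV_nonpos_imp_nonincreasing[OF that(2)])
    fix z assume "y \<le> z" "z \<le> t"
    with that dr[of z] s show "\<exists>d. (r has_real_derivative d) (at z) \<and> d \<le> 0"
      by (auto intro!: exI[of _ "- (2 * s * z powr (2 * s - 1) / (B z * B z))"])
  qed
  \<comment> \<open>The quotient r decreases, so this infimum is its limit at infinity, and A - c B
    = B (r - c) stays nonnegative.\<close>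
  define c where "c = Inf (r ` {0<..})"
  have bdd: "bdd_below (r ` {0<..})" 
    by (rule bdd_belowI2[of _ 0], rule less_imp_le, rule rpos) simp
  have cle: "c \<le> r y" if "y > 0" for y
    unfolding c_def using that bdd by (intro cInf_lower) auto
  \<comment> \<open>The decrease of r beyond y is at most that of m / t^2, because B(t)^2 >= B(y) C
    t^(2s+2) for t >= y. Hence r - m / t^2 is nondecreasing there and r(y) exceeds c by at most m /
    y^2. The B(y) in the denominator of m later cancels the factor B(y) in B (r - c), which leaves
    the bound (s / C) / y^2.\<close>
  have up: "r y - s / (C * B y) / y\<^sup>2 \<le> c" if y: "y > 0" for y
  proof -
    define m where "m = s / (C * B y)"
    have m: "m > 0" using C Bpos[OF y] s by (simp add: m_def)
    have dm: "((\<lambda>t. r t - m / t\<^sup>2) has_real_derivative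
        - (2 * s * t powr (2 * s - 1) / (B t * B t)) + 2 * m / t ^ 3) (at t)" if "t > 0" for t
      using that by (auto intro!: derivative_eq_intros dr simp: field_simps power2_eq_square power3_eq_cube)
    have pos: "- (2 * s * t powr (2 * s - 1) / (B t * B t)) + 2 * m / t ^ 3 \<ge> 0" if t: "y \<le> t" for t
    proof -
      have t0: "t > 0" using t y by simp
      have "t powr (2 * s - 1) * t ^ 3 = t powr (2 * s) * t\<^sup>2"
        using t0 by (simp add: powr_diff power2_eq_square power3_eq_cube)
      then have "C * B y * (t powr (2 * s - 1) * t ^ 3) = B y * (C * (t powr (2 * s) * t\<^sup>2))"
        by (simp add: mult_ac)
      also have "\<dots> \<le> B t * B t"
        using Bmono[OF y t] Blow[OF t0] Bpos[OF y] Bpos[OF t0] C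
        by (intro mult_mono) auto
      finally have "C * B y * (t powr (2 * s - 1) * t ^ 3) \<le> B t * B t" .
      then have "t powr (2 * s - 1) / (B t * B t) \<le> 1 / (C * B y) / t ^ 3"
        using C Bpos[OF y] Bpos[OF t0] t0 by (simp add: field_simps)
      then have "2 * s * (t powr (2 * s - 1) / (B t * B t)) \<le> 2 * s * (1 / (C * B y) / t ^ 3)"
        using s by (intro mult_left_mono) auto
      then show ?thesis by (simp add: m_def)
    qed
    have "r y - m / y\<^sup>2 \<le> r T" if T: "T > 0" for T
    proof (cases "y \<le> T")
      case True
      have "r y - m / y\<^sup>2 \<le> r T - m / T\<^sup>2"
      proof (rule DERIV_nonneg_imp_nondecreasing[OF True])
        fix x assume "y \<le> x" "x \<le> T"
        then show "\<exists>d. ((\<lambda>t. r t - m / t\<^sup>2) has_real_derivative d) (at x) \<and> 0 \<le> d"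
          using dm[of x] pos[of x] y by auto
      qed
      also have "\<dots> \<le> r T" using m by simp
      finally show ?thesis .
    next
      case False
      then have "r y \<le> r T" using T by (intro rmono) auto
      moreover have "m / y\<^sup>2 \<ge> 0" using m by simp
      ultimately show ?thesis by linarith
    qed
    then show ?thesis unfolding c_def m_def[symmetric] by (intro cInf_greatest) auto
  qed
  have "0 \<le> profile s c y \<and> profile s c y \<le> (s / C) / y\<^sup>2" if y: "y > 0" for y
  proof -
    have "profile s c y = A y - c * B y" by (simp add: profile_def A_def B_def E_def)
    then have e: "profile s c y = B y * (r y - c)"
      using less_imp_neq[OF Bpos[OF y]] by (simp add: r_def right_diff_distrib)
    have "B y * (r y - c) \<le> B y * (s / (C * B y) / y\<^sup>2)"
      using up[OF y] Bpos[OF y] by (intro mult_left_mono) auto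
    also have "\<dots> = (s / C) / y\<^sup>2" using Bpos[OF y] C by simp
    finally show ?thesis unfolding e using cle[OF y] Bpos[OF y] by simp
  qed
  then show ?thesis by blast
qed

text \<open>As \<theta> >= 0, the flux increases. Were it positive somewhere, \<theta> would be
  nondecreasing from there on with limit 0, hence zero, against the positive derivative; so q <= 0
  and \<theta> decreases from 1. If c <= 0, then q would vanish identically and \<theta> could not
  decay. The constant 2 s c is minus the flux at 0.\<close>

lemma decaying_profile_exists:
  assumes s: "0 < s" "s < 1"
  shows "\<exists>c>0. decaying_profile s (2 * s * c) 1 (profile s c) (profile_flux s c)"
proof -
  obtain c K where th: "\<And>y. y > 0 \<Longrightarrow> 0 \<le> profile s c y \<and> profile s c y \<le> K / y\<^sup>2"
    using profile_decay_exists[OF s] by blast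
  define \<theta> where "\<theta> = profile s c"
  define q where "q = profile_flux s c"
  have m: "\<theta> \<in> borel_measurable borel" "q \<in> borel_measurable borel"
    using borel_measurable_profile[OF s] by (auto simp: \<theta>_def q_def)
  have d\<theta>: "(\<theta> has_real_derivative y powr (2 * s - 1) * q y) (at y)" if "y > 0" for y
    using profile_DERIV[OF s that] by (simp add: \<theta>_def q_def)
  have dq: "(q has_real_derivative y powr (1 - 2 * s) * \<theta> y) (at y)" if "y > 0" for y
    using profile_flux_DERIV[OF s that] by (simp add: \<theta>_def q_def)
  have c\<theta>: "continuous_on {0..} \<theta>" and cq: "continuous_on {0..} q"
    using continuous_on_profile[OF s] continuous_on_profile_flux[OF s] by (auto simp: \<theta>_def q_def)
  have \<theta>0: "\<theta> 0 = 1" and q0: "q 0 = - (2 * s * c)"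
    using profile_0[OF s] profile_flux_0[OF s] by (auto simp: \<theta>_def q_def)
  have pos: "\<theta> y \<ge> 0" if "y \<ge> 0" for y
    using th[of y] that \<theta>0 by (cases "y = 0") (auto simp: \<theta>_def)
  have lim: "(\<theta> \<longlongrightarrow> 0) at_top"
  proof (rule tendsto_sandwich[where f="\<lambda>_. 0" and h="\<lambda>y. K / y\<^sup>2"])
    show "((\<lambda>y::real. K / y\<^sup>2) \<longlongrightarrow> 0) at_top"
      by (intro tendsto_divide_0[OF tendsto_const] filterlim_at_top_imp_at_infinity
          filterlim_pow_at_top filterlim_ident) auto
  qed (use th in \<open>auto simp: \<theta>_def intro!: eventually_mono[OF eventually_gt_at_top[of 0]]\<close>)
  have qmono: "q x \<le> q y" if "0 \<le> x" "x \<le> y" for x y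
  proof (cases "x = y")
    case False
    have "continuous_on {x..y} q" using cq by (rule continuous_on_subset) (use that in auto)
    with that False show ?thesis
      by (intro DERIV_nonneg_imp_increasing_open[of x y q])
        (auto intro!: exI dq mult_nonneg_nonneg pos)
  qed simp
  have \<theta>mono: "\<theta> x \<le> \<theta> y" if "0 < x" "x \<le> y" "q x \<ge> 0" for x y
  proof (rule DERIV_nonneg_imp_nondecreasing[OF that(2)])
    fix z assume "x \<le> z" "z \<le> y"
    then show "\<exists>d. (\<theta> has_real_derivative d) (at z) \<and> 0 \<le> d"
      using d\<theta>[of z] qmono[of x z] that by (auto intro!: exI mult_nonneg_nonneg)
  qed
  have qneg: "q y \<le> 0" if y: "y \<ge> 0" for y
  proof (rule ccontr)
    assume "\<not> q y \<le> 0"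
    then have qz: "q z > 0" if "z \<ge> y" for z using qmono[OF y that] by simp
    have z0: "\<theta> z = 0" if z: "z \<ge> y + 1" for z
    proof -
      have "\<forall>\<^sub>F x in at_top. \<theta> z \<le> \<theta> x"
        using eventually_ge_at_top[of z]
        by eventually_elim (use z y qz[of z] in \<open>auto intro!: \<theta>mono\<close>)
      then have "\<theta> z \<le> 0" by (intro tendsto_lowerbound[OF lim]) auto
      then show ?thesis using pos[of z] z y by simp
    qed
    have "(\<theta> has_real_derivative 0) (at (y + 2))"
      by (rule has_field_derivative_transform_within_open[of "\<lambda>_. 0" _ _ "{y+1<..}"])
        (use z0 in auto)
    then have "(y + 2) powr (2 * s - 1) * q (y + 2) = 0"
      using d\<theta>[of "y + 2"] y DERIV_unique by force
    then show False using qz[of "y + 2"] y by simp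
  qed
  have \<theta>le: "\<theta> y \<le> 1" if "y \<ge> 0" for y
  proof (cases "y = 0")
    case False
    have "continuous_on {0..y} \<theta>" using c\<theta> by (rule continuous_on_subset) auto
    with that False have "\<theta> y \<le> \<theta> 0"
      by (intro DERIV_nonpos_imp_decreasing_open[of 0 y \<theta>])
        (auto intro!: exI d\<theta> mult_nonneg_nonpos qneg)
    then show ?thesis by (simp add: \<theta>0)
  qed (simp add: \<theta>0)
  have "c > 0"
  proof (rule ccontr)
    assume "\<not> c > 0"
    then have "2 * s * c \<le> 0" using s by (simp add: mult_nonneg_nonpos)
    then have "q y = 0" if "y \<ge> 0" for y using qneg[OF that] qmono[OF order.refl that] q0 by linarith
    then have q: "\<theta> y \<ge> 1" if "y \<ge> 0" for y
    proof (cases "y = 0")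
      case False
      have "continuous_on {0..y} \<theta>" using c\<theta> by (rule continuous_on_subset) auto
      with that False have "\<theta> 0 \<le> \<theta> y"
        by (intro DERIV_nonneg_imp_increasing_open[of 0 y \<theta>])
          (use \<open>\<And>y. 0 \<le> y \<Longrightarrow> q y = 0\<close> d\<theta> in force)+
      then show ?thesis by (simp add: \<theta>0)
    qed (simp add: \<theta>0)
    have "1 \<le> (0::real)"
      by (rule tendsto_lowerbound[OF lim]) (use q in \<open>auto intro!: eventually_mono[OF eventually_ge_at_top[of 0]]\<close>)
    then show False by simp
  qed
  moreover have "((\<lambda>y. q y * \<theta> y) \<longlongrightarrow> 0) at_top"
  proof (rule Lim_null_comparison)
    show "((\<lambda>y. 2 * s * c * \<theta> y) \<longlongrightarrow> 0) at_top" using tendsto_mult_left[OF lim, of "2 * s * c"] by simp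
    have "\<bar>q y\<bar> \<le> 2 * s * c" if "y \<ge> 0" for y
      using qneg[OF that] qmono[of 0 y] that q0 by linarith
    then show "\<forall>\<^sub>F y in at_top. norm (q y * \<theta> y) \<le> 2 * s * c * \<theta> y"
      by (intro eventually_mono[OF eventually_ge_at_top[of 0]]) (auto simp: abs_mult pos intro!: mult_right_mono)
  qed
  then have "decaying_profile s (2 * s * c) 1 \<theta> q"
    unfolding decaying_profile_def
    using m \<theta>0 q0 c\<theta> cq d\<theta> dq pos \<theta>le qneg qmono[of 0] by auto
  ultimately show ?thesis unfolding \<theta>_def q_def by blast
qed

text \<open>The substitution y -> sqrt \<mu> y multiplies the flux by (sqrt \<mu>)^(2s) = \<mu>^s,
  and this is where the power s of the eigenvalue comes from. At \<mu> = 0 it returns the constant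
  profile with zero flux, since \<open>0 powr s = 0\<close>.\<close>

lemma decaying_profile_scale:
  assumes \<theta>: "decaying_profile s \<kappa> 1 \<theta> q" and \<mu>: "\<mu> \<ge> 0"
  shows "decaying_profile s \<kappa> \<mu> (\<lambda>y. \<theta> (sqrt \<mu> * y)) (\<lambda>y. \<mu> powr s * q (sqrt \<mu> * y))"
proof (cases "\<mu> = 0")
  case True
  with \<theta> show ?thesis by (simp add: decaying_profile_def)
next
  case False
  define r where "r = sqrt \<mu>"
  have r: "r > 0" and \<mu>r: "\<mu> powr s = r powr (2 * s)" "\<mu> = r * r"
    using False \<mu> by (auto simp: r_def powr_half_sqrt[symmetric] powr_powr) (simp add: powr_half_sqrt)
  have d1: "((\<lambda>y. \<theta> (r * y)) has_real_derivative y powr (2 * s - 1) * (r powr (2 * s) * q (r * y))) (at y)"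
    if "y > 0" for y
  proof -
    have "((\<lambda>y. \<theta> (r * y)) has_real_derivative ((r * y) powr (2 * s - 1) * q (r * y)) * r) (at y)"
      by (rule DERIV_chain2[where g="\<lambda>y. r * y"])
        (use \<theta> r that in \<open>auto simp: decaying_profile_def intro!: derivative_eq_intros\<close>)
    moreover have "r powr (2 * s) = r * r powr (2 * s - 1)"
      using powr_add[of r 1 "2 * s - 1"] r by simp
    ultimately show ?thesis using r that by (simp add: powr_mult mult_ac)
  qed
  have d2: "((\<lambda>y. r powr (2 * s) * q (r * y)) has_real_derivative r * r * y powr (1 - 2 * s) * \<theta> (r * y)) (at y)"
    if "y > 0" for y
  proof -
    have "((\<lambda>y. q (r * y)) has_real_derivative ((r * y) powr (1 - 2 * s) * \<theta> (r * y)) * r) (at y)"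
      by (rule DERIV_chain2[where g="\<lambda>y. r * y"])
        (use \<theta> r that in \<open>auto simp: decaying_profile_def intro!: derivative_eq_intros\<close>)
    from DERIV_cmult[OF this, of "r powr (2 * s)"] show ?thesis
    proof (rule DERIV_cong)
      have "r powr (2 * s) * r powr (1 - 2 * s) = r"
        using r by (simp add: powr_add[symmetric])
      then have *: "r powr (2 * s) * (r powr (1 - 2 * s) * x) = r * x" for x by (metis mult.assoc)
      show "r powr (2 * s) * ((r * y) powr (1 - 2 * s) * \<theta> (r * y) * r) =
        r * r * y powr (1 - 2 * s) * \<theta> (r * y)"
        using r that by (simp add: powr_mult * mult.assoc)
    qed
  qed
  have c: "continuous_on {0..} (\<lambda>y. \<theta> (r * y))" "continuous_on {0..} (\<lambda>y. q (r * y))"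
    using \<theta> r by (auto simp: decaying_profile_def intro!: continuous_on_compose2[where g=\<theta> and t="{0..}"]
        continuous_on_compose2[where g=q and t="{0..}"] continuous_intros)
  have "((\<lambda>y. q (r * y) * \<theta> (r * y)) \<longlongrightarrow> 0) at_top"
    using \<theta> r by (intro filterlim_compose[where g="\<lambda>y. q y * \<theta> y" and f="\<lambda>y. r * y"])
      (auto simp: decaying_profile_def intro!: filterlim_tendsto_pos_mult_at_top[OF tendsto_const] filterlim_ident)
  from tendsto_mult_left[OF this, of "r powr (2 * s)"]
  have l: "((\<lambda>y. r powr (2 * s) * q (r * y) * \<theta> (r * y)) \<longlongrightarrow> 0) at_top" by (simp add: mult.assoc)
  have b: "- (\<kappa> * r powr (2 * s)) \<le> r powr (2 * s) * q (r * y)" "r powr (2 * s) * q (r * y) \<le> 0" if "y \<ge> 0" for y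
  proof -
    have qq: "- \<kappa> \<le> q (r * y)" "q (r * y) \<le> 0" using \<theta> r that by (auto simp: decaying_profile_def)
    show "r powr (2 * s) * q (r * y) \<le> 0" using qq by (intro mult_nonneg_nonpos) auto
    show "- (\<kappa> * r powr (2 * s)) \<le> r powr (2 * s) * q (r * y)"
      using mult_left_mono[OF qq(1), of "r powr (2 * s)"] by (simp add: mult.commute)
  qed
  show ?thesis
    \<comment> \<open>Two stages, so that the powers \<open>\<mu> powr s\<close> are rewritten
      before \<mu> itself becomes \<open>r * r\<close>.\<close>
    unfolding r_def[symmetric] decaying_profile_def \<mu>r(1) unfolding \<mu>r(2)
  proof (intro conjI allI impI)
    show "continuous_on {0..} (\<lambda>y. r powr (2 * s) * q (r * y))" using c by (intro continuous_intros)
    have [measurable]: "\<theta> \<in> borel_measurable borel" "q \<in> borel_measurable borel"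
      using \<theta> by (auto simp: decaying_profile_def)
    show "(\<lambda>y. \<theta> (r * y)) \<in> borel_measurable borel" "(\<lambda>y. r powr (2 * s) * q (r * y)) \<in> borel_measurable borel"
      by measurable
  qed (use d1 d2 c l b \<theta> r in \<open>auto simp: decaying_profile_def\<close>)
qed

lemma continuous_on_tendsto_at_right_0:
  assumes "continuous_on {0..} (F :: real \<Rightarrow> real)"
  shows "(F \<longlongrightarrow> F 0) (at_right 0)"
proof -
  have "(F \<longlongrightarrow> F 0) (at 0 within {0..})" using assms by (simp add: continuous_on)
  then show ?thesis by (rule tendsto_within_subset) auto
qed

lemma tendsto_at_right_ereal_0:
  assumes "continuous_on {0..} (F :: real \<Rightarrow> real)"
  shows "((F \<circ> real_of_ereal) \<longlongrightarrow> F 0) (at_right 0)"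
proof -
  show ?thesis using continuous_on_tendsto_at_right_0[OF assms] by (simp add: zero_ereal_def ereal_tendsto_simps1)
qed

text \<open>The energy of the profile is the boundary term of \<open>(q \<theta>)' = \<mu> y\<^sup>1\<^sup>-\<^sup>2\<^sup>s \<theta>\<^sup>2 + y\<^sup>1\<^sup>-\<^sup>2\<^sup>s \<theta>'\<^sup>2\<close>.\<close>

lemma decaying_profile_energy:
  assumes "decaying_profile s \<kappa> \<mu> \<theta> q" and "\<mu> \<ge> 0"
  shows "set_integrable lborel {0<..} (\<lambda>y. y powr (1 - 2 * s) * (\<mu> * (\<theta> y)\<^sup>2 + (y powr (2 * s - 1) * q y)\<^sup>2))"
    (is "set_integrable _ _ ?f")
proof -
  note \<theta> = assms(1)[unfolded decaying_profile_def]
  have "set_integrable lborel (einterval 0 \<infinity>) ?f"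
  \<comment> \<open>For a nonnegative integrand, integrability follows from the existence of the two
    endpoint limits of a primitive.\<close>
  proof (rule interval_integral_FTC_nonneg(1)[where F="\<lambda>y. q y * \<theta> y" and A="q 0 * \<theta> 0" and B=0])
    fix y assume "0 < ereal y" "ereal y < \<infinity>"
    then have y: "y > 0" by (simp add: zero_ereal_def)
    have "y powr (1 - 2 * s) * y powr (2 * s - 1) = 1"
      using y by (simp add: powr_add[symmetric])
    then have *: "y powr (1 - 2 * s) * (y powr (2 * s - 1) * z) = z" for z by (metis mult.assoc mult_1)
    have e: "\<mu> * y powr (1 - 2 * s) * \<theta> y * \<theta> y + y powr (2 * s - 1) * q y * q y = ?f y"
      by (simp add: power2_eq_square distrib_left * mult.assoc mult.left_commute[of "q y"])
    have "(\<theta> has_real_derivative y powr (2 * s - 1) * q y) (at y)"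
      "(q has_real_derivative \<mu> * y powr (1 - 2 * s) * \<theta> y) (at y)" using \<theta> y by auto
    note d = this
    show "((\<lambda>y. q y * \<theta> y) has_real_derivative ?f y) (at y)"
      using DERIV_mult[OF d(2) d(1)] by (simp only: e)
    show "isCont ?f y"
      using y by (intro continuous_intros DERIV_isCont[OF d(1)] DERIV_isCont[OF d(2)]) auto
  next
    show "(((\<lambda>y. q y * \<theta> y) \<circ> real_of_ereal) \<longlongrightarrow> q 0 * \<theta> 0) (at_right 0)"
      using \<theta> by (intro tendsto_at_right_ereal_0 continuous_intros) auto
    show "(((\<lambda>y. q y * \<theta> y) \<circ> real_of_ereal) \<longlongrightarrow> 0) (at_left \<infinity>)"
      using \<theta> by (simp add: ereal_tendsto_simps1)
    show "AE x in lborel. 0 < ereal x \<longrightarrow> ereal x < \<infinity> \<longrightarrow> 0 \<le> ?f x"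
      using \<open>\<mu> \<ge> 0\<close> by auto
  qed simp
  moreover have "einterval 0 \<infinity> = {0<..}"
    by (auto simp: einterval_def zero_ereal_def)
  ultimately show ?thesis by simp
qed

lemma decaying_profile_deriv:
  assumes "decaying_profile s \<kappa> \<mu> \<theta> q" "y > 0"
  shows "deriv \<theta> y = y powr (2 * s - 1) * q y"
  using assms by (auto simp: decaying_profile_def intro!: DERIV_imp_deriv)

text \<open>Differentiating \<theta>' = y^(2s-1) q recovers the second-order equation, and
  membership in the weighted space is the energy identity at \<mu> = 1. This makes \<kappa> a
  candidate for the description in \<open>kappa\<close>.\<close>

lemma extension_profile_decaying_profile:
  assumes "decaying_profile s \<kappa> 1 \<theta> q"
  shows "extension_profile s \<theta>"
    and "((\<lambda>y. - (y powr (1 - 2 * s) * deriv \<theta> y)) \<longlongrightarrow> \<kappa>) (at_right 0)"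
proof -
  note \<theta> = assms(1)[unfolded decaying_profile_def]
  note d = decaying_profile_deriv[OF assms]
  have dd: "(deriv \<theta> has_real_derivative \<theta> y - (1 - 2 * s) / y * deriv \<theta> y) (at y)" if y: "y > 0" for y
  proof -
    have pw: "y powr (2 * s - 1) * y powr (1 - 2 * s) = 1"
      using y by (simp add: powr_add[symmetric])
    have dp: "((\<lambda>y. y powr (2 * s - 1)) has_real_derivative (2 * s - 1) * y powr (2 * s - 1 - 1)) (at y)"
      using y by (auto intro!: derivative_eq_intros)
    have dq: "(q has_real_derivative y powr (1 - 2 * s) * \<theta> y) (at y)" using \<theta> y by simp
    have "((\<lambda>y. y powr (2 * s - 1) * q y) has_real_derivative
        (2 * s - 1) * y powr (2 * s - 1 - 1) * q y + y powr (1 - 2 * s) * \<theta> y * y powr (2 * s - 1)) (at y)"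
      by (rule DERIV_mult[OF dp dq])
    also have "(2 * s - 1) * y powr (2 * s - 1 - 1) * q y + y powr (1 - 2 * s) * \<theta> y * y powr (2 * s - 1)
      = \<theta> y - (1 - 2 * s) / y * deriv \<theta> y"
    proof -
      have "y powr (1 - 2 * s) * \<theta> y * y powr (2 * s - 1) = \<theta> y" using pw by (simp add: mult_ac)
      moreover have "(2 * s - 1) * y powr (2 * s - 1 - 1) * q y = - ((1 - 2 * s) / y * deriv \<theta> y)"
        using y unfolding d[OF y] powr_diff[of y "2 * s - 1" 1] by (simp add: field_simps)
      ultimately show ?thesis by simp
    qed
    finally show ?thesis
      by (rule has_field_derivative_transform_within_open[of _ _ _ "{0<..}"]) (use d y in auto)
  qed
  have "set_integrable lborel {0<..} (\<lambda>y. y powr (1 - 2 * s) * ((\<theta> y)\<^sup>2 + (deriv \<theta> y)\<^sup>2))"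
    using decaying_profile_energy[OF assms] d
    by (subst set_integrable_cong[OF refl refl, of _ _ "\<lambda>y. y powr (1 - 2 * s) * (1 * (\<theta> y)\<^sup>2 + (y powr (2 * s - 1) * q y)\<^sup>2)"]) auto
  moreover have "\<theta> field_differentiable (at y)" if "y > 0" for y
    using \<theta> that unfolding field_differentiable_def by blast
  moreover have "deriv \<theta> field_differentiable (at y) \<and>
        deriv (deriv \<theta>) y + (1 - 2 * s) / y * deriv \<theta> y - \<theta> y = 0" if "y > 0" for y
    using dd[OF that] DERIV_imp_deriv[OF dd[OF that]] unfolding field_differentiable_def by auto
  ultimately show "extension_profile s \<theta>"
    unfolding extension_profile_def using \<theta> by auto
  have "(q \<longlongrightarrow> - \<kappa>) (at_right 0)"
    using \<theta> continuous_on_tendsto_at_right_0[of q] by simp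
  from tendsto_minus[OF this] have "((\<lambda>y. - q y) \<longlongrightarrow> \<kappa>) (at_right 0)" by simp
  then show "((\<lambda>y. - (y powr (1 - 2 * s) * deriv \<theta> y)) \<longlongrightarrow> \<kappa>) (at_right 0)"
  proof (rule Lim_transform_eventually)
    show "\<forall>\<^sub>F y in at_right 0. - q y = - (y powr (1 - 2 * s) * deriv \<theta> y)"
    proof (rule eventually_at_rightI[of 0 1])
      fix y :: real assume "y \<in> {0<..<1}"
      then have y: "y > 0" by simp
      have "y powr (1 - 2 * s) * y powr (2 * s - 1) = 1"
        using y by (simp add: powr_add[symmetric])
      then show "- q y = - (y powr (1 - 2 * s) * deriv \<theta> y)"
        unfolding d[OF y] by (metis mult.assoc mult_1)
    qed simp
  qed
qed

section \<open>Uniqueness of the flux at 0 and the value of kappa\<close>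

lemma not_set_integrable_inverse:
  assumes "a > 0" "m > 0"
  shows "\<not> set_integrable lborel {a..} (\<lambda>y::real. m / y)"
proof
  assume int: "set_integrable lborel {a..} (\<lambda>y::real. m / y)"
  define I where "I = (LINT y:{a..}|lborel. m / y)"
  \<comment> \<open>Chosen so that the integral of m / y over [a, T], which is m ln (T / a), equals
    |I| + 1.\<close>
  define T where "T = a * exp ((\<bar>I\<bar> + 1) / m)"
  have T: "T \<ge> a" using assms by (simp add: T_def mult_le_cancel_left1)
  have "(\<integral>y. indicator {a..T} y *\<^sub>R (m / y) \<partial>lborel) = m * ln T - m * ln a"
    using assms T
    by (intro integral_FTC_Icc) 
      (auto intro!: derivative_eq_intros continuous_intros simp: has_real_derivative_iff_has_vector_derivative[symmetric])
  also have "\<dots> = \<bar>I\<bar> + 1"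
    using assms by (simp add: T_def ln_mult field_simps)
  finally have "(LINT y:{a..T}|lborel. m / y) = \<bar>I\<bar> + 1" by (simp add: set_lebesgue_integral_def)
  moreover have "(LINT y:{a..T}|lborel. m / y) \<le> I"
    unfolding I_def set_lebesgue_integral_def using set_integrable_subset[OF int, of "{a..T}"] int assms
    by (intro integral_mono) (auto simp: set_integrable_def indicator_def)
  ultimately show False by linarith
qed

text \<open>For the difference w of two profiles, p = y^(1-2s) w' w has derivative y^(1-2s) (w^2 +
  w'^2) >= 0 and limit 0 at y = 0, because both fluxes converge and w tends to 0. So p >= 0 and w^2
  is nondecreasing. A nonzero value of w would then contradict the integrability of y^(1-2s) w^2 at
  infinity.\<close>

lemma extension_profile_flux_unique:
  assumes s: "0 < s" "s < 1"
    and t1: "extension_profile s t1" "((\<lambda>y. - (y powr (1 - 2 * s) * deriv t1 y)) \<longlongrightarrow> k1) (at_right 0)"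
    and t2: "extension_profile s t2" "((\<lambda>y. - (y powr (1 - 2 * s) * deriv t2 y)) \<longlongrightarrow> k2) (at_right 0)"
  shows "k1 = k2"
proof -
  define w where "w = (\<lambda>y. t1 y - t2 y)"
  define d where "d = (\<lambda>y. deriv t1 y - deriv t2 y)"
  define p where "p = (\<lambda>y. y powr (1 - 2 * s) * d y * w y)"
  have w': "(w has_real_derivative d y) (at y)" if "y > 0" for y
    unfolding w_def d_def using t1(1) t2(1) that
    by (auto simp: extension_profile_def intro!: DERIV_diff field_differentiable_derivI)
  have d': "(d has_real_derivative (w y - (1 - 2 * s) / y * d y)) (at y)" if y: "y > 0" for y
  proof -
    have "(d has_real_derivative (deriv (deriv t1) y - deriv (deriv t2) y)) (at y)"
      unfolding d_def using t1(1) t2(1) that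
      by (auto simp: extension_profile_def intro!: DERIV_diff field_differentiable_derivI)
    moreover have "deriv (deriv t1) y = t1 y - (1 - 2 * s) / y * deriv t1 y"
      "deriv (deriv t2) y = t2 y - (1 - 2 * s) / y * deriv t2 y"
      using t1(1) t2(1) that by (auto simp: extension_profile_def algebra_simps)
    ultimately show ?thesis
      by (simp add: w_def d_def right_diff_distrib del: times_divide_eq_left) (simp add: algebra_simps)
  qed
  have p': "(p has_real_derivative y powr (1 - 2 * s) * ((w y)\<^sup>2 + (d y)\<^sup>2)) (at y)" if y: "y > 0" for y
  proof -
    have dp: "((\<lambda>y. y powr (1 - 2 * s)) has_real_derivative (1 - 2 * s) / y * y powr (1 - 2 * s)) (at y)"
      by (rule DERIV_cong[OF has_real_derivative_powr[OF y]])
        (use y powr_diff[of y "1 - 2 * s" 1] in \<open>simp add: field_simps\<close>)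
    show ?thesis unfolding p_def
      by (rule DERIV_cong[OF DERIV_mult[OF DERIV_mult[OF dp d'[OF y]] w'[OF y]]])
        (simp add: power2_eq_square algebra_simps)
  qed
  have pmono: "p x \<le> p y" if "0 < x" "x \<le> y" for x y
  proof (rule DERIV_nonneg_imp_nondecreasing[OF that(2)])
    fix z assume "x \<le> z" "z \<le> y"
    then show "\<exists>e. (p has_real_derivative e) (at z) \<and> 0 \<le> e"
      using p'[of z] that by (intro exI[of _ "z powr (1 - 2 * s) * ((w z)\<^sup>2 + (d z)\<^sup>2)"]) auto
  qed
  have "(w \<longlongrightarrow> t1 0 - t2 0) (at_right 0)"
    unfolding w_def using t1(1) t2(1)
    by (intro tendsto_diff continuous_on_tendsto_at_right_0) (auto simp: extension_profile_def)
  then have "(w \<longlongrightarrow> 0) (at_right 0)"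
    using t1(1) t2(1) by (simp add: extension_profile_def)
  moreover have "((\<lambda>y. y powr (1 - 2 * s) * d y) \<longlongrightarrow> k2 - k1) (at_right 0)"
    using tendsto_diff[OF t2(2) t1(2)] by (simp add: d_def right_diff_distrib)
  ultimately have "(p \<longlongrightarrow> 0) (at_right 0)"
    unfolding p_def using tendsto_mult[of "\<lambda>y. y powr (1 - 2 * s) * d y" "k2 - k1" _ w 0] by simp
  then have pnn: "p y \<ge> 0" if "y > 0" for y
    by (rule tendsto_upperbound) (use that pmono in \<open>auto intro!: eventually_at_rightI[of 0 y]\<close>)
  have wmono: "(w x)\<^sup>2 \<le> (w y)\<^sup>2" if "0 < x" "x \<le> y" for x y
  proof (rule DERIV_nonneg_imp_nondecreasing[OF that(2)])
    fix z assume "x \<le> z" "z \<le> y"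
    then have z: "z > 0" using that by simp
    then have "d z * w z \<ge> 0"
      using pnn[OF z] by (simp add: p_def zero_le_mult_iff mult.assoc)
    then show "\<exists>e. ((\<lambda>y. (w y)\<^sup>2) has_real_derivative e) (at z) \<and> 0 \<le> e"
      by (intro exI[of _ "2 * (d z * w z)"]) (auto intro!: derivative_eq_intros w' z)
  qed
  have wz: "w y = 0" if y: "y > 0" for y
  proof (rule ccontr)
    assume "w y \<noteq> 0"
    then have m: "(w y)\<^sup>2 > 0" by simp
    have wc: "continuous_on {0<..} w"
      by (rule DERIV_continuous_on, rule has_field_derivative_at_within, rule w') simp
    have "set_integrable lborel {0<..} (\<lambda>y. 2 * (y powr (1 - 2 * s) * ((t1 y)\<^sup>2 + (deriv t1 y)\<^sup>2))
        + 2 * (y powr (1 - 2 * s) * ((t2 y)\<^sup>2 + (deriv t2 y)\<^sup>2)))" (is "set_integrable _ _ ?g")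
      using t1(1) t2(1) by (intro set_integral_add set_integrable_mult_right) (auto simp: extension_profile_def)
    then have "set_integrable lborel {0<..} (\<lambda>y. y powr (1 - 2 * s) * (w y)\<^sup>2)"
    proof (rule set_integrable_bound)
      show "set_borel_measurable lborel {0<..} (\<lambda>y. y powr (1 - 2 * s) * (w y)\<^sup>2)"
        unfolding set_borel_measurable_def
        unfolding measurable_lborel2
        by (intro borel_measurable_continuous_on_indicator continuous_intros wc) auto
      have "(w x)\<^sup>2 \<le> 2 * (t1 x)\<^sup>2 + 2 * (t2 x)\<^sup>2" for x
        using sum_squares_bound[of "t1 x" "- t2 x"] by (simp add: w_def power2_eq_square algebra_simps)
      then have "(w x)\<^sup>2 \<le> 2 * ((t1 x)\<^sup>2 + (deriv t1 x)\<^sup>2) + 2 * ((t2 x)\<^sup>2 + (deriv t2 x)\<^sup>2)" for x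
        by (smt (verit) zero_le_power2)
      from mult_left_mono[OF this, of "x powr (1 - 2 * s)" for x]
      have "x powr (1 - 2 * s) * (w x)\<^sup>2 \<le> ?g x" for x
        by (simp add: algebra_simps)
      then show "AE x in lborel. x \<in> {0<..} \<longrightarrow> norm (x powr (1 - 2 * s) * (w x)\<^sup>2) \<le> norm (?g x)"
        by (intro AE_I2) (smt (verit) norm_mult real_norm_def abs_of_nonneg powr_ge_zero zero_le_power2 mult_nonneg_nonneg)
    qed
    \<comment> \<open>Beyond 1 the weight is at least 1 / x, as s < 1; beyond y the square of w is
      at least its value at y.\<close>
    then have "set_integrable lborel {max 1 y..} (\<lambda>y. y powr (1 - 2 * s) * (w y)\<^sup>2)"
      by (rule set_integrable_subset) auto
    then have "set_integrable lborel {max 1 y..} (\<lambda>z. (w y)\<^sup>2 / z)"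
    proof (rule set_integrable_bound)
      show "set_borel_measurable lborel {max 1 y..} (\<lambda>z. (w y)\<^sup>2 / z)"
        unfolding set_borel_measurable_def by measurable
      have "norm ((w y)\<^sup>2 / x) \<le> norm (x powr (1 - 2 * s) * (w x)\<^sup>2)" if x: "max 1 y \<le> x" for x
      proof -
        have "x powr (- 1) \<le> x powr (1 - 2 * s)" using x s by (intro powr_mono) auto
        then have "x powr (- 1) * (w y)\<^sup>2 \<le> x powr (1 - 2 * s) * (w x)\<^sup>2"
          using x y by (intro mult_mono wmono) auto
        then show ?thesis using x by (simp add: powr_minus field_simps)
      qed
      then show "AE x in lborel. x \<in> {max 1 y..} \<longrightarrow> norm ((w y)\<^sup>2 / x) \<le> norm (x powr (1 - 2 * s) * (w x)\<^sup>2)"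
        by auto
    qed
    with not_set_integrable_inverse[of "max 1 y", OF _ m] show False by (simp add: less_max_iff_disj)
  qed
  have "d y = 0" if "y > 0" for y
  proof -
    have "(w has_real_derivative 0) (at y)"
      by (rule has_field_derivative_transform_within_open[of "\<lambda>_. 0" _ _ "{0<..}"]) (use that wz in auto)
    then show ?thesis using w'[OF that] DERIV_unique by blast
  qed
  then have "\<forall>\<^sub>F y in at_right 0. - (y powr (1 - 2 * s) * deriv t1 y) = - (y powr (1 - 2 * s) * deriv t2 y)"
    by (intro eventually_at_rightI[of 0 1]) (auto simp: d_def)
  from Lim_transform_eventually[OF t1(2) this] t2(2) show ?thesis
    by (intro tendsto_unique[of "at_right (0::real)"]) auto
qed

text \<open>A definite description yields its value only with existence and uniqueness in hand; any
  decaying profile at \<mu> = 1 then computes it.\<close>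

lemma kappa_eqI:
  assumes "0 < s" "s < 1" and "decaying_profile s \<kappa> 1 \<theta> q"
  shows "kappa s = \<kappa>"
  unfolding kappa_def
  using extension_profile_decaying_profile[OF assms(3)] extension_profile_flux_unique[OF assms(1,2)]
  by (intro the_equality) blast+


lemma kappa_pos:
  assumes "0 < s" "s < 1"
  shows "kappa s > 0"
proof -
  obtain c where "c > 0" "decaying_profile s (2 * s * c) 1 (profile s c) (profile_flux s c)"
    using decaying_profile_exists[OF assms] by blast
  then show ?thesis using kappa_eqI[OF assms] assms by simp
qed

text \<open>The decomposition isolates the whole singularity at y = 0 in the factor
  \<open>y powr (2 * s)\<close>, the only one that the later regularisation touches.\<close>

lemma smooth_decaying_profile_exists:
  assumes s: "0 < s" "s < 1" and \<mu>: "\<mu> \<ge> 0"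
  obtains \<theta> q a e where "decaying_profile s (kappa s) \<mu> \<theta> q" "smooth_on UNIV a" "smooth_on UNIV e"
    "\<And>y. y \<ge> 0 \<Longrightarrow> \<theta> y = a y - y powr (2 * s) * e y"
proof -
  obtain c where c: "decaying_profile s (2 * s * c) 1 (profile s c) (profile_flux s c)"
    using decaying_profile_exists[OF s] by blast
  have p: "decaying_profile s (kappa s) 1 (profile s c) (profile_flux s c)"
    using kappa_eqI[OF s c] c by simp
  show thesis
  proof (rule that[OF decaying_profile_scale[OF p \<mu>]])
    show "smooth_on UNIV (\<lambda>y. hyp01 (1 - s) (\<mu> / 4 * y\<^sup>2))" using s by (intro smooth_on_hyp01_sq) auto
    show "smooth_on UNIV (\<lambda>y. c * \<mu> powr s * hyp01 (1 + s) (\<mu> / 4 * y\<^sup>2))"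
      using s by (intro smooth_on_mult[OF smooth_on_const] smooth_on_hyp01_sq) auto
    fix y :: real assume "y \<ge> 0"
    then have "(sqrt \<mu> * y) powr (2 * s) = \<mu> powr s * y powr (2 * s)"
      using \<mu> by (simp add: powr_mult powr_half_sqrt[symmetric] powr_powr)
    moreover have "(sqrt \<mu> * y)\<^sup>2 = \<mu> * y\<^sup>2" using \<mu> by (simp add: power_mult_distrib)
    ultimately show "profile s c (sqrt \<mu> * y) = hyp01 (1 - s) (\<mu> / 4 * y\<^sup>2)
      - y powr (2 * s) * (c * \<mu> powr s * hyp01 (1 + s) (\<mu> / 4 * y\<^sup>2))"
      by (simp add: profile_def mult_ac)
  qed
qed

section \<open>Square integrable functions and the cylinder measure\<close>

definition L2_fun :: "'a measure \<Rightarrow> ('a \<Rightarrow> 'b::euclidean_space) \<Rightarrow> bool" where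
  "L2_fun M f \<longleftrightarrow> f \<in> borel_measurable M \<and> (\<integral>\<^sup>+ x. ennreal ((norm (f x))\<^sup>2) \<partial>M) < \<infinity>"

lemma L2_funI:
  "f \<in> borel_measurable M \<Longrightarrow> integrable M (\<lambda>x. (norm (f x))\<^sup>2) \<Longrightarrow> L2_fun M f"
  by (auto simp: L2_fun_def integrable_iff_bounded)

lemma L2_fun_integrable_sq: "L2_fun M f \<Longrightarrow> integrable M (\<lambda>x. (norm (f x))\<^sup>2)"
  by (auto simp: L2_fun_def integrable_iff_bounded)

lemma L2_fun_measurable: "L2_fun M f \<Longrightarrow> f \<in> borel_measurable M"
  by (simp add: L2_fun_def)

lemma L2_fun_integrable_inner:
  assumes "L2_fun M f" "L2_fun M g"
  shows "integrable M (\<lambda>x. f x \<bullet> g x)"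
proof (rule Bochner_Integration.integrable_bound)
  show "integrable M (\<lambda>x. (norm (f x))\<^sup>2 + (norm (g x))\<^sup>2)"
    using assms by (intro Bochner_Integration.integrable_add L2_fun_integrable_sq)
  show "(\<lambda>x. f x \<bullet> g x) \<in> borel_measurable M"
    using assms by (intro borel_measurable_inner L2_fun_measurable)
  have "\<bar>a \<bullet> b\<bar> \<le> (norm a)\<^sup>2 + (norm b)\<^sup>2" for a b :: 'b
    using Cauchy_Schwarz_ineq2[of a b] sum_squares_bound[of "norm a" "norm b"]
      mult_nonneg_nonneg[OF norm_ge_zero[of a] norm_ge_zero[of b]] by linarith
  then show "AE x in M. norm (f x \<bullet> g x) \<le> norm ((norm (f x))\<^sup>2 + (norm (g x))\<^sup>2)"
    by auto
qed

lemma L2_fun_bound: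
  assumes "L2_fun M g" "f \<in> borel_measurable M" "AE x in M. norm (f x) \<le> C * norm (g x)"
  shows "L2_fun M f"
proof (rule L2_funI[OF assms(2)], rule Bochner_Integration.integrable_bound)
  show "integrable M (\<lambda>x. C\<^sup>2 * (norm (g x))\<^sup>2)"
    using L2_fun_integrable_sq[OF assms(1)] by simp
  show "AE x in M. norm ((norm (f x))\<^sup>2) \<le> norm (C\<^sup>2 * (norm (g x))\<^sup>2)"
    using assms(3)
  proof eventually_elim
    case (elim x)
    from power_mono[OF this norm_ge_zero, of 2] show ?case by (simp add: power_mult_distrib)
  qed
qed (use assms in auto)

lemma L2_fun_add:
  assumes "L2_fun M f" "L2_fun M g"
  shows "L2_fun M (\<lambda>x. f x + g x)"
proof (rule L2_funI)
  show "(\<lambda>x. f x + g x) \<in> borel_measurable M" using assms by (auto simp: L2_fun_def)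
  have "(norm (f x + g x))\<^sup>2 = (norm (f x))\<^sup>2 + 2 * (f x \<bullet> g x) + (norm (g x))\<^sup>2" for x
    by (simp add: power2_norm_eq_inner inner_add_left inner_add_right inner_commute)
  then show "integrable M (\<lambda>x. (norm (f x + g x))\<^sup>2)"
    using assms by (auto intro!: Bochner_Integration.integrable_add L2_fun_integrable_sq L2_fun_integrable_inner)
qed

lemma L2_fun_minus: "L2_fun M f \<Longrightarrow> L2_fun M (\<lambda>x. - f x)"
  by (simp add: L2_fun_def)

lemma L2_tendsto_L2_fun:
  assumes "L2_tendsto M F g" "\<And>n. L2_fun M (F n)"
  shows "L2_fun M g"
proof -
  have "eventually (\<lambda>n. (\<integral>\<^sup>+ x. ennreal ((norm (F n x - g x))\<^sup>2) \<partial>M) < 1) sequentially"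
    using assms(1) by (intro order_tendstoD(2)[where y=0]) (auto simp: L2_tendsto_def)
  then obtain n where "(\<integral>\<^sup>+ x. ennreal ((norm (F n x - g x))\<^sup>2) \<partial>M) < 1"
    by (auto simp: eventually_sequentially)
  moreover have "(1::ennreal) < \<infinity>" by simp
  ultimately have "(\<integral>\<^sup>+ x. ennreal ((norm (F n x - g x))\<^sup>2) \<partial>M) < \<infinity>" by (rule less_trans)
  then have "L2_fun M (\<lambda>x. F n x - g x)"
    using assms(1) by (auto simp: L2_fun_def L2_tendsto_def intro: borel_measurable_diff)
  from L2_fun_add[OF assms(2)[of n] L2_fun_minus[OF this]] show ?thesis by simp
qed

text \<open>Cauchy-Schwarz, squared and stated in \<open>ennreal\<close> so that its right-hand side
  contains exactly the integral in \<open>L2_tendsto\<close>.\<close>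

lemma L2_tendsto_inner:
  assumes F: "L2_tendsto M F g" "\<And>n. L2_fun M (F n)" and H: "L2_fun M H"
  shows "(\<lambda>n. \<integral>x. F n x \<bullet> H x \<partial>M) \<longlonglongrightarrow> (\<integral>x. g x \<bullet> H x \<partial>M)"
proof -
  note g = L2_tendsto_L2_fun[OF F]
  define a where "a = (\<lambda>n. \<integral>\<^sup>+ x. ennreal ((norm (F n x - g x))\<^sup>2) \<partial>M)"
  define K where "K = (\<integral>\<^sup>+ x. ennreal ((norm (H x))\<^sup>2) \<partial>M)"
  define D where "D = (\<lambda>n. (\<integral>x. F n x \<bullet> H x \<partial>M) - (\<integral>x. g x \<bullet> H x \<partial>M))"
  have K: "K < \<infinity>" using H by (simp add: K_def L2_fun_def)
  have a: "a \<longlonglongrightarrow> 0" using F by (simp add: a_def L2_tendsto_def)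
  have le: "ennreal ((D n)\<^sup>2) \<le> a n * K" for n
  proof -
    have d: "L2_fun M (\<lambda>x. F n x - g x)"
      using L2_fun_add[OF F(2)[of n] L2_fun_minus[OF g]] by simp
    have "D n = (\<integral>x. (F n x - g x) \<bullet> H x \<partial>M)"
      unfolding D_def inner_diff_left
      by (intro Bochner_Integration.integral_diff[symmetric] L2_fun_integrable_inner F(2) g H)
    then have "ennreal \<bar>D n\<bar> \<le> (\<integral>\<^sup>+ x. norm ((F n x - g x) \<bullet> H x) \<partial>M)"
      using integral_norm_bound_ennreal[OF L2_fun_integrable_inner[OF d H]] by simp
    also have "\<dots> \<le> (\<integral>\<^sup>+ x. ennreal (norm (F n x - g x)) * ennreal (norm (H x)) \<partial>M)"
      by (intro nn_integral_mono) (simp add: ennreal_mult[symmetric] Cauchy_Schwarz_ineq2)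
    finally have "(ennreal \<bar>D n\<bar>)\<^sup>2 \<le> (\<integral>\<^sup>+ x. ennreal (norm (F n x - g x)) * ennreal (norm (H x)) \<partial>M)\<^sup>2"
      by (intro power_mono) auto
    also have "\<dots> \<le> (\<integral>\<^sup>+ x. (ennreal (norm (F n x - g x)))\<^sup>2 \<partial>M) * (\<integral>\<^sup>+ x. (ennreal (norm (H x)))\<^sup>2 \<partial>M)"
      using d H by (intro Cauchy_Schwarz_nn_integral) (auto simp: L2_fun_def)
    finally show ?thesis by (simp add: a_def K_def ennreal_power)
  qed
  have "(\<lambda>n. a n * K) \<longlonglongrightarrow> 0"
    using ennreal_tendsto_cmult[OF _ a, of K] K by (simp add: mult.commute)
  then have "(\<lambda>n. ennreal ((D n)\<^sup>2)) \<longlonglongrightarrow> 0"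
    by (rule tendsto_sandwich[OF _ _ tendsto_const, rotated 2]) (simp_all add: le)
  then have "(\<lambda>n. (D n)\<^sup>2) \<longlonglongrightarrow> 0"
    by (subst (asm) ennreal_0[symmetric], subst (asm) tendsto_ennreal_iff) auto
  then have "D \<longlonglongrightarrow> 0" by (simp add: tendsto_null_power)
  then show ?thesis unfolding D_def by (simp add: LIM_zero_iff)
qed

lemma L2_tendsto_cong:
  assumes "L2_tendsto M F g" "AE x in M. g x = g' x" "g' \<in> borel_measurable M"
  shows "L2_tendsto M F g'"
proof -
  have "(\<integral>\<^sup>+ x. ennreal ((norm (F n x - g x))\<^sup>2) \<partial>M) = (\<integral>\<^sup>+ x. ennreal ((norm (F n x - g' x))\<^sup>2) \<partial>M)" for n
    using assms(2) by (intro nn_integral_cong_AE) auto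
  then show ?thesis using assms by (auto simp: L2_tendsto_def)
qed

lemma L2_tendsto_const: "g \<in> borel_measurable M \<Longrightarrow> L2_tendsto M (\<lambda>n. g) g"
  by (simp add: L2_tendsto_def)

section \<open>Borel representatives and the product structure of the cylinder measure\<close>

lemma measurable_lebesgue_on_borel:
  "f \<in> borel_measurable borel \<Longrightarrow> f \<in> borel_measurable (lebesgue_on S)"
  by (intro measurable_restrict_space1 measurable_completion) simp

text \<open>The eigenfunction and its gradient are only Lebesgue measurable, whereas Fubini is
  applied to products of Borel functions of x and of y. The representative is assembled from Borel
  representatives of the coordinates.\<close>

lemma lebesgue_on_ex_borel_measurable:
  fixes f :: "'a::euclidean_space \<Rightarrow> 'b::euclidean_space"
  assumes f: "f \<in> borel_measurable (lebesgue_on S)" and S: "S \<in> sets lebesgue"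
  shows "\<exists>f'\<in>borel_measurable borel. AE x in lebesgue_on S. f x = f' x"
proof -
  have fS: "(\<lambda>x. indicator S x *\<^sub>R f x) \<in> borel_measurable lebesgue"
    using f S by (simp add: borel_measurable_restrict_space_iff)
  have "\<forall>b. \<exists>h. h \<in> borel_measurable lborel \<and> (AE x in lborel. (indicator S x *\<^sub>R f x) \<bullet> b = h x)"
  proof
    show "\<exists>h. h \<in> borel_measurable lborel \<and> (AE x in lborel. (indicator S x *\<^sub>R f x) \<bullet> b = h x)" for b
      using completion_ex_borel_measurable_real[OF borel_measurable_inner[OF fS borel_measurable_const[of b]]]
      unfolding Bex_def by assumption
  qed
  from choice[OF this] obtain h where
    h0: "\<forall>b. h b \<in> borel_measurable lborel \<and> (AE x in lborel. (indicator S x *\<^sub>R f x) \<bullet> b = h b x)" ..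
  have h: "h b \<in> borel_measurable lborel" "AE x in lborel. (indicator S x *\<^sub>R f x) \<bullet> b = h b x" for b
    using spec[OF h0, of b] by simp_all
  define f' where "f' = (\<lambda>x. \<Sum>b\<in>Basis. h b x *\<^sub>R b)"
  have "f' \<in> borel_measurable borel"
    unfolding f'_def using h(1) by simp
  moreover have "AE x in lborel. \<forall>b\<in>Basis. (indicator S x *\<^sub>R f x) \<bullet> b = h b x"
    using h(2) by (intro AE_finite_allI) auto
  then have "AE x in lborel. indicator S x *\<^sub>R f x = f' x"
  proof eventually_elim
    case (elim x)
    have "indicator S x *\<^sub>R f x = (\<Sum>b\<in>Basis. ((indicator S x *\<^sub>R f x) \<bullet> b) *\<^sub>R b)"
      by (rule euclidean_representation[symmetric])
    also have "\<dots> = f' x" using elim by (simp add: f'_def)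
    finally show ?case .
  qed
  then have "AE x in lebesgue. x \<in> S \<longrightarrow> f x = f' x"
    by (intro AE_completion) (auto elim!: eventually_mono split: split_indicator_asm)
  then have "AE x in lebesgue_on S. f x = f' x"
    using S by (simp add: AE_restrict_space_iff)
  ultimately show ?thesis by blast
qed

text \<open>The cylinder measure is a completed product measure; on Borel functions it agrees with the
  product of the following two measures, for which Fubini's theorem is available.\<close>

definition base_measure :: "'a::euclidean_space set \<Rightarrow> 'a measure" where
  "base_measure \<Omega> = density lborel (indicator \<Omega>)"

definition height_measure :: "real \<Rightarrow> real measure" where
  "height_measure s = density lborel (\<lambda>y. ennreal (y powr (1 - 2 * s)) * indicator {0<..} y)"

lemma space_base_measure [simp]: "space (base_measure \<Omega>) = UNIV"
  and sets_base_measure [measurable_cong]: "sets (base_measure \<Omega>) = sets borel"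
  and space_height_measure [simp]: "space (height_measure s) = UNIV"
  and sets_height_measure [measurable_cong]: "sets (height_measure s) = sets borel"
  by (simp_all add: base_measure_def height_measure_def)

lemma sigma_finite_base_measure:
  assumes "\<Omega> \<in> sets borel"
  shows "sigma_finite_measure (base_measure \<Omega>)"
  unfolding base_measure_def
  by (rule sigma_finite_measure.sigma_finite_iff_density_finite[OF sigma_finite_lborel, THEN iffD2])
    (use assms in \<open>auto simp: indicator_def\<close>)

lemma sigma_finite_height_measure: "sigma_finite_measure (height_measure s)"
  unfolding height_measure_def
  by (rule sigma_finite_measure.sigma_finite_iff_density_finite[OF sigma_finite_lborel, THEN iffD2])
    (auto simp: indicator_def)

text \<open>The image under the identity into \<open>borel\<close> forgets the completion, and
  restriction to \<Omega> becomes a density; integrals of Borel functions are unchanged.\<close>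

lemma distr_lebesgue_on:
  assumes [measurable]: "\<Omega> \<in> sets borel"
  shows "distr (lebesgue_on \<Omega>) borel (\<lambda>x. x) = base_measure \<Omega>"
proof (rule measure_eqI)
  fix A assume "A \<in> sets (distr (lebesgue_on \<Omega>) borel (\<lambda>x. x))"
  then have A [measurable]: "A \<in> sets borel" by simp
  have "emeasure (distr (lebesgue_on \<Omega>) borel (\<lambda>x. x)) A = emeasure (lebesgue_on \<Omega>) (A \<inter> \<Omega>)"
    by (subst emeasure_distr) (auto intro!: measurable_lebesgue_on_borel simp: space_restrict_space)
  also have "\<dots> = emeasure lborel (A \<inter> \<Omega>)"
    by (subst emeasure_restrict_space) auto
  also have "\<dots> = emeasure (base_measure \<Omega>) A"
    unfolding base_measure_def
    by (subst emeasure_density) (auto simp: indicator_inter_arith[symmetric] Int_commute)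
  finally show "emeasure (distr (lebesgue_on \<Omega>) borel (\<lambda>x. x)) A = emeasure (base_measure \<Omega>) A" .
qed (simp add: base_measure_def)

lemma measurable_cyl_measure:
  "f \<in> borel_measurable borel \<Longrightarrow> f \<in> borel_measurable (cyl_measure s \<Omega>)"
  unfolding cyl_measure_def by (simp add: measurable_lebesgue_on_borel)

lemma distr_cyl_measure:
  fixes \<Omega> :: "'a::euclidean_space set"
  assumes \<Omega> [measurable]: "\<Omega> \<in> sets borel"
  shows "distr (cyl_measure s \<Omega>) borel (\<lambda>p. p) = base_measure \<Omega> \<Otimes>\<^sub>M height_measure s"
proof (rule measure_eqI)
  have eq: "base_measure \<Omega> \<Otimes>\<^sub>M height_measure s
     = density lborel (\<lambda>(x, y). indicator \<Omega> x * (ennreal (y powr (1 - 2 * s)) * indicator {0<..} y))"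
    unfolding base_measure_def height_measure_def
    unfolding lborel_prod[symmetric]
    by (rule pair_measure_density)
      (simp_all add: sigma_finite_lborel sigma_finite_height_measure[unfolded height_measure_def])
  show s: "sets (distr (cyl_measure s \<Omega>) borel (\<lambda>p. p)) = sets (base_measure \<Omega> \<Otimes>\<^sub>M height_measure s)"
    unfolding eq by simp
  fix A assume "A \<in> sets (distr (cyl_measure s \<Omega>) borel (\<lambda>p. p))"
  then have A [measurable]: "A \<in> sets borel" by simp
  have C [measurable]: "half_cylinder \<Omega> \<in> sets borel"
    unfolding half_cylinder_def by (intro borel_Times) auto
  have "(\<lambda>p::'a \<times> real. ennreal (snd p powr (1 - 2 * s))) \<in> borel_measurable (borel \<Otimes>\<^sub>M borel)"
    by measurable
  then have w [measurable]: "(\<lambda>p::'a \<times> real. ennreal (snd p powr (1 - 2 * s))) \<in> borel_measurable borel"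
    by (simp add: borel_prod)
  have AC: "A \<inter> half_cylinder \<Omega> \<in> sets (lebesgue_on (half_cylinder \<Omega>))"
  proof -
    have "A \<inter> half_cylinder \<Omega> \<in> sets lebesgue" "half_cylinder \<Omega> \<in> sets lebesgue"
      using A C by (auto intro!: sets_completionI_sets)
    then show ?thesis by (simp add: sets_restrict_space_iff)
  qed
  have "emeasure (distr (cyl_measure s \<Omega>) borel (\<lambda>p. p)) A = emeasure (cyl_measure s \<Omega>) (A \<inter> half_cylinder \<Omega>)"
    by (subst emeasure_distr)
      (auto intro: measurable_cyl_measure, simp add: cyl_measure_def space_restrict_space)
  also have "\<dots> = (\<integral>\<^sup>+ p. ennreal (snd p powr (1 - 2 * s)) * indicator (A \<inter> half_cylinder \<Omega>) p \<partial>lebesgue_on (half_cylinder \<Omega>))"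
    unfolding cyl_measure_def by (rule emeasure_density[OF measurable_lebesgue_on_borel[OF w] AC])
  also have "\<dots> = (\<integral>\<^sup>+ p. ennreal (snd p powr (1 - 2 * s)) * indicator (A \<inter> half_cylinder \<Omega>) p * indicator (half_cylinder \<Omega>) p \<partial>lborel)"
    by (subst nn_integral_restrict_space) (auto simp: nn_integral_completion)
  also have "\<dots> = (\<integral>\<^sup>+ p. (case p of (x, y) \<Rightarrow> indicator \<Omega> x * (ennreal (y powr (1 - 2 * s)) * indicator {0<..} y)) * indicator A p \<partial>lborel)"
    by (intro nn_integral_cong) (auto simp: half_cylinder_def indicator_def split: prod.splits)
  also have "\<dots> = emeasure (base_measure \<Omega> \<Otimes>\<^sub>M height_measure s) A"
  proof -
    have "(\<lambda>(x, y). indicator \<Omega> x * (ennreal (y powr (1 - 2 * s)) * indicator {0<..} y))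
        \<in> borel_measurable (borel \<Otimes>\<^sub>M borel)"
      by measurable
    then show ?thesis
      unfolding eq by (subst emeasure_density) (auto simp: borel_prod)
  qed
  finally show "emeasure (distr (cyl_measure s \<Omega>) borel (\<lambda>p. p)) A = emeasure (base_measure \<Omega> \<Otimes>\<^sub>M height_measure s) A" .
qed

context
  fixes \<Omega> :: "'a::euclidean_space set" and s :: real
  assumes \<Omega> [measurable]: "\<Omega> \<in> sets borel"
begin

lemma nn_integral_cyl_measure:
  assumes "f \<in> borel_measurable borel"
  shows "(\<integral>\<^sup>+ p. f p \<partial>cyl_measure s \<Omega>) = (\<integral>\<^sup>+ p. f p \<partial>(base_measure \<Omega> \<Otimes>\<^sub>M height_measure s))"
  unfolding distr_cyl_measure[OF \<Omega>, symmetric] using assms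
  by (subst nn_integral_distr) (auto intro: measurable_cyl_measure)

lemma integral_cyl_measure:
  fixes f :: "_ \<Rightarrow> 'b::{banach, second_countable_topology}"
  assumes "f \<in> borel_measurable borel"
  shows "(\<integral> p. f p \<partial>cyl_measure s \<Omega>) = (\<integral> p. f p \<partial>(base_measure \<Omega> \<Otimes>\<^sub>M height_measure s))"
  unfolding distr_cyl_measure[OF \<Omega>, symmetric] using assms
  by (subst integral_distr) (auto intro: measurable_cyl_measure)

lemma integrable_cyl_measure:
  fixes f :: "_ \<Rightarrow> 'b::{banach, second_countable_topology}"
  assumes "f \<in> borel_measurable borel"
  shows "integrable (cyl_measure s \<Omega>) f \<longleftrightarrow> integrable (base_measure \<Omega> \<Otimes>\<^sub>M height_measure s) f"
  unfolding distr_cyl_measure[OF \<Omega>, symmetric] using assms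
  by (subst integrable_distr_eq) (auto intro: measurable_cyl_measure)

lemma nn_integral_base_measure:
  assumes "f \<in> borel_measurable borel"
  shows "(\<integral>\<^sup>+ x. f x \<partial>lebesgue_on \<Omega>) = (\<integral>\<^sup>+ x. f x \<partial>base_measure \<Omega>)"
  unfolding distr_lebesgue_on[OF \<Omega>, symmetric] using assms
  by (subst nn_integral_distr) (auto intro: measurable_lebesgue_on_borel)

lemma integral_base_measure:
  fixes f :: "_ \<Rightarrow> 'b::{banach, second_countable_topology}"
  assumes "f \<in> borel_measurable borel"
  shows "(\<integral> x. f x \<partial>lebesgue_on \<Omega>) = (\<integral> x. f x \<partial>base_measure \<Omega>)"
  unfolding distr_lebesgue_on[OF \<Omega>, symmetric] using assms
  by (subst integral_distr) (auto intro: measurable_lebesgue_on_borel)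

lemma nn_integral_cyl_measure_tensor:
  fixes f :: "'a \<Rightarrow> ennreal" and k :: "real \<Rightarrow> ennreal"
  assumes [measurable]: "f \<in> borel_measurable borel" "k \<in> borel_measurable borel"
  shows "(\<integral>\<^sup>+ p. f (fst p) * k (snd p) \<partial>cyl_measure s \<Omega>)
    = (\<integral>\<^sup>+ x. f x \<partial>lebesgue_on \<Omega>) * (\<integral>\<^sup>+ y. k y \<partial>height_measure s)"
proof -
  interpret sigma_finite_measure "height_measure s" by (rule sigma_finite_height_measure)
  have "(\<integral>\<^sup>+ p. f (fst p) * k (snd p) \<partial>cyl_measure s \<Omega>)
    = (\<integral>\<^sup>+ p. f (fst p) * k (snd p) \<partial>(base_measure \<Omega> \<Otimes>\<^sub>M height_measure s))"
  proof (rule nn_integral_cyl_measure)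
    have "(\<lambda>p. f (fst p) * k (snd p)) \<in> borel_measurable (borel \<Otimes>\<^sub>M borel)" by measurable
    then show "(\<lambda>p. f (fst p) * k (snd p)) \<in> borel_measurable borel" by (simp add: borel_prod)
  qed
  also have "\<dots> = (\<integral>\<^sup>+ x. \<integral>\<^sup>+ y. f x * k y \<partial>height_measure s \<partial>base_measure \<Omega>)"
    by (subst nn_integral_fst[symmetric]) auto
  also have "\<dots> = (\<integral>\<^sup>+ x. f x * (\<integral>\<^sup>+ y. k y \<partial>height_measure s) \<partial>base_measure \<Omega>)"
    by (subst nn_integral_cmult) auto
  also have "\<dots> = (\<integral>\<^sup>+ x. f x \<partial>base_measure \<Omega>) * (\<integral>\<^sup>+ y. k y \<partial>height_measure s)"
    by (subst nn_integral_multc) auto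
  finally show ?thesis by (simp add: nn_integral_base_measure)
qed

lemma L2_fun_tensor:
  fixes f :: "'a \<Rightarrow> 'b::euclidean_space"
  assumes f: "f \<in> borel_measurable borel" "L2_fun (lebesgue_on \<Omega>) f"
    and k: "k \<in> borel_measurable borel" "L2_fun (height_measure s) k"
  shows "L2_fun (cyl_measure s \<Omega>) (\<lambda>p. k (snd p) *\<^sub>R f (fst p))"
proof -
  note [measurable] = f(1) k(1)
  have "(\<lambda>p. k (snd p) *\<^sub>R f (fst p)) \<in> borel_measurable (borel \<Otimes>\<^sub>M borel)" by measurable
  then have m: "(\<lambda>p. k (snd p) *\<^sub>R f (fst p)) \<in> borel_measurable (cyl_measure s \<Omega>)"
    by (intro measurable_cyl_measure) (simp add: borel_prod)
  have "(\<integral>\<^sup>+ p. ennreal ((norm (k (snd p) *\<^sub>R f (fst p)))\<^sup>2) \<partial>cyl_measure s \<Omega>)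
     = (\<integral>\<^sup>+ p. ennreal ((norm (f (fst p)))\<^sup>2) * ennreal ((norm (k (snd p)))\<^sup>2) \<partial>cyl_measure s \<Omega>)"
    by (simp add: power_mult_distrib ennreal_mult[symmetric] mult.commute)
  also have "\<dots> = (\<integral>\<^sup>+ x. ennreal ((norm (f x))\<^sup>2) \<partial>lebesgue_on \<Omega>) * (\<integral>\<^sup>+ y. ennreal ((norm (k y))\<^sup>2) \<partial>height_measure s)"
    by (rule nn_integral_cyl_measure_tensor) measurable
  also have "\<dots> < \<infinity>" using f k by (auto simp: L2_fun_def ennreal_mult_less_top)
  finally show ?thesis using m by (simp add: L2_fun_def)
qed

text \<open>By Tonelli the squared error factors into the squared error on \<Omega> times the fixed
  finite energy of k.\<close>

lemma L2_tendsto_tensor: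
  fixes F :: "nat \<Rightarrow> 'a \<Rightarrow> 'b::euclidean_space"
  assumes F: "L2_tendsto (lebesgue_on \<Omega>) F f" "\<And>n. F n \<in> borel_measurable borel" "f \<in> borel_measurable borel"
    and k: "k \<in> borel_measurable borel" "L2_fun (height_measure s) k"
  shows "L2_tendsto (cyl_measure s \<Omega>) (\<lambda>n p. k (snd p) *\<^sub>R F n (fst p)) (\<lambda>p. k (snd p) *\<^sub>R f (fst p))"
proof -
  note [measurable] = F(2,3) k(1)
  have m: "(\<lambda>p. k (snd p) *\<^sub>R h (fst p)) \<in> borel_measurable (cyl_measure s \<Omega>)"
    if [measurable]: "h \<in> borel_measurable borel" for h :: "'a \<Rightarrow> 'b"
  proof -
    have "(\<lambda>p. k (snd p) *\<^sub>R h (fst p)) \<in> borel_measurable (borel \<Otimes>\<^sub>M borel)" by measurable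
    then show ?thesis by (intro measurable_cyl_measure) (simp add: borel_prod)
  qed
  have e: "(\<integral>\<^sup>+ p. ennreal ((norm (k (snd p) *\<^sub>R F n (fst p) - k (snd p) *\<^sub>R f (fst p)))\<^sup>2) \<partial>cyl_measure s \<Omega>)
     = (\<integral>\<^sup>+ x. ennreal ((norm (F n x - f x))\<^sup>2) \<partial>lebesgue_on \<Omega>) * (\<integral>\<^sup>+ y. ennreal ((norm (k y))\<^sup>2) \<partial>height_measure s)" for n
  proof -
    have "(\<integral>\<^sup>+ p. ennreal ((norm (k (snd p) *\<^sub>R F n (fst p) - k (snd p) *\<^sub>R f (fst p)))\<^sup>2) \<partial>cyl_measure s \<Omega>)
     = (\<integral>\<^sup>+ p. ennreal ((norm (F n (fst p) - f (fst p)))\<^sup>2) * ennreal ((norm (k (snd p)))\<^sup>2) \<partial>cyl_measure s \<Omega>)"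
      by (simp add: scaleR_diff_right[symmetric] power_mult_distrib ennreal_mult[symmetric] mult.commute)
    also have "\<dots> = (\<integral>\<^sup>+ x. ennreal ((norm (F n x - f x))\<^sup>2) \<partial>lebesgue_on \<Omega>) * (\<integral>\<^sup>+ y. ennreal ((norm (k y))\<^sup>2) \<partial>height_measure s)"
      by (rule nn_integral_cyl_measure_tensor) measurable
    finally show ?thesis .
  qed
  have "(\<lambda>n. (\<integral>\<^sup>+ x. ennreal ((norm (F n x - f x))\<^sup>2) \<partial>lebesgue_on \<Omega>) * (\<integral>\<^sup>+ y. ennreal ((norm (k y))\<^sup>2) \<partial>height_measure s))
     \<longlonglongrightarrow> 0"
    using F(1) k(2) ennreal_tendsto_cmult[of "\<integral>\<^sup>+ y. ennreal ((norm (k y))\<^sup>2) \<partial>height_measure s"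
        "\<lambda>n. \<integral>\<^sup>+ x. ennreal ((norm (F n x - f x))\<^sup>2) \<partial>lebesgue_on \<Omega>" 0 sequentially]
    by (simp add: L2_tendsto_def L2_fun_def mult.commute)
  then show ?thesis
    unfolding L2_tendsto_def e using m F(2,3) by simp
qed

end

lemma L2_fun_Pair:
  assumes "L2_fun M f" "L2_fun M g"
  shows "L2_fun M (\<lambda>x. (f x, g x))"
proof (rule L2_funI)
  show "(\<lambda>x. (f x, g x)) \<in> borel_measurable M"
    using assms by (intro borel_measurable_Pair L2_fun_measurable)
  show "integrable M (\<lambda>x. (norm (f x, g x))\<^sup>2)"
    using assms by (simp add: norm_Pair L2_fun_integrable_sq)
qed

lemma L2_tendsto_Pair:
  assumes "L2_tendsto M F f" "L2_tendsto M G g"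
  shows "L2_tendsto M (\<lambda>n x. (F n x, G n x)) (\<lambda>x. (f x, g x))"
proof -
  have m: "\<And>n. F n \<in> borel_measurable M" "\<And>n. G n \<in> borel_measurable M" "f \<in> borel_measurable M" "g \<in> borel_measurable M"
    using assms by (auto simp: L2_tendsto_def)
  note [measurable] = m
  have "(\<integral>\<^sup>+ x. ennreal ((norm ((F n x, G n x) - (f x, g x)))\<^sup>2) \<partial>M)
     = (\<integral>\<^sup>+ x. ennreal ((norm (F n x - f x))\<^sup>2) \<partial>M) + (\<integral>\<^sup>+ x. ennreal ((norm (G n x - g x))\<^sup>2) \<partial>M)" for n
    by (subst nn_integral_add[symmetric]) (auto simp: norm_Pair ennreal_plus[symmetric] simp del: ennreal_plus)
  moreover have "(\<lambda>n. (\<integral>\<^sup>+ x. ennreal ((norm (F n x - f x))\<^sup>2) \<partial>M) + (\<integral>\<^sup>+ x. ennreal ((norm (G n x - g x))\<^sup>2) \<partial>M)) \<longlonglongrightarrow> 0 + 0"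
    using assms by (intro tendsto_add) (auto simp: L2_tendsto_def)
  ultimately show ?thesis
    using m by (auto simp: L2_tendsto_def intro: borel_measurable_Pair)
qed

section \<open>Integrals with the weight y^(1-2s) on the half-line\<close>

lemma integral_height_measure:
  fixes k :: "real \<Rightarrow> real"
  assumes k: "k \<in> borel_measurable borel"
  shows "(\<integral> y. k y \<partial>height_measure s) = (LBINT y:{0<..}. y powr (1 - 2 * s) * k y)"
    and "integrable (height_measure s) k \<longleftrightarrow> set_integrable lborel {0<..} (\<lambda>y. y powr (1 - 2 * s) * k y)"
proof -
  have e: "height_measure s = density lborel (\<lambda>y. ennreal (indicator {0<..} y * y powr (1 - 2 * s)))"
    unfolding height_measure_def by (intro density_cong) (auto simp: indicator_def)
  show "(\<integral> y. k y \<partial>height_measure s) = (LBINT y:{0<..}. y powr (1 - 2 * s) * k y)"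
    unfolding e set_lebesgue_integral_def using k by (subst integral_density) (auto simp: mult_ac)
  show "integrable (height_measure s) k \<longleftrightarrow> set_integrable lborel {0<..} (\<lambda>y. y powr (1 - 2 * s) * k y)"
    unfolding e set_integrable_def using k by (subst integrable_density) (auto simp: mult_ac)
qed

lemma set_integrable_powr_0:
  fixes a Y :: real
  assumes "a > -1"
  shows "set_integrable lborel {0<..Y} (\<lambda>y. y powr a)"
proof (cases "Y \<ge> 0")
  case True
  have "integral\<^sup>N lborel (\<lambda>x. indicator {0..Y} x * (x::real) powr a) = Y powr (a+1) / (a+1)"
    by (rule nn_integral_has_integral_lebesgue[OF _ has_integral_powr_from_0[OF assms True]]) auto
  then have "set_integrable lborel {0..Y} (\<lambda>y. y powr a)"
    unfolding set_integrable_def by (intro integrableI_bounded) auto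
  then show ?thesis by (rule set_integrable_subset) auto
qed (simp add: set_integrable_def)

lemma set_integrable_powr_inf:
  fixes a :: real
  assumes "a < -1"
  shows "set_integrable lborel {1..} (\<lambda>y. y powr a)"
proof -
  have "integral\<^sup>N lborel (\<lambda>x. indicator {1..} x * (x::real) powr a) = - (1 powr (a+1)) / (a+1)"
    by (rule nn_integral_has_integral_lebesgue[OF _ has_integral_powr_to_inf[OF assms]]) auto
  then show ?thesis
    unfolding set_integrable_def by (intro integrableI_bounded) auto
qed

section \<open>Test functions on the cylinder\<close>

lemma grad_eq_0:
  assumes "open S" "x \<in> S" "\<And>z. z \<in> S \<Longrightarrow> f z = 0"
  shows "grad f x = 0"
proof (rule grad_eqI)
  have "((\<lambda>z. 0) has_derivative (\<lambda>v. 0 \<bullet> v)) (at x)" by simp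
  then show "(f has_derivative (\<lambda>v. 0 \<bullet> v)) (at x)"
    by (rule has_derivative_transform_within_open[OF _ assms(1,2)]) (simp add: assms(3))
qed

lemma L2_fun_bounded_support:
  assumes "f \<in> borel_measurable M" "A \<in> sets M" "emeasure M A < \<infinity>"
    and "AE x in M. norm (f x) \<le> B * indicator A x"
  shows "L2_fun M f"
proof -
  have "L2_fun M (indicator A :: _ \<Rightarrow> real)"
  proof (rule L2_funI)
    have "(norm (indicator A x :: real))\<^sup>2 = indicator A x" for x by (simp add: indicator_def)
    then show "integrable M (\<lambda>x. (norm (indicator A x :: real))\<^sup>2)" using assms by simp
  qed (use assms in auto)
  then show ?thesis using assms by (rule_tac L2_fun_bound) auto
qed

lemma continuous_compact_bounded:
  fixes f :: "'a::euclidean_space \<Rightarrow> 'b::euclidean_space"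
  assumes "compact K" "continuous_on K f"
  obtains B where "B > 0" "\<And>x. x \<in> K \<Longrightarrow> norm (f x) \<le> B"
  using compact_imp_bounded[OF compact_continuous_image[OF assms(2,1)]]
  unfolding bounded_pos by auto

lemma Cc_infty_L2_fun:
  assumes \<Omega>: "open \<Omega>" and \<Phi>: "\<Phi> \<in> Cc_infty \<Omega>"
  shows "L2_fun (lebesgue_on \<Omega>) \<Phi>" "L2_fun (lebesgue_on \<Omega>) (grad \<Phi>)"
    "\<Phi> \<in> borel_measurable borel" "grad \<Phi> \<in> borel_measurable borel"
proof -
  from \<Phi> obtain K where s: "smooth_on UNIV \<Phi>" and K: "compact K" "K \<subseteq> \<Omega>" "\<And>x. x \<notin> K \<Longrightarrow> \<Phi> x = 0"
    by (auto simp: Cc_infty_def)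
  have c: "continuous_on UNIV \<Phi>" "continuous_on UNIV (grad \<Phi>)"
    using s smooth_on_continuous smooth_on_continuous_grad by auto
  then show m: "\<Phi> \<in> borel_measurable borel" "grad \<Phi> \<in> borel_measurable borel"
    by (auto intro: borel_measurable_continuous_onI)
  have K0: "grad \<Phi> x = 0" if "x \<notin> K" for x
    using that K compact_imp_closed by (intro grad_eq_0[of "- K"]) auto
  have S: "K \<in> sets lebesgue" "\<Omega> \<in> sets lebesgue"
    using compact_imp_closed[OF K(1)] \<Omega> by auto
  then have KM: "K \<in> sets (lebesgue_on \<Omega>)"
    using K(2) by (auto simp: sets_restrict_space_iff)
  have fin: "emeasure (lebesgue_on \<Omega>) K < \<infinity>"
    using S K(2) emeasure_compact_finite[OF K(1)] compact_imp_closed[OF K(1)]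
    by (subst emeasure_restrict_space) auto
  obtain B where "\<And>x. x \<in> K \<Longrightarrow> norm (\<Phi> x) \<le> B"
    using continuous_compact_bounded[OF K(1) continuous_on_subset[OF c(1)]] by auto
  then show "L2_fun (lebesgue_on \<Omega>) \<Phi>"
    using K(3) by (intro L2_fun_bounded_support[OF measurable_lebesgue_on_borel[OF m(1)] KM fin, of B])
      (auto simp: indicator_def)
  obtain B where "\<And>x. x \<in> K \<Longrightarrow> norm (grad \<Phi> x) \<le> B"
    using continuous_compact_bounded[OF K(1) continuous_on_subset[OF c(2)]] by auto
  then show "L2_fun (lebesgue_on \<Omega>) (grad \<Phi>)"
    using K0 by (intro L2_fun_bounded_support[OF measurable_lebesgue_on_borel[OF m(2)] KM fin, of B])
      (auto simp: indicator_def)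
qed

lemma Cc_infty_H10:
  assumes "open \<Omega>" "\<Phi> \<in> Cc_infty \<Omega>"
  shows "H10 \<Omega> \<Phi> (grad \<Phi>)"
  unfolding H10_def using Cc_infty_L2_fun[OF assms] assms
  by (intro exI[of _ "\<lambda>n. \<Phi>"]) (auto intro!: L2_tendsto_const measurable_lebesgue_on_borel)

lemma H10_L2_fun:
  assumes "open \<Omega>" "H10 \<Omega> v g"
  shows "L2_fun (lebesgue_on \<Omega>) v" "L2_fun (lebesgue_on \<Omega>) g"
  using assms(2) Cc_infty_L2_fun(1,2)[OF assms(1)] L2_tendsto_L2_fun unfolding H10_def by blast+

lemma H10_cong:
  assumes "H10 \<Omega> v g" "AE x in lebesgue_on \<Omega>. v x = v' x" "AE x in lebesgue_on \<Omega>. g x = g' x"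
    "v' \<in> borel_measurable borel" "g' \<in> borel_measurable borel"
  shows "H10 \<Omega> v' g'"
  using assms unfolding H10_def by (blast intro: L2_tendsto_cong measurable_lebesgue_on_borel)

lemma AE_cyl_measure_height: "open \<Omega> \<Longrightarrow> AE p in cyl_measure s \<Omega>. snd p > 0"
proof -
  assume \<Omega>: "open \<Omega>"
  have "AE p in lebesgue_on (half_cylinder \<Omega>). snd p > 0"
    by (rule AE_I2) (auto simp: space_restrict_space half_cylinder_def)
  moreover have "(\<lambda>p::'a \<times> real. ennreal (snd p powr (1 - 2 * s))) \<in> borel_measurable (borel \<Otimes>\<^sub>M borel)"
    by measurable
  then have "(\<lambda>p::'a \<times> real. ennreal (snd p powr (1 - 2 * s))) \<in> borel_measurable (lebesgue_on (half_cylinder \<Omega>))"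
    by (intro measurable_lebesgue_on_borel) (simp add: borel_prod)
  ultimately show ?thesis
    unfolding cyl_measure_def by (subst AE_density) auto
qed

lemma AE_height_measure_pos: "AE y in height_measure s. y > 0"
  unfolding height_measure_def by (subst AE_density) (auto simp: indicator_def)

lemma emeasure_height_measure_atMost:
  assumes "s < 1"
  shows "emeasure (height_measure s) {..Y} < \<infinity>"
proof -
  have "integrable (height_measure s) (indicator {..Y} :: real \<Rightarrow> real)"
  proof (subst integral_height_measure)
    have "set_integrable lborel {0<..Y} (\<lambda>y. y powr (1 - 2 * s))"
      using assms by (intro set_integrable_powr_0) auto
    moreover have "(\<lambda>y::real. indicator {0<..} y *\<^sub>R (y powr (1 - 2 * s) * indicator {..Y} y))
      = (\<lambda>y. indicator {0<..Y} y *\<^sub>R (y powr (1 - 2 * s)))"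
      by (auto simp: indicator_def fun_eq_iff)
    ultimately show "set_integrable lborel {0<..} (\<lambda>y. y powr (1 - 2 * s) * indicator {..Y} y)"
      unfolding set_integrable_def by simp
  qed auto
  then show ?thesis by (simp add: integrable_indicator_iff)
qed

text \<open>The bounds are stated for y > 0: outside K the function is known to vanish only in the
  closed upper half-space, so its full gradient is known to vanish only off K in the open
  one.\<close>

lemma Cc_infty_cyl_support:
  assumes \<Omega>: "open \<Omega>" and \<Phi>: "\<Phi> \<in> Cc_infty_cyl \<Omega>"
  obtains Y B where "Y > 0"
    "\<And>x y. 0 \<le> y \<Longrightarrow> Y \<le> y \<Longrightarrow> \<Phi> (x, y) = 0"
    "\<And>x y. 0 < y \<Longrightarrow> norm (\<Phi> (x, y)) \<le> B * indicator {..Y} y"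
    "\<And>x y. 0 < y \<Longrightarrow> norm (grad \<Phi> (x, y)) \<le> B * indicator {..Y} y"
proof -
  from \<Phi> obtain K where s: "smooth_on UNIV \<Phi>" and K: "compact K" "K \<subseteq> \<Omega> \<times> {0..}"
    "\<And>x y. 0 \<le> y \<Longrightarrow> (x, y) \<notin> K \<Longrightarrow> \<Phi> (x, y) = 0"
    by (auto simp: Cc_infty_cyl_def)
  have c: "continuous_on UNIV \<Phi>" "continuous_on UNIV (grad \<Phi>)"
    using s smooth_on_continuous smooth_on_continuous_grad by auto
  obtain C where C: "\<And>p. p \<in> K \<Longrightarrow> norm p \<le> C"
    using compact_imp_bounded[OF K(1)] unfolding bounded_pos by auto
  \<comment> \<open>Positive and strictly above every height in K, so that the function vanishes at
    the height Y itself.\<close>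
  define Y where "Y = max 1 (C + 1)"
  have Y: "y < Y" if "(x, y) \<in> K" for x y
    using C[OF that] norm_snd_le[where x=x and y=y] by (simp add: Y_def)
  obtain B1 where B1: "B1 > 0" "\<And>p. p \<in> K \<Longrightarrow> norm (\<Phi> p) \<le> B1"
    using continuous_compact_bounded[OF K(1) continuous_on_subset[OF c(1)]] by auto
  obtain B2 where B2: "B2 > 0" "\<And>p. p \<in> K \<Longrightarrow> norm (grad \<Phi> p) \<le> B2"
    using continuous_compact_bounded[OF K(1) continuous_on_subset[OF c(2)]] by auto
  have K0: "grad \<Phi> (x, y) = 0" if "(x, y) \<notin> K" "y > 0" for x y
  proof (rule grad_eq_0[of "- K \<inter> UNIV \<times> {0<..}"])
    show "open (- K \<inter> UNIV \<times> {0<..})"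
      using compact_imp_closed[OF K(1)] by (intro open_Int open_Compl open_Times) auto
  qed (use that K(3) in \<open>auto simp: less_imp_le\<close>)
  show thesis
  proof (rule that[of Y "max B1 B2"])
    show "\<Phi> (x, y) = 0" if "0 \<le> y" "Y \<le> y" for x y
      using Y[of x y] K(3)[of y x] that by linarith
    show "norm (\<Phi> (x, y)) \<le> max B1 B2 * indicator {..Y} y" if "0 < y" for x y
      using Y[of x y] K(3)[of y x] B1 B1(2)[of "(x, y)"] that
      by (cases "(x, y) \<in> K") (auto simp: indicator_def le_max_iff_disj)
    show "norm (grad \<Phi> (x, y)) \<le> max B1 B2 * indicator {..Y} y" if "0 < y" for x y
      using Y[of x y] K0[of x y] B1 B2(2)[of "(x, y)"] that
      by (cases "(x, y) \<in> K") (auto simp: indicator_def le_max_iff_disj)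
  qed (simp add: Y_def)
qed

text \<open>Both functions are bounded and live in a slab of finite measure: \<Omega> is bounded,
  and the exponent 1 - 2s > -1 makes the weight integrable near y = 0.\<close>

lemma Cc_infty_cyl_L2_fun:
  fixes \<Omega> :: "'a::euclidean_space set"
  assumes \<Omega>: "open \<Omega>" "bounded \<Omega>" and s: "s < 1" and \<Phi>: "\<Phi> \<in> Cc_infty_cyl \<Omega>"
  shows "L2_fun (cyl_measure s \<Omega>) \<Phi>" "L2_fun (cyl_measure s \<Omega>) (grad \<Phi>)"
    "\<Phi> \<in> borel_measurable borel" "grad \<Phi> \<in> borel_measurable borel"
proof -
  have \<Omega>b: "\<Omega> \<in> sets borel" using \<Omega> by auto
  have sm: "smooth_on UNIV \<Phi>" using \<Phi> by (auto simp: Cc_infty_cyl_def)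
  show m: "\<Phi> \<in> borel_measurable borel" "grad \<Phi> \<in> borel_measurable borel"
    using smooth_on_continuous[OF sm] smooth_on_continuous_grad[OF sm]
    by (auto intro: borel_measurable_continuous_onI)
  obtain Y B where YB: "\<And>x y. 0 < y \<Longrightarrow> norm (\<Phi> (x, y)) \<le> B * indicator {..Y} y"
    "\<And>x y. 0 < y \<Longrightarrow> norm (grad \<Phi> (x, y)) \<le> B * indicator {..Y} y"
    using Cc_infty_cyl_support[OF \<Omega>(1) \<Phi>] by metis
  define A where "A = (UNIV :: 'a set) \<times> {..Y}"
  have A: "A \<in> sets borel" unfolding A_def by (intro borel_closed closed_Times) auto
  have A': "indicator A p = (indicator {..Y} (snd p) :: real)" for p
    by (auto simp: A_def indicator_def mem_Times_iff)
  have fin: "(\<integral>\<^sup>+ p. indicator A p \<partial>cyl_measure s \<Omega>) < \<infinity>"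
  proof -
    have "(\<integral>\<^sup>+ p. indicator A p \<partial>cyl_measure s \<Omega>)
       = (\<integral>\<^sup>+ p. 1 * indicator {..Y} (snd p) \<partial>cyl_measure s \<Omega>)"
      by (intro nn_integral_cong) (auto simp: A_def indicator_def split: prod.splits)
    also have "\<dots> = (\<integral>\<^sup>+ x. 1 \<partial>lebesgue_on \<Omega>) * (\<integral>\<^sup>+ y. indicator {..Y} y \<partial>height_measure s)"
      by (rule nn_integral_cyl_measure_tensor[OF \<Omega>b, of "\<lambda>_. 1" "indicator {..Y}"]) auto
    also have "\<dots> < \<infinity>"
      using emeasure_height_measure_atMost[OF s, of Y] emeasure_bounded_finite[OF \<Omega>(2)] \<Omega>b
      by (simp add: ennreal_mult_less_top emeasure_restrict_space space_restrict_space)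
    finally show ?thesis .
  qed
  have L: "L2_fun (cyl_measure s \<Omega>) (indicator A :: _ \<Rightarrow> real)"
    unfolding L2_fun_def
  proof
    show "(indicator A :: _ \<Rightarrow> real) \<in> borel_measurable (cyl_measure s \<Omega>)"
      using A by (intro measurable_cyl_measure) auto
    have "(\<integral>\<^sup>+ x. ennreal ((norm (indicator A x :: real))\<^sup>2) \<partial>cyl_measure s \<Omega>) = (\<integral>\<^sup>+ p. indicator A p \<partial>cyl_measure s \<Omega>)"
      by (intro nn_integral_cong) (auto simp: indicator_def)
    then show "(\<integral>\<^sup>+ x. ennreal ((norm (indicator A x :: real))\<^sup>2) \<partial>cyl_measure s \<Omega>) < \<infinity>" using fin by simp
  qed
  show "L2_fun (cyl_measure s \<Omega>) \<Phi>" "L2_fun (cyl_measure s \<Omega>) (grad \<Phi>)"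
    by (rule L2_fun_bound[OF L measurable_cyl_measure, of _ B]; 
        use m AE_cyl_measure_height[OF \<Omega>(1), of s] YB in \<open>auto simp: A' elim!: eventually_mono\<close>)+
qed

lemma Cc_infty_cyl_slice:
  assumes \<Phi>: "\<Phi> \<in> Cc_infty_cyl \<Omega>" and y: "y \<ge> 0"
  shows "(\<lambda>x. \<Phi> (x, y)) \<in> Cc_infty \<Omega>"
proof -
  from \<Phi> obtain K where s: "smooth_on UNIV \<Phi>" and K: "compact K" "K \<subseteq> \<Omega> \<times> {0..}"
    "\<And>x y. 0 \<le> y \<Longrightarrow> (x, y) \<notin> K \<Longrightarrow> \<Phi> (x, y) = 0"
    by (auto simp: Cc_infty_cyl_def)
  have "compact (fst ` K)" using K(1) by (intro compact_continuous_image continuous_intros)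
  moreover have "fst ` K \<subseteq> \<Omega>" using K(2) by auto
  moreover have "\<Phi> (x, y) = 0" if "x \<notin> fst ` K" for x
    using that K(3)[OF y, of x] by (metis fst_conv image_eqI)
  ultimately show ?thesis using smooth_on_slice[OF s] by (auto simp: Cc_infty_def)
qed

text \<open>At \<mu> = 0 the energy controls the derivative alone, and the constant profile has
  infinite weighted norm; hence the condition on the second claim.\<close>

lemma decaying_profile_L2_fun:
  assumes \<theta>: "decaying_profile s \<kappa> \<mu> \<theta> q" and \<mu>: "\<mu> \<ge> 0"
  shows "L2_fun (height_measure s) (\<lambda>y. y powr (2 * s - 1) * q y)"
    and "\<mu> > 0 \<Longrightarrow> L2_fun (height_measure s) \<theta>"
proof -
  have [measurable]: "\<theta> \<in> borel_measurable borel" "q \<in> borel_measurable borel"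
    using \<theta> by (auto simp: decaying_profile_def)
  have int: "integrable (height_measure s) (\<lambda>y. \<mu> * (\<theta> y)\<^sup>2 + (y powr (2 * s - 1) * q y)\<^sup>2)"
    by (subst integral_height_measure(2)) (use decaying_profile_energy[OF \<theta> \<mu>] in auto)
  show "L2_fun (height_measure s) (\<lambda>y. y powr (2 * s - 1) * q y)"
    by (rule L2_funI, measurable, rule Bochner_Integration.integrable_bound[OF int])
      (use \<mu> in auto)
  assume "\<mu> > 0"
  have "integrable (height_measure s) (\<lambda>y. (1/\<mu>) * (\<mu> * (\<theta> y)\<^sup>2 + (y powr (2 * s - 1) * q y)\<^sup>2))"
    using int by simp
  then show "L2_fun (height_measure s) \<theta>"
    by (rule_tac L2_funI, measurable, rule_tac Bochner_Integration.integrable_bound)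
      (use \<open>\<mu> > 0\<close> in \<open>auto simp: distrib_left\<close>)
qed

text \<open>The weak form of the profile equation tested with V. Multiplied by the weight, the
  integrand is the derivative of q V, and as V vanishes from Y on, only the boundary term -q(0) V(0)
  survives. The integrand has no sign, so its integrability is established separately from the
  bounds on \<theta> and q.\<close>

lemma decaying_profile_pairing:
  assumes \<theta>: "decaying_profile s \<kappa> \<mu> \<theta> q" and \<mu>: "\<mu> \<ge> 0" and s: "0 < s" "s < 1"
    and V: "\<And>y. (V has_real_derivative V' y) (at y)" "continuous_on UNIV V'"
    and Y: "\<And>y. y \<ge> Y \<Longrightarrow> V y = 0" "Y > 0"
  shows "(\<integral> y. \<mu> * \<theta> y * V y + y powr (2 * s - 1) * q y * V' y \<partial>height_measure s) = \<kappa> * \<mu> powr s * V 0"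
proof -
  note \<theta>' = \<theta>[unfolded decaying_profile_def]
  define M where "M = \<kappa> * \<mu> powr s"
  have [measurable]: "\<theta> \<in> borel_measurable borel" "q \<in> borel_measurable borel" using \<theta>' by auto
  have cV: "continuous_on UNIV V" using V(1) by (meson DERIV_continuous_on has_field_derivative_at_within)
  have [measurable]: "V \<in> borel_measurable borel" "V' \<in> borel_measurable borel"
    using cV V(2) by (auto intro: borel_measurable_continuous_onI)
  have V'0: "V' y = 0" if "y > Y" for y
  proof -
    have "(V has_real_derivative 0) (at y)"
      by (rule has_field_derivative_transform_within_open[of "\<lambda>_. 0" _ _ "{Y<..}"]) (use that Y in auto)
    then show ?thesis using V(1)[of y] DERIV_unique by blast
  qed
  obtain B1 where B1: "B1 > 0" "\<And>y. y \<in> {0..Y} \<Longrightarrow> norm (V y) \<le> B1"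
    using continuous_compact_bounded[of "{0..Y}" V] continuous_on_subset[OF cV] by auto
  obtain B2 where B2: "B2 > 0" "\<And>y. y \<in> {0..Y} \<Longrightarrow> norm (V' y) \<le> B2"
    using continuous_compact_bounded[of "{0..Y}" V'] continuous_on_subset[OF V(2)] by auto
  define h where "h = (\<lambda>y. (\<mu> * y powr (1 - 2 * s) * \<theta> y) * V y + V' y * q y)"
  have h: "y powr (1 - 2 * s) * (\<mu> * \<theta> y * V y + y powr (2 * s - 1) * q y * V' y) = h y" if "y > 0" for y
  proof -
    have "y powr (1 - 2 * s) * y powr (2 * s - 1) = 1"
      using that by (simp add: powr_add[symmetric])
    then have *: "y powr (1 - 2 * s) * (y powr (2 * s - 1) * z) = z" for z by (metis mult.assoc mult_1)
    show ?thesis by (simp add: h_def distrib_left * mult.assoc)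
  qed
  have E: "einterval 0 \<infinity> = {0<..}" by (auto simp: einterval_def zero_ereal_def)
  have int: "set_integrable lborel {0<..} h"
  proof -
    \<comment> \<open>The second summand is a constant, written with \<open>y powr 0\<close> so that
      the power rule covers both. It bounds q V', in which the weight has cancelled the factor
      y^(2s-1).\<close>
    have "set_integrable lborel {0<..Y} (\<lambda>y. \<mu> * B1 * y powr (1 - 2 * s) + M * B2 * y powr 0)"
      using s by (intro set_integral_add set_integrable_mult_right set_integrable_powr_0) auto
    then have i: "set_integrable lborel {0<..Y} h"
    proof (rule set_integrable_bound)
      show "set_borel_measurable lborel {0<..Y} h" unfolding set_borel_measurable_def h_def by measurable
      have "norm (h y) \<le> \<mu> * B1 * y powr (1 - 2 * s) + M * B2 * y powr 0" if y: "y \<in> {0<..Y}" for y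
      proof -
        have "0 \<le> \<theta> y \<and> \<theta> y \<le> 1" "- M \<le> q y \<and> q y \<le> 0" using \<theta>' y by (auto simp: M_def)
        then have t: "\<bar>\<theta> y\<bar> \<le> 1" "\<bar>q y\<bar> \<le> M" by auto
        have "\<bar>(\<mu> * y powr (1 - 2 * s) * \<theta> y) * V y\<bar> \<le> (\<mu> * y powr (1 - 2 * s) * 1) * B1"
          unfolding abs_mult using t B1 y \<mu> by (intro mult_mono) auto
        moreover have "\<bar>V' y * q y\<bar> \<le> B2 * M"
          unfolding abs_mult using t B2 y by (intro mult_mono) auto
        ultimately have "\<bar>h y\<bar> \<le> (\<mu> * y powr (1 - 2 * s) * 1) * B1 + B2 * M"
          unfolding h_def by linarith
        then show ?thesis using y by (simp add: mult_ac)
      qed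
      then show "AE y in lborel. y \<in> {0<..Y} \<longrightarrow> norm (h y) \<le> norm (\<mu> * B1 * y powr (1 - 2 * s) + M * B2 * y powr 0)"
        by (intro AE_I2) (metis abs_ge_self order_trans real_norm_def)
    qed
    have "(\<lambda>y. indicator {0<..} y *\<^sub>R h y) = (\<lambda>y. indicator {0<..Y} y *\<^sub>R h y)"
      using Y(1) V'0 by (auto simp: indicator_def h_def fun_eq_iff)
    then show ?thesis using i unfolding set_integrable_def by simp
  qed
  have "(LBINT y=0..\<infinity>. h y) = 0 - q 0 * V 0"
  proof (rule interval_integral_FTC_integrable[where F="\<lambda>y. q y * V y"])
    fix y assume "0 < ereal y" "ereal y < \<infinity>"
    then have y: "y > 0" by (simp add: zero_ereal_def)
    have d: "(\<theta> has_real_derivative y powr (2 * s - 1) * q y) (at y)"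
      "(q has_real_derivative \<mu> * y powr (1 - 2 * s) * \<theta> y) (at y)" using \<theta>' y by auto
    show "((\<lambda>y. q y * V y) has_vector_derivative h y) (at y)"
      unfolding has_real_derivative_iff_has_vector_derivative[symmetric] h_def
      by (rule DERIV_mult[OF d(2) V(1)])
    show "isCont h y"
      unfolding h_def using y V(2)
      by (intro continuous_intros DERIV_isCont[OF d(1)] DERIV_isCont[OF d(2)] DERIV_isCont[OF V(1)])
        (auto simp: continuous_on_eq_continuous_at)
  next
    show "set_integrable lborel (einterval 0 \<infinity>) h" using int by (simp add: E)
    show "(((\<lambda>y. q y * V y) \<circ> real_of_ereal) \<longlongrightarrow> q 0 * V 0) (at_right 0)"
      using \<theta>' continuous_on_subset[OF cV] by (intro tendsto_at_right_ereal_0 continuous_intros) auto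
    have "\<forall>\<^sub>F y in at_top. 0 = q y * V y" using eventually_ge_at_top[of Y] by eventually_elim (simp add: Y)
    then have "((\<lambda>y. q y * V y) \<longlongrightarrow> 0) at_top" by (rule Lim_transform_eventually[OF tendsto_const])
    then show "(((\<lambda>y. q y * V y) \<circ> real_of_ereal) \<longlongrightarrow> 0) (at_left \<infinity>)"
      by (simp add: ereal_tendsto_simps1)
  qed simp
  then have "(LBINT y:{0<..}. h y) = M * V 0"
    using \<theta>' by (simp add: interval_lebesgue_integral_def E M_def)
  moreover have "(\<integral> y. \<mu> * \<theta> y * V y + y powr (2 * s - 1) * q y * V' y \<partial>height_measure s) = (LBINT y:{0<..}. h y)"
    by (subst integral_height_measure(1)) (auto intro!: set_lebesgue_integral_cong simp: h)
  ultimately show ?thesis by (simp add: M_def)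
qed

text \<open>The product of the norms of G and W is an integrable majorant. The approximating fields
  therefore need only converge pointwise under a square integrable bound.\<close>

lemma integral_inner_dominated_convergence:
  fixes G :: "'a \<Rightarrow> 'b::euclidean_space" and W :: "'a \<Rightarrow> 'c::euclidean_space"
  assumes G: "L2_fun M G" and W: "L2_fun M W"
    and m: "\<And>n. H n \<in> borel_measurable M" "H' \<in> borel_measurable M"
    and lim: "AE x in M. (\<lambda>n. H n x) \<longlonglongrightarrow> H' x"
    and le: "\<And>n. AE x in M. norm (H n x) \<le> norm (W x)"
  shows "(\<lambda>n. \<integral>x. G x \<bullet> H n x \<partial>M) \<longlonglongrightarrow> (\<integral>x. G x \<bullet> H' x \<partial>M)"
proof (rule integral_dominated_convergence[where w="\<lambda>x. norm (G x) * norm (W x)"])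
  have mG: "G \<in> borel_measurable M" "W \<in> borel_measurable M" using G W by (auto simp: L2_fun_def)
  have "L2_fun M (\<lambda>x. norm (G x))" "L2_fun M (\<lambda>x. norm (W x))"
    using G W by (auto simp: L2_fun_def)
  from L2_fun_integrable_inner[OF this] show "integrable M (\<lambda>x. norm (G x) * norm (W x))" by simp
  show "AE x in M. (\<lambda>n. G x \<bullet> H n x) \<longlonglongrightarrow> G x \<bullet> H' x"
    using lim by eventually_elim (intro tendsto_intros)
  show "AE x in M. norm (G x \<bullet> H n x) \<le> norm (G x) * norm (W x)" for n
    using le[of n]
  proof eventually_elim
    case (elim x)
    have "norm (G x \<bullet> H n x) \<le> norm (G x) * norm (H n x)"
      using Cauchy_Schwarz_ineq2 by auto
    also have "\<dots> \<le> norm (G x) * norm (W x)" using elim by (intro mult_left_mono) auto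
    finally show ?case .
  qed
  show "(\<lambda>x. G x \<bullet> H' x) \<in> borel_measurable M" using mG m by (intro borel_measurable_inner)
  show "(\<lambda>x. G x \<bullet> H n x) \<in> borel_measurable M" for n using mG m by (intro borel_measurable_inner)
qed

section \<open>Test functions that are products of an eigenfunction and a function of the
  height\<close>

lemma L2_tendsto_mult_right:
  fixes F :: "nat \<Rightarrow> 'a \<Rightarrow> real"
  assumes "L2_tendsto M F f"
  shows "L2_tendsto M (\<lambda>n x. F n x * c) (\<lambda>x. f x * c)"
proof -
  have m: "F n \<in> borel_measurable M" "f \<in> borel_measurable M" for n
    using assms by (auto simp: L2_tendsto_def)
  note [measurable] = m
  have "(\<integral>\<^sup>+ x. ennreal ((norm (F n x * c - f x * c))\<^sup>2) \<partial>M)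
     = ennreal (c\<^sup>2) * (\<integral>\<^sup>+ x. ennreal ((norm (F n x - f x))\<^sup>2) \<partial>M)" for n
  proof -
    have "(norm (F n x * c - f x * c))\<^sup>2 = c\<^sup>2 * (norm (F n x - f x))\<^sup>2" for x
      by (simp add: power2_eq_square algebra_simps)
    then show ?thesis
      by (subst nn_integral_cmult[symmetric]) (simp_all add: ennreal_mult)
  qed
  moreover have "(\<lambda>n. ennreal (c\<^sup>2) * (\<integral>\<^sup>+ x. ennreal ((norm (F n x - f x))\<^sup>2) \<partial>M)) \<longlonglongrightarrow> 0"
    using assms ennreal_tendsto_cmult[of "ennreal (c\<^sup>2)" "\<lambda>n. \<integral>\<^sup>+ x. ennreal ((norm (F n x - f x))\<^sup>2) \<partial>M" 0 sequentially]
    by (simp add: L2_tendsto_def)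
  ultimately show ?thesis using m by (simp add: L2_tendsto_def)
qed

lemma borel_measurable_tensor:
  fixes v :: "'a::euclidean_space \<Rightarrow> 'b::euclidean_space" and k :: "real \<Rightarrow> real"
  assumes [measurable]: "k \<in> borel_measurable borel" "v \<in> borel_measurable borel"
  shows "(\<lambda>p. k (snd p) *\<^sub>R v (fst p)) \<in> borel_measurable borel"
proof -
  have "(\<lambda>p. k (snd p) *\<^sub>R v (fst p)) \<in> borel_measurable (borel \<Otimes>\<^sub>M borel)" by measurable
  then show ?thesis by (simp add: borel_prod)
qed

lemma L2_fun_height_measureI:
  fixes k :: "real \<Rightarrow> real"
  assumes s: "s < 1" and k: "k \<in> borel_measurable borel" "\<And>y. y > 0 \<Longrightarrow> \<bar>k y\<bar> \<le> B * indicator {..R} y"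
  shows "L2_fun (height_measure s) k"
proof (rule L2_fun_bounded_support[where A="{..R}" and B=B])
  show "AE y in height_measure s. norm (k y) \<le> B * indicator {..R} y"
    using AE_height_measure_pos by eventually_elim (simp add: k)
  have "sets (height_measure s) = sets borel" by (rule sets_height_measure)
  then show "{..R} \<in> sets (height_measure s)" by simp
  show "k \<in> borel_measurable (height_measure s)"
    using k(1) by (simp cong: measurable_cong_sets add: sets_height_measure)
qed (rule emeasure_height_measure_atMost[OF s])

text \<open>The approximants are the products of \<eta> with the functions that approximate v in
  \<open>H10\<close>, and each error splits by Tonelli. Vanishing of \<eta> is asked only for y >=
  R, because heights below 0 are unconstrained in \<open>Cc_infty_cyl\<close>.\<close>

lemma H10L_tensor:
  fixes \<Omega> :: "'a::euclidean_space set"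
  assumes \<Omega>: "open \<Omega>" and s: "s < 1"
    and v: "H10 \<Omega> v g" "v \<in> borel_measurable borel" "g \<in> borel_measurable borel"
    and \<eta>: "smooth_on UNIV \<eta>" "\<And>y. y \<ge> R \<Longrightarrow> \<eta> y = 0" and R: "R > 0"
  shows "H10L s \<Omega> (\<lambda>p. \<eta> (snd p) *\<^sub>R v (fst p)) (\<lambda>p. (\<eta> (snd p) *\<^sub>R g (fst p), deriv \<eta> (snd p) *\<^sub>R v (fst p)))
    (\<lambda>x. v x * \<eta> 0)"
proof -
  have \<Omega>b: "\<Omega> \<in> sets borel" using \<Omega> by auto
  note d = smooth_on_real_deriv[OF \<eta>(1)]
  have c: "continuous_on UNIV \<eta>" by (rule smooth_on_continuous[OF \<eta>(1)])
  have m\<eta>: "\<eta> \<in> borel_measurable borel" "deriv \<eta> \<in> borel_measurable borel"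
    using c d(2) by (auto intro: borel_measurable_continuous_onI)
  have d0: "deriv \<eta> y = 0" if "y > R" for y
  proof -
    have "(\<eta> has_real_derivative 0) (at y)"
      by (rule has_field_derivative_transform_within_open[of "\<lambda>_. 0" _ _ "{R<..}"]) (use that \<eta>(2) in auto)
    then show ?thesis by (rule DERIV_imp_deriv)
  qed
  obtain B1 where B1: "B1 > 0" "\<And>y. y \<in> {0..R} \<Longrightarrow> norm (\<eta> y) \<le> B1"
    using continuous_compact_bounded[of "{0..R}" \<eta>] continuous_on_subset[OF c] by auto
  obtain B2 where B2: "B2 > 0" "\<And>y. y \<in> {0..R} \<Longrightarrow> norm (deriv \<eta> y) \<le> B2"
    using continuous_compact_bounded[of "{0..R}" "deriv \<eta>"] continuous_on_subset[OF d(2)] by auto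
  have L: "L2_fun (height_measure s) \<eta>" "L2_fun (height_measure s) (deriv \<eta>)"
    by (rule L2_fun_height_measureI[OF s m\<eta>(1), of B1 R], use B1 \<eta>(2) in \<open>auto simp: indicator_def\<close>)
      (rule L2_fun_height_measureI[OF s m\<eta>(2), of B2 R], use B2 d0 in \<open>auto simp: indicator_def\<close>)
  from v(1) obtain \<Phi> where \<Phi>: "\<And>n. \<Phi> n \<in> Cc_infty \<Omega>" "L2_tendsto (lebesgue_on \<Omega>) \<Phi> v"
    "L2_tendsto (lebesgue_on \<Omega>) (\<lambda>n. grad (\<Phi> n)) g"
    unfolding H10_def by blast
  have sm: "smooth_on UNIV (\<Phi> n)" for n using \<Phi>(1)[of n] by (auto simp: Cc_infty_def)
  have m: "\<Phi> n \<in> borel_measurable borel" "grad (\<Phi> n) \<in> borel_measurable borel" for n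
    using Cc_infty_L2_fun(3,4)[OF \<Omega> \<Phi>(1)] by auto
  define \<Psi> where "\<Psi> = (\<lambda>n p. \<Phi> n (fst p) * \<eta> (snd p))"
  have \<Psi>: "\<Psi> n \<in> Cc_infty_cyl \<Omega>" for n
  proof -
    obtain K where K: "compact K" "K \<subseteq> \<Omega>" "\<And>x. x \<notin> K \<Longrightarrow> \<Phi> n x = 0"
      using \<Phi>(1)[of n] by (auto simp: Cc_infty_def)
    have "compact (K \<times> {0..R})" "K \<times> {0..R} \<subseteq> \<Omega> \<times> {0..}"
      using K by (auto intro: compact_Times)
    moreover have "\<Psi> n (x, y) = 0" if "0 \<le> y" "(x, y) \<notin> K \<times> {0..R}" for x y
      using that K(3)[of x] \<eta>(2)[of y] by (auto simp: \<Psi>_def)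
    moreover have "smooth_on UNIV (\<Psi> n)"
      unfolding \<Psi>_def by (intro smooth_on_mult smooth_on_fst smooth_on_snd sm \<eta>)
    ultimately show ?thesis unfolding Cc_infty_cyl_def by blast
  qed
  have g: "grad (\<Psi> n) = (\<lambda>p. (\<eta> (snd p) *\<^sub>R grad (\<Phi> n) (fst p), deriv \<eta> (snd p) *\<^sub>R \<Phi> n (fst p)))" for n
    unfolding \<Psi>_def by (rule ext, subst grad_tensor[OF smooth_on_differentiable[OF sm] d(1)]) simp
  have P: "\<Psi> n = (\<lambda>p. \<eta> (snd p) *\<^sub>R \<Phi> n (fst p))" for n
    by (auto simp: \<Psi>_def)
  have "L2_tendsto (cyl_measure s \<Omega>) (\<lambda>n. grad (\<Psi> n))
      (\<lambda>p. (\<eta> (snd p) *\<^sub>R g (fst p), deriv \<eta> (snd p) *\<^sub>R v (fst p)))"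
    unfolding g by (intro L2_tendsto_Pair L2_tendsto_tensor[OF \<Omega>b] \<Phi> m v m\<eta> L)
  moreover have "L2_tendsto (cyl_measure s \<Omega>) \<Psi> (\<lambda>p. \<eta> (snd p) *\<^sub>R v (fst p))"
    using L2_tendsto_tensor[OF \<Omega>b \<Phi>(2) m(1) v(2) m\<eta>(1) L(1)] by (simp add: P[abs_def])
  moreover have "L2_tendsto (lebesgue_on \<Omega>) (\<lambda>n x. \<Psi> n (x, 0)) (\<lambda>x. v x * \<eta> 0)"
    using L2_tendsto_mult_right[OF \<Phi>(2)] by (simp add: \<Psi>_def)
  ultimately show ?thesis
    unfolding H10L_def using \<Psi> by blast
qed

section \<open>The bilinear form paired with eigenfunction times profile\<close>

text \<open>Admitting \<open>\<mu> = 0\<close>, with the constant profile 1, avoids a proof that the first Dirichlet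
  eigenvalue is positive.\<close>

locale eigen_profile =
  fixes \<Omega> :: "'a::euclidean_space set" and s \<kappa> \<mu> :: real and v g \<theta> q
  assumes \<Omega>: "open \<Omega>" "bounded \<Omega>" and s: "0 < s" "s < 1" and \<mu>: "\<mu> \<ge> 0"
    and v: "H10 \<Omega> v g" "v \<in> borel_measurable borel" "g \<in> borel_measurable borel"
    and eigen: "\<And>w gw. H10 \<Omega> w gw \<Longrightarrow> (\<integral>x. g x \<bullet> gw x \<partial>lebesgue_on \<Omega>) = \<mu> * (\<integral>x. v x * w x \<partial>lebesgue_on \<Omega>)"
    and g0: "\<mu> = 0 \<Longrightarrow> g = (\<lambda>_. 0)"
    and \<theta>: "decaying_profile s \<kappa> \<mu> \<theta> q"
begin

abbreviation "\<theta>' y \<equiv> y powr (2 * s - 1) * q y"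

lemma \<Omega>b [measurable]: "\<Omega> \<in> sets borel"
  using \<Omega> by auto

lemma measurable_vg [measurable]: "v \<in> borel_measurable borel" "g \<in> borel_measurable borel"
  "\<theta> \<in> borel_measurable borel" "q \<in> borel_measurable borel" "\<theta>' \<in> borel_measurable borel"
proof -
  show [measurable]: "\<theta> \<in> borel_measurable borel" "q \<in> borel_measurable borel"
    using \<theta> by (auto simp: decaying_profile_def)
  show "\<theta>' \<in> borel_measurable borel" by measurable
qed (use v in auto)

lemma L2_fun_vg: "L2_fun (lebesgue_on \<Omega>) v" "L2_fun (lebesgue_on \<Omega>) g"
  using H10_L2_fun[OF \<Omega>(1) v(1)] by auto

text \<open>At \<mu> = 0 the constant profile is not square integrable; the first field is then
  rescued by \<open>g0\<close> and the third by its factor \<mu>.\<close>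

lemma L2_fun_profile_tensor:
  "L2_fun (cyl_measure s \<Omega>) (\<lambda>p. \<theta> (snd p) *\<^sub>R g (fst p))"
  "L2_fun (cyl_measure s \<Omega>) (\<lambda>p. \<theta>' (snd p) *\<^sub>R v (fst p))"
  "L2_fun (cyl_measure s \<Omega>) (\<lambda>p. (\<mu> * \<theta> (snd p)) *\<^sub>R v (fst p))"
proof -
  note L = decaying_profile_L2_fun[OF \<theta> \<mu>]
  show "L2_fun (cyl_measure s \<Omega>) (\<lambda>p. \<theta>' (snd p) *\<^sub>R v (fst p))"
    by (rule L2_fun_tensor[OF \<Omega>b _ L2_fun_vg(1) _ L(1)]) measurable
  show "L2_fun (cyl_measure s \<Omega>) (\<lambda>p. \<theta> (snd p) *\<^sub>R g (fst p))"
  proof (cases "\<mu> = 0")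
    case True
    show ?thesis unfolding g0[OF True] by (simp add: L2_fun_def)
  next
    case False
    then show ?thesis
      using \<mu> by (intro L2_fun_tensor[OF \<Omega>b _ L2_fun_vg(2) _ L(2)]) auto
  qed
  show "L2_fun (cyl_measure s \<Omega>) (\<lambda>p. (\<mu> * \<theta> (snd p)) *\<^sub>R v (fst p))"
  proof (cases "\<mu> = 0")
    case True
    then show ?thesis by (simp add: L2_fun_def)
  next
    case False
    then have "L2_fun (cyl_measure s \<Omega>) (\<lambda>p. \<theta> (snd p) *\<^sub>R v (fst p))"
      using \<mu> by (intro L2_fun_tensor[OF \<Omega>b _ L2_fun_vg(1) _ L(2)]) auto
    then show ?thesis
      by (rule L2_fun_bound[where C="\<mu>"])
        (use \<mu> borel_measurable_tensor[of "\<lambda>y. \<mu> * \<theta> y" v] in \<open>auto intro!: measurable_cyl_measure simp: abs_mult\<close>)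
  qed
qed

text \<open>Test functions are handled slice by slice: the weak eigenvalue equation on horizontal slices
  turns the \<open>x\<close>-gradient into \<open>\<mu> \<Phi>\<close>, and the profile equation does the rest on vertical lines.\<close>

lemma bilinear_Cc_infty_cyl:
  assumes \<Phi>: "\<Phi> \<in> Cc_infty_cyl \<Omega>"
  shows "(\<integral>p. grad \<Phi> p \<bullet> (\<theta> (snd p) *\<^sub>R g (fst p), \<theta>' (snd p) *\<^sub>R v (fst p)) \<partial>cyl_measure s \<Omega>)
    = \<kappa> * \<mu> powr s * (\<integral>x. \<Phi> (x, 0) * v x \<partial>lebesgue_on \<Omega>)"
proof -
  let ?P = "base_measure \<Omega> \<Otimes>\<^sub>M height_measure s"
  interpret base: sigma_finite_measure "base_measure \<Omega>" by (rule sigma_finite_base_measure) simp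
  interpret height: sigma_finite_measure "height_measure s" by (rule sigma_finite_height_measure)
  interpret P: pair_sigma_finite "base_measure \<Omega>" "height_measure s" ..
  have sm: "smooth_on UNIV \<Phi>" using \<Phi> by (auto simp: Cc_infty_cyl_def)
  note L = Cc_infty_cyl_L2_fun[OF \<Omega> s(2) \<Phi>]
  have [measurable]: "\<Phi> \<in> borel_measurable (borel \<Otimes>\<^sub>M borel)" "grad \<Phi> \<in> borel_measurable (borel \<Otimes>\<^sub>M borel)"
    using L(3,4) by (simp_all add: borel_prod)
  \<comment> \<open>Horizontal part, vertical part, and the function that replaces the horizontal
    one. They are kept apart because f1 is exchanged for f3 under an inner x-integral, whereas f3 +
    f2 is evaluated under an inner y-integral; each is integrable by itself.\<close>
  define f1 where "f1 = (\<lambda>p. fst (grad \<Phi> p) \<bullet> (\<theta> (snd p) *\<^sub>R g (fst p)))"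
  define f2 where "f2 = (\<lambda>p. snd (grad \<Phi> p) \<bullet> (\<theta>' (snd p) *\<^sub>R v (fst p)))"
  define f3 where "f3 = (\<lambda>p. \<Phi> p \<bullet> ((\<mu> * \<theta> (snd p)) *\<^sub>R v (fst p)))"
  have mg: "(\<lambda>p. fst (grad \<Phi> p)) \<in> borel_measurable borel" "(\<lambda>p. snd (grad \<Phi> p)) \<in> borel_measurable borel"
    using smooth_on_continuous_grad[OF sm] by (auto intro!: borel_measurable_continuous_onI continuous_intros)
  have m': "f1 \<in> borel_measurable borel" "f2 \<in> borel_measurable borel" "f3 \<in> borel_measurable borel"
  proof -
    have \<mu>\<theta>: "(\<lambda>y. \<mu> * \<theta> y) \<in> borel_measurable borel" by measurable
    show "f1 \<in> borel_measurable borel" "f2 \<in> borel_measurable borel" "f3 \<in> borel_measurable borel"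
      unfolding f1_def f2_def f3_def
      by (rule borel_measurable_inner[OF mg(1) borel_measurable_tensor[OF measurable_vg(3,2)]],
          rule borel_measurable_inner[OF mg(2) borel_measurable_tensor[OF measurable_vg(5,1)]],
          rule borel_measurable_inner[OF L(3) borel_measurable_tensor[OF \<mu>\<theta> measurable_vg(1)]])
  qed
  have m [measurable]: "f1 \<in> borel_measurable (borel \<Otimes>\<^sub>M borel)" "f2 \<in> borel_measurable (borel \<Otimes>\<^sub>M borel)"
    "f3 \<in> borel_measurable (borel \<Otimes>\<^sub>M borel)"
    using m' by (simp_all add: borel_prod)
  have "L2_fun (cyl_measure s \<Omega>) (\<lambda>p. fst (grad \<Phi> p))"
    by (rule L2_fun_bound[OF L(2) measurable_cyl_measure[OF mg(1)], of 1])
      (auto intro!: always_eventually norm_fst_le[of "fst z" "snd z" for z, simplified])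
  then have i1: "integrable (cyl_measure s \<Omega>) f1"
    unfolding f1_def by (rule L2_fun_integrable_inner[OF _ L2_fun_profile_tensor(1)])
  have "L2_fun (cyl_measure s \<Omega>) (\<lambda>p. snd (grad \<Phi> p))"
    by (rule L2_fun_bound[OF L(2) measurable_cyl_measure[OF mg(2)], of 1])
      (use norm_snd_le[where x="fst z" and y="snd z" for z :: "'a \<times> real"] in \<open>simp add: always_eventually\<close>)
  then have i2: "integrable (cyl_measure s \<Omega>) f2"
    unfolding f2_def by (rule L2_fun_integrable_inner[OF _ L2_fun_profile_tensor(2)])
  have i3: "integrable (cyl_measure s \<Omega>) f3"
    unfolding f3_def by (rule L2_fun_integrable_inner[OF L(1) L2_fun_profile_tensor(3)])
  have I: "integrable ?P f1" "integrable ?P f2" "integrable ?P f3"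
    using i1 i2 i3 m' by (simp_all add: integrable_cyl_measure[OF \<Omega>b])
  have slice: "(\<integral>x. f1 (x, y) \<partial>base_measure \<Omega>) = (\<integral>x. f3 (x, y) \<partial>base_measure \<Omega>)" if y: "y > 0" for y
  proof -
    let ?w = "\<lambda>x. \<Phi> (x, y)"
    have w: "?w \<in> Cc_infty \<Omega>" using Cc_infty_cyl_slice[OF \<Phi>] y by simp
    have gw: "fst (grad \<Phi> (x, y)) = grad ?w x" for x
      using grad_slice(1)[OF smooth_on_differentiable[OF sm]] by simp
    note mw = Cc_infty_L2_fun(3,4)[OF \<Omega>(1) w]
    have "(\<integral>x. f1 (x, y) \<partial>base_measure \<Omega>) = (\<integral>x. \<theta> y * (g x \<bullet> grad ?w x) \<partial>base_measure \<Omega>)"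
      by (simp add: f1_def gw inner_commute)
    also have "\<dots> = \<theta> y * (\<integral>x. g x \<bullet> grad ?w x \<partial>lebesgue_on \<Omega>)"
      using mw by (subst integral_base_measure[OF \<Omega>b]) (auto intro: borel_measurable_inner)
    also have "\<dots> = \<theta> y * (\<mu> * (\<integral>x. v x * ?w x \<partial>lebesgue_on \<Omega>))"
      using eigen[OF Cc_infty_H10[OF \<Omega>(1) w]] by simp
    also have "\<dots> = \<theta> y * (\<mu> * (\<integral>x. v x * ?w x \<partial>base_measure \<Omega>))"
      using mw by (subst integral_base_measure[OF \<Omega>b]) auto
    also have "\<dots> = (\<integral>x. (\<theta> y * \<mu>) * (v x * ?w x) \<partial>base_measure \<Omega>)" by simp
    also have "\<dots> = (\<integral>x. f3 (x, y) \<partial>base_measure \<Omega>)"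
      by (simp add: f3_def mult_ac)
    finally show ?thesis .
  qed
  have "(\<integral>p. f1 p \<partial>?P) = (\<integral>y. \<integral>x. f1 (x, y) \<partial>base_measure \<Omega> \<partial>height_measure s)"
    using P.integral_snd[of "\<lambda>x y. f1 (x, y)"] I(1) by simp
  also have "\<dots> = (\<integral>y. \<integral>x. f3 (x, y) \<partial>base_measure \<Omega> \<partial>height_measure s)"
  proof (rule integral_cong_AE)
    show "AE y in height_measure s. (\<integral>x. f1 (x, y) \<partial>base_measure \<Omega>) = (\<integral>x. f3 (x, y) \<partial>base_measure \<Omega>)"
      using AE_height_measure_pos by eventually_elim (rule slice)
  qed measurable
  also have "\<dots> = (\<integral>p. f3 p \<partial>?P)"
    using P.integral_snd[of "\<lambda>x y. f3 (x, y)"] I(3) by simp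
  finally have e13: "(\<integral>p. f1 p \<partial>?P) = (\<integral>p. f3 p \<partial>?P)" .
  obtain Y where Y: "Y > 0" "\<And>x y. 0 \<le> y \<Longrightarrow> Y \<le> y \<Longrightarrow> \<Phi> (x, y) = 0"
    using Cc_infty_cyl_support[OF \<Omega>(1) \<Phi>] by metis
  have line: "(\<integral>y. f3 (x, y) + f2 (x, y) \<partial>height_measure s) = v x * (\<kappa> * \<mu> powr s * \<Phi> (x, 0))" for x
  proof -
    have "continuous_on UNIV (\<lambda>y. grad \<Phi> (x, y))"
      by (rule continuous_on_compose2[OF smooth_on_continuous_grad[OF sm]]) (auto intro!: continuous_intros)
    then have c: "continuous_on UNIV (\<lambda>y. snd (grad \<Phi> (x, y)))" by (intro continuous_intros)
    have "(\<integral>y. \<mu> * \<theta> y * \<Phi> (x, y) + \<theta>' y * snd (grad \<Phi> (x, y)) \<partial>height_measure s) = \<kappa> * \<mu> powr s * \<Phi> (x, 0)"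
      using grad_slice(2)[OF smooth_on_differentiable[OF sm]] Y
      by (intro decaying_profile_pairing[OF \<theta> \<mu> s _ c, of _ Y]) auto
    then have "(\<integral>y. v x * (\<mu> * \<theta> y * \<Phi> (x, y) + \<theta>' y * snd (grad \<Phi> (x, y))) \<partial>height_measure s)
        = v x * (\<kappa> * \<mu> powr s * \<Phi> (x, 0))" by simp
    then show ?thesis by (simp add: f2_def f3_def algebra_simps)
  qed
  have "(\<integral>p. grad \<Phi> p \<bullet> (\<theta> (snd p) *\<^sub>R g (fst p), \<theta>' (snd p) *\<^sub>R v (fst p)) \<partial>cyl_measure s \<Omega>)
      = (\<integral>p. f1 p + f2 p \<partial>cyl_measure s \<Omega>)"
    by (simp add: f1_def f2_def inner_prod_def)
  also have "\<dots> = (\<integral>p. f1 p + f2 p \<partial>?P)"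
    using m' by (intro integral_cyl_measure[OF \<Omega>b] borel_measurable_add)
  also have "\<dots> = (\<integral>p. f3 p + f2 p \<partial>?P)" using I e13 by simp
  also have "\<dots> = (\<integral>x. \<integral>y. f3 (x, y) + f2 (x, y) \<partial>height_measure s \<partial>base_measure \<Omega>)"
    using P.integral_fst[of "\<lambda>x y. f3 (x, y) + f2 (x, y)"] I by (simp add: case_prod_unfold)
  also have "\<dots> = (\<integral>x. v x * (\<kappa> * \<mu> powr s * \<Phi> (x, 0)) \<partial>base_measure \<Omega>)"
    by (simp only: line)
  also have "\<dots> = \<kappa> * \<mu> powr s * (\<integral>x. \<Phi> (x, 0) * v x \<partial>base_measure \<Omega>)"
    by (subst integral_mult_right_zero[symmetric]) (simp add: mult_ac)
  also have "(\<integral>x. \<Phi> (x, 0) * v x \<partial>base_measure \<Omega>) = (\<integral>x. \<Phi> (x, 0) * v x \<partial>lebesgue_on \<Omega>)"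
    using Cc_infty_L2_fun(3)[OF \<Omega>(1) Cc_infty_cyl_slice[OF \<Phi>, of 0]]
    by (subst integral_base_measure[OF \<Omega>b]) auto
  finally show ?thesis .
qed

lemma H10L_L2_fun:
  assumes "H10L s \<Omega> U G u"
  shows "L2_fun (cyl_measure s \<Omega>) G" "L2_fun (lebesgue_on \<Omega>) u"
  using assms Cc_infty_cyl_L2_fun(2)[OF \<Omega> s(2)] Cc_infty_L2_fun(1)[OF \<Omega>(1) Cc_infty_cyl_slice[of _ _ 0]]
  by (auto simp: H10L_def intro: L2_tendsto_L2_fun)

text \<open>Both sides are continuous along the sequence that witnesses \<open>H10L\<close>. The
  second field enters only as a square integrable one, so it need not be the gradient of a member of
  the space.\<close>

lemma bilinear_H10L:
  assumes "H10L s \<Omega> U G u"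
  shows "(\<integral>p. G p \<bullet> (\<theta> (snd p) *\<^sub>R g (fst p), \<theta>' (snd p) *\<^sub>R v (fst p)) \<partial>cyl_measure s \<Omega>)
    = \<kappa> * \<mu> powr s * (\<integral>x. u x * v x \<partial>lebesgue_on \<Omega>)"
proof -
  from assms obtain \<Phi> where \<Phi>: "\<And>n. \<Phi> n \<in> Cc_infty_cyl \<Omega>"
    "L2_tendsto (cyl_measure s \<Omega>) (\<lambda>n. grad (\<Phi> n)) G" "L2_tendsto (lebesgue_on \<Omega>) (\<lambda>n x. \<Phi> n (x, 0)) u"
    unfolding H10L_def by blast
  have "(\<lambda>n. \<integral>x. \<Phi> n (x, 0) \<bullet> v x \<partial>lebesgue_on \<Omega>) \<longlonglongrightarrow> (\<integral>x. u x \<bullet> v x \<partial>lebesgue_on \<Omega>)"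
    by (intro L2_tendsto_inner \<Phi> L2_fun_vg Cc_infty_L2_fun(1)[OF \<Omega>(1) Cc_infty_cyl_slice[OF \<Phi>(1)]]) auto
  then have "(\<lambda>n. \<kappa> * \<mu> powr s * (\<integral>x. \<Phi> n (x, 0) * v x \<partial>lebesgue_on \<Omega>)) \<longlonglongrightarrow> \<kappa> * \<mu> powr s * (\<integral>x. u x * v x \<partial>lebesgue_on \<Omega>)"
    by (intro tendsto_mult_left) simp
  moreover have "(\<lambda>n. \<integral>p. grad (\<Phi> n) p \<bullet> (\<theta> (snd p) *\<^sub>R g (fst p), \<theta>' (snd p) *\<^sub>R v (fst p)) \<partial>cyl_measure s \<Omega>)
     \<longlonglongrightarrow> (\<integral>p. G p \<bullet> (\<theta> (snd p) *\<^sub>R g (fst p), \<theta>' (snd p) *\<^sub>R v (fst p)) \<partial>cyl_measure s \<Omega>)"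
    by (intro L2_tendsto_inner \<Phi> L2_fun_Pair L2_fun_profile_tensor Cc_infty_cyl_L2_fun(2)[OF \<Omega> s(2)])
  ultimately show ?thesis
    unfolding bilinear_Cc_infty_cyl[OF \<Phi>(1)] using LIMSEQ_unique by blast
qed

text \<open>Integrability is imposed on the products of the majorants with g and v, not on the
  majorants alone. This lets \<theta> serve as its own majorant against g, including the constant
  profile, where g = 0.\<close>

lemma tendsto_bilinear_tensor:
  assumes G: "L2_fun (cyl_measure s \<Omega>) G"
    and m: "\<And>n. k0 n \<in> borel_measurable borel" "\<And>n. k1 n \<in> borel_measurable borel"
      "l0 \<in> borel_measurable borel" "l1 \<in> borel_measurable borel"
    and lim: "\<And>y. y > 0 \<Longrightarrow> (\<lambda>n. k0 n y) \<longlonglongrightarrow> l0 y" "\<And>y. y > 0 \<Longrightarrow> (\<lambda>n. k1 n y) \<longlonglongrightarrow> l1 y"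
    and le: "\<And>n y. y > 0 \<Longrightarrow> \<bar>k0 n y\<bar> \<le> \<bar>W0 y\<bar>" "\<And>n y. y > 0 \<Longrightarrow> \<bar>k1 n y\<bar> \<le> \<bar>W1 y\<bar>"
    and W: "L2_fun (cyl_measure s \<Omega>) (\<lambda>p. W0 (snd p) *\<^sub>R g (fst p))" "L2_fun (cyl_measure s \<Omega>) (\<lambda>p. W1 (snd p) *\<^sub>R v (fst p))"
  shows "(\<lambda>n. \<integral>p. G p \<bullet> (k0 n (snd p) *\<^sub>R g (fst p), k1 n (snd p) *\<^sub>R v (fst p)) \<partial>cyl_measure s \<Omega>)
    \<longlonglongrightarrow> (\<integral>p. G p \<bullet> (l0 (snd p) *\<^sub>R g (fst p), l1 (snd p) *\<^sub>R v (fst p)) \<partial>cyl_measure s \<Omega>)"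
proof (rule integral_inner_dominated_convergence[OF G L2_fun_Pair[OF W]])
  show "(\<lambda>p. (k0 n (snd p) *\<^sub>R g (fst p), k1 n (snd p) *\<^sub>R v (fst p))) \<in> borel_measurable (cyl_measure s \<Omega>)" for n
    by (intro borel_measurable_Pair measurable_cyl_measure borel_measurable_tensor m measurable_vg)
  show "(\<lambda>p. (l0 (snd p) *\<^sub>R g (fst p), l1 (snd p) *\<^sub>R v (fst p))) \<in> borel_measurable (cyl_measure s \<Omega>)"
    by (intro borel_measurable_Pair measurable_cyl_measure borel_measurable_tensor m measurable_vg)
  note pos = AE_cyl_measure_height[OF \<Omega>(1), of s]
  show "AE p in cyl_measure s \<Omega>. (\<lambda>n. (k0 n (snd p) *\<^sub>R g (fst p), k1 n (snd p) *\<^sub>R v (fst p)))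
      \<longlonglongrightarrow> (l0 (snd p) *\<^sub>R g (fst p), l1 (snd p) *\<^sub>R v (fst p))"
    using pos by eventually_elim (intro tendsto_intros lim)
  show "AE p in cyl_measure s \<Omega>. norm (k0 n (snd p) *\<^sub>R g (fst p), k1 n (snd p) *\<^sub>R v (fst p))
      \<le> norm (W0 (snd p) *\<^sub>R g (fst p), W1 (snd p) *\<^sub>R v (fst p))" for n
    using pos
  proof eventually_elim
    case (elim p)
    then show ?case
      unfolding norm_Pair by (intro real_sqrt_le_mono add_mono power_mono) (auto intro!: mult_right_mono le simp: abs_mult)
  qed
qed

end

section \<open>Regularising and truncating the profile\<close>

lemma smooth_on_powr_shift:
  assumes "\<epsilon> > 0"
  shows "smooth_on UNIV (\<lambda>y::real. (y\<^sup>2 + \<epsilon>) powr b)"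
proof -
  have pos: "y\<^sup>2 + \<epsilon> > 0" for y :: real using assms by (simp add: add_nonneg_pos)
  have "((\<lambda>y. (y\<^sup>2 + \<epsilon>) powr b) has_real_derivative
      (\<Sum>j\<in>{b - 1}. (2 * b * y) * (y\<^sup>2 + \<epsilon>) powr j)) (at y)" for b y :: real
  proof -
    have "((\<lambda>y. y\<^sup>2 + \<epsilon>) has_real_derivative 2 * y) (at y)"
      by (auto intro!: derivative_eq_intros)
    from DERIV_chain2[OF has_real_derivative_powr[OF pos] this] show ?thesis by (simp add: mult_ac)
  qed
  then show ?thesis
    by (rule smooth_on_realI[where c="\<lambda>b j y. 2 * b * y"])
      (auto intro: smooth_on_mult[OF smooth_on_const smooth_on_id])
qed

text \<open>The factor \<open>exp 1\<close> normalises the value at y = 0 to 1, so that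
  multiplication preserves traces. Instead of a plateau near 0 the arguments use the derivative
  bound 2e / R.\<close>

definition cutoff :: "real \<Rightarrow> real \<Rightarrow> real" where
  "cutoff R y = exp 1 * flat 0 (1 - y / R)"

definition cutoff' :: "real \<Rightarrow> real \<Rightarrow> real" where
  "cutoff' R y = - (exp 1 / R) * flat 2 (1 - y / R)"

lemma cutoff_smooth: "smooth_on UNIV (cutoff R)"
proof -
  have "bounded_linear (\<lambda>y. - (y / R) :: real)"
    by (intro bounded_linear_minus bounded_linear_divide)
  from smooth_on_affine_compose[OF this smooth_on_flat, of 0 1]
  have "smooth_on UNIV (\<lambda>y. flat 0 (1 - y / R))" by simp
  from smooth_on_mult[OF smooth_on_const this] show ?thesis
    unfolding cutoff_def[abs_def] .
qed

lemma cutoff_DERIV: "(cutoff R has_real_derivative cutoff' R y) (at y)"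
proof -
  have "((\<lambda>y. 1 - y / R) has_real_derivative (- 1 / R)) (at y)"
    by (cases "R = 0") (auto intro!: derivative_eq_intros)
  from DERIV_cmult[OF DERIV_chain2[OF flat_DERIV[of 0] this], of "exp 1"]
  show ?thesis unfolding cutoff_def[abs_def] cutoff'_def
    by (rule DERIV_cong) (simp add: numeral_2_eq_2)
qed

lemma cutoff_0: "R > 0 \<Longrightarrow> cutoff R 0 = 1"
  by (simp add: cutoff_def flat_def exp_minus)

lemma cutoff_eq_0: "R > 0 \<Longrightarrow> y \<ge> R \<Longrightarrow> cutoff R y = 0" "R > 0 \<Longrightarrow> y \<ge> R \<Longrightarrow> cutoff' R y = 0"
  by (auto simp: cutoff_def cutoff'_def flat_def field_simps)

lemma cutoff_le: assumes "R > 0" "y \<ge> 0" shows "\<bar>cutoff R y\<bar> \<le> 1"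
proof -
  have "flat 0 (1 - y / R) \<le> exp (- 1)"
  proof (cases "1 - y / R > 0")
    case True
    have "1 - y / R \<le> 1" using assms by simp
    then have "1 \<le> 1 / (1 - y / R)" using True by (simp add: le_divide_eq)
    then show ?thesis using True by (simp add: flat_def)
  qed (simp add: flat_def)
  then have "exp 1 * flat 0 (1 - y / R) \<le> exp 1 * exp (- 1)" by (intro mult_left_mono) auto
  then show ?thesis using flat_nonneg by (simp add: cutoff_def exp_minus)
qed

lemma cutoff'_le: assumes "R > 0" shows "\<bar>cutoff' R y\<bar> \<le> 2 * exp 1 / R"
proof -
  have "flat 2 (1 - y / R) \<le> 2"
    using flat_le[of "1 - y / R" 2] by (cases "1 - y / R > 0") (auto simp: flat_def fact_numeral)
  then have "exp 1 / R * flat 2 (1 - y / R) \<le> exp 1 / R * 2"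
    using assms by (intro mult_left_mono) auto
  then show ?thesis using assms flat_nonneg[of 2 "1 - y / R"]
    by (simp add: cutoff'_def abs_mult mult.commute)
qed

lemma cutoff_tendsto: "(\<lambda>n. cutoff (real (Suc n)) y) \<longlonglongrightarrow> 1" "(\<lambda>n. cutoff' (real (Suc n)) y) \<longlonglongrightarrow> 0"
proof -
  have i: "(\<lambda>n. inverse (real (Suc n))) \<longlonglongrightarrow> 0" by (rule LIMSEQ_inverse_real_of_nat)
  have "isCont (flat 0) 1" using DERIV_isCont[OF flat_DERIV] .
  moreover have "(\<lambda>n. 1 - y * inverse (real (Suc n))) \<longlonglongrightarrow> 1"
    using tendsto_diff[OF tendsto_const tendsto_mult[OF tendsto_const i], of 1 y] by simp
  ultimately have "(\<lambda>n. flat 0 (1 - y * inverse (real (Suc n)))) \<longlonglongrightarrow> flat 0 1"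
    by (rule isCont_tendsto_compose)
  then have "(\<lambda>n. exp 1 * flat 0 (1 - y * inverse (real (Suc n)))) \<longlonglongrightarrow> exp 1 * flat 0 1"
    by (intro tendsto_intros)
  then show "(\<lambda>n. cutoff (real (Suc n)) y) \<longlonglongrightarrow> 1"
    by (simp add: cutoff_def divide_inverse flat_def exp_minus)
  show "(\<lambda>n. cutoff' (real (Suc n)) y) \<longlonglongrightarrow> 0"
  proof (rule Lim_null_comparison)
    have "(\<lambda>n. 2 * exp 1 * inverse (real (Suc n))) \<longlonglongrightarrow> 2 * exp 1 * 0" by (intro tendsto_intros i)
    then show "(\<lambda>n. 2 * exp 1 / real (Suc n)) \<longlonglongrightarrow> (0::real)" by (simp add: divide_inverse)
    show "\<forall>\<^sub>F n in sequentially. norm (cutoff' (real (Suc n)) y) \<le> 2 * exp 1 / real (Suc n)"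
      by (rule always_eventually) (use cutoff'_le in auto)
  qed
qed

text \<open>A majorant, up to a constant, for the cutoff derivatives of all radii n + 1. Its
  weighted square behaves like y^(-1-2s) at infinity, which is integrable as s > 0, and like the
  weight near 0.\<close>

lemma L2_fun_height_measure_decay:
  assumes s: "0 < s" "s < 1"
  shows "L2_fun (height_measure s) (\<lambda>y. 1 / (1 + y))"
proof (rule L2_funI)
  have "set_integrable lborel ({0<..1} \<union> {1..}) (\<lambda>y. y powr (1 - 2 * s) * (norm (1 / (1 + y)))\<^sup>2)"
  proof (rule set_integrable_Un)
    show "set_integrable lborel {0<..1} (\<lambda>y. y powr (1 - 2 * s) * (norm (1 / (1 + y)))\<^sup>2)"
    proof (rule set_integrable_bound[OF set_integrable_powr_0[of "1 - 2 * s"]])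
      have "y powr (1 - 2 * s) * (norm (1 / (1 + y)))\<^sup>2 \<le> y powr (1 - 2 * s) * 1" if "y > 0" for y :: real
        using that by (intro mult_left_mono power_le_one) auto
      then show "AE y in lborel. y \<in> {0<..1} \<longrightarrow> norm (y powr (1 - 2 * s) * (norm (1 / (1 + y)))\<^sup>2) \<le> norm (y powr (1 - 2 * s))"
        by (intro AE_I2 impI) (simp add: abs_mult)
    qed (use s in \<open>auto simp: set_borel_measurable_def\<close>)
    show "set_integrable lborel {1..} (\<lambda>y. y powr (1 - 2 * s) * (norm (1 / (1 + y)))\<^sup>2)"
    proof (rule set_integrable_bound[OF set_integrable_powr_inf[of "- 1 - 2 * s"]])
      have "y powr (1 - 2 * s) * (norm (1 / (1 + y)))\<^sup>2 \<le> y powr (- 1 - 2 * s)" if "y \<ge> 1" for y :: real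
      proof -
        have "(norm (1 / (1 + y)))\<^sup>2 \<le> (1 / y)\<^sup>2"
          using that by (intro power_mono) (auto simp: field_simps)
        then have "y powr (1 - 2 * s) * (norm (1 / (1 + y)))\<^sup>2 \<le> y powr (1 - 2 * s) * (1 / y)\<^sup>2"
          by (intro mult_left_mono) auto
        also have "\<dots> = y powr (- 1 - 2 * s)"
          using that powr_diff[of y "1 - 2 * s" 2] by (simp add: power_divide)
        finally show ?thesis .
      qed
      then show "AE y in lborel. y \<in> {1..} \<longrightarrow> norm (y powr (1 - 2 * s) * (norm (1 / (1 + y)))\<^sup>2) \<le> norm (y powr (- 1 - 2 * s))"
        by (intro AE_I2 impI) (simp add: abs_mult)
    qed (use s in \<open>auto simp: set_borel_measurable_def\<close>)
  qed auto
  moreover have "{0<..1} \<union> {1..} = {0::real<..}" by auto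
  ultimately show "integrable (height_measure s) (\<lambda>y. (norm (1 / (1 + y)))\<^sup>2)"
    by (subst integral_height_measure(2)) auto
qed measurable

text \<open>This power is the size of the derivative of y^(2s) near 0. Its weighted square is again
  y^(2s-1), integrable at 0 because s > 0.\<close>

lemma L2_fun_height_measure_powr:
  assumes s: "0 < s" "s < 1"
  shows "L2_fun (height_measure s) (\<lambda>y. y powr (2 * s - 1) * indicator {..R} y)"
proof (rule L2_funI)
  have "set_integrable lborel {0<..R} (\<lambda>y. y powr (2 * s - 1))"
    using s by (intro set_integrable_powr_0) auto
  moreover have "y powr (1 - 2 * s) * (y powr (2 * s - 1))\<^sup>2 = y powr (2 * s - 1)" if "y > 0" for y
    using that by (simp add: power2_eq_square powr_add[symmetric])
  then have "(\<lambda>y. indicator {0<..} y *\<^sub>R (y powr (1 - 2 * s) * (norm (y powr (2 * s - 1) * indicator {..R} y))\<^sup>2))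
     = (\<lambda>y. indicator {0<..R} y *\<^sub>R y powr (2 * s - 1))"
    by (auto simp: indicator_def fun_eq_iff)
  ultimately show "integrable (height_measure s) (\<lambda>y. (norm (y powr (2 * s - 1) * indicator {..R} y))\<^sup>2)"
    by (subst integral_height_measure(2)) (simp_all add: set_integrable_def)
qed measurable

context eigen_profile
begin

text \<open>Smooth compactly supported approximations of \<open>v(x) \<theta>(y)\<close>: near \<open>y = 0\<close> the singular factor
  \<open>y\<^sup>2\<^sup>s\<close> is replaced by \<open>(y\<^sup>2 + \<epsilon>)\<^sup>s\<close>, whose derivative is dominated by that of \<open>y\<^sup>2\<^sup>s\<close>.\<close>

lemma test_identity_profile:
  assumes G: "L2_fun (cyl_measure s \<Omega>) G"
    and a: "smooth_on UNIV a" and e: "smooth_on UNIV e"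
    and \<theta>ae: "\<And>y. y \<ge> 0 \<Longrightarrow> \<theta> y = a y - y powr (2 * s) * e y"
    and test: "\<And>\<eta> R. smooth_on UNIV \<eta> \<Longrightarrow> R > 0 \<Longrightarrow> (\<And>y. y \<ge> R \<Longrightarrow> \<eta> y = 0) \<Longrightarrow>
      (\<integral>p. G p \<bullet> (\<eta> (snd p) *\<^sub>R g (fst p), deriv \<eta> (snd p) *\<^sub>R v (fst p)) \<partial>cyl_measure s \<Omega>) = D * \<eta> 0"
  shows "(\<integral>p. G p \<bullet> (\<theta> (snd p) *\<^sub>R g (fst p), \<theta>' (snd p) *\<^sub>R v (fst p)) \<partial>cyl_measure s \<Omega>) = D"
proof -
  note da = smooth_on_real_deriv[OF a] and de = smooth_on_real_deriv[OF e]
  have ca: "continuous_on UNIV a" "continuous_on UNIV e" using a e smooth_on_continuous by auto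
  have [measurable]: "a \<in> borel_measurable borel" "e \<in> borel_measurable borel"
    "deriv a \<in> borel_measurable borel" "deriv e \<in> borel_measurable borel"
    using ca da(2) de(2) by (auto intro: borel_measurable_continuous_onI)
  have cut [measurable]: "cutoff R \<in> borel_measurable borel" "cutoff' R \<in> borel_measurable borel" for R
  proof -
    have "cutoff' R = deriv (cutoff R)" using DERIV_imp_deriv[OF cutoff_DERIV] by auto
    then show "cutoff R \<in> borel_measurable borel" "cutoff' R \<in> borel_measurable borel"
      using smooth_on_continuous[OF cutoff_smooth] smooth_on_real_deriv(2)[OF cutoff_smooth]
      by (auto intro: borel_measurable_continuous_onI)
  qed
  have a0: "a 0 = 1" using \<theta>ae[of 0] \<theta> s by (simp add: decaying_profile_def)
  have \<theta>'ae: "\<theta>' y = deriv a y - (2 * s * y powr (2 * s - 1) * e y + y powr (2 * s) * deriv e y)" if y: "y > 0" for y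
  proof -
    have "((\<lambda>y. a y - y powr (2 * s) * e y) has_real_derivative
       deriv a y - (2 * s * y powr (2 * s - 1) * e y + deriv e y * y powr (2 * s))) (at y)"
      by (intro DERIV_diff DERIV_mult da(1) de(1) has_real_derivative_powr y)
    then have "(\<theta> has_real_derivative
       deriv a y - (2 * s * y powr (2 * s - 1) * e y + deriv e y * y powr (2 * s))) (at y)"
      by (rule has_field_derivative_transform_within_open[of _ _ _ "{0<..}"]) (use y \<theta>ae in auto)
    moreover have "(\<theta> has_real_derivative \<theta>' y) (at y)"
      using \<theta> y by (auto simp: decaying_profile_def)
    ultimately show ?thesis using DERIV_unique by (fastforce simp: mult.commute)
  qed
  let ?I = "\<lambda>k0 k1. \<integral>p. G p \<bullet> (k0 (snd p) *\<^sub>R g (fst p), k1 (snd p) *\<^sub>R v (fst p)) \<partial>cyl_measure s \<Omega>"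
  \<comment> \<open>First limit, at a fixed cutoff radius R: the regularisation parameter
    \<open>E n\<close> tends to 0. The limit in the radius follows afterwards.\<close>
  have step: "?I (\<lambda>y. cutoff R y * \<theta> y) (\<lambda>y. cutoff' R y * \<theta> y + cutoff R y * \<theta>' y) = D" if R: "R > 0" for R
  proof -
    define E where "E = (\<lambda>n. inverse (real (Suc n)))"
    have E: "E n > 0" "E n \<le> 1" for n by (auto simp: E_def inverse_le_1_iff)
    have E0: "E \<longlonglongrightarrow> 0" unfolding E_def by (rule LIMSEQ_inverse_real_of_nat)
    define Z where "Z = (\<lambda>n y. a y - (y\<^sup>2 + E n) powr s * e y)"
    define Z' where "Z' = (\<lambda>n y. deriv a y - (2 * s * (y * (y\<^sup>2 + E n) powr (s - 1)) * e y + (y\<^sup>2 + E n) powr s * deriv e y))"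
    have dZ: "(Z n has_real_derivative Z' n y) (at y)" for n y
    proof -
      have pos: "y\<^sup>2 + E n > 0" using E(1)[of n] by (simp add: add_nonneg_pos)
      have "((\<lambda>y. y\<^sup>2 + E n) has_real_derivative 2 * y) (at y)"
        by (auto intro!: derivative_eq_intros)
      from DERIV_diff[OF da(1) DERIV_mult[OF DERIV_chain2[OF has_real_derivative_powr[OF pos] this] de(1)]]
      show ?thesis unfolding Z_def Z'_def by (rule DERIV_cong) (simp add: mult_ac)
    qed
    have sZ: "smooth_on UNIV (Z n)" for n
      unfolding Z_def by (intro smooth_on_diff smooth_on_mult smooth_on_powr_shift a e E)
    define \<eta> where "\<eta> = (\<lambda>n y. cutoff R y * Z n y)"
    have s\<eta>: "smooth_on UNIV (\<eta> n)" for n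
      unfolding \<eta>_def by (intro smooth_on_mult cutoff_smooth sZ)
    have d\<eta>: "deriv (\<eta> n) y = cutoff' R y * Z n y + cutoff R y * Z' n y" for n y
      unfolding \<eta>_def by (rule DERIV_imp_deriv, rule DERIV_cong[OF DERIV_mult[OF cutoff_DERIV dZ]]) (simp add: mult_ac)
    have \<eta>R: "\<eta> n y = 0" if "y \<ge> R" for n y using cutoff_eq_0[OF R that] by (simp add: \<eta>_def)
    \<comment> \<open>On the right-hand side only the value at y = 0 matters; it is
      \<open>a 0 - E n powr s * e 0\<close>, with limit \<open>a 0 = 1\<close>.\<close>
    have \<eta>0: "(\<lambda>n. D * \<eta> n 0) \<longlonglongrightarrow> D"
    proof -
      have "(\<lambda>n. E n powr s) \<longlonglongrightarrow> 0"
        using tendsto_powr'[OF E0 tendsto_const[of s]] E s by (simp add: less_imp_le)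
      then have "(\<lambda>n. D * (cutoff R 0 * (a 0 - E n powr s * e 0))) \<longlonglongrightarrow> D * (cutoff R 0 * (a 0 - 0 * e 0))"
        by (intro tendsto_intros)
      then show ?thesis by (simp add: \<eta>_def Z_def cutoff_0[OF R] a0)
    qed
    obtain B where B: "B > 0" "\<And>y. y \<in> {0..R} \<Longrightarrow> \<bar>a y\<bar> \<le> B \<and> \<bar>e y\<bar> \<le> B \<and> \<bar>deriv a y\<bar> \<le> B \<and> \<bar>deriv e y\<bar> \<le> B"
    proof -
      have "continuous_on {0..R} (\<lambda>y. ((a y, e y), (deriv a y, deriv e y)))"
        using ca da(2) de(2) by (auto intro!: continuous_on_Pair elim: continuous_on_subset)
      from continuous_compact_bounded[OF compact_Icc this]
      obtain B where B: "B > 0" "\<And>y. y \<in> {0..R} \<Longrightarrow> norm ((a y, e y), (deriv a y, deriv e y)) \<le> B" by blast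
      have "\<bar>a y\<bar> \<le> norm ((a y, e y), (deriv a y, deriv e y)) \<and> \<bar>e y\<bar> \<le> norm ((a y, e y), (deriv a y, deriv e y)) \<and>
        \<bar>deriv a y\<bar> \<le> norm ((a y, e y), (deriv a y, deriv e y)) \<and> \<bar>deriv e y\<bar> \<le> norm ((a y, e y), (deriv a y, deriv e y))" for y
        by (auto simp: norm_Pair intro!: real_le_rsqrt)
      then show thesis using that[of B] B by (meson order_trans)
    qed
    define S where "S = (R\<^sup>2 + 1) powr s"
    define C where "C = B + S * B"
    have S: "S \<ge> 0" by (simp add: S_def)
    have C: "C \<ge> 0" using B S by (simp add: C_def)
    have bZ: "\<bar>Z n y\<bar> \<le> C" "\<bar>Z' n y\<bar> \<le> C + 2 * B * y powr (2 * s - 1)" if y: "0 < y" "y \<le> R" for n y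
    proof -
      have yR: "y \<in> {0..R}" using y by auto
      have b: "\<bar>a y\<bar> \<le> B" "\<bar>e y\<bar> \<le> B" "\<bar>deriv a y\<bar> \<le> B" "\<bar>deriv e y\<bar> \<le> B" using B(2)[OF yR] by auto
      have "y\<^sup>2 \<le> R\<^sup>2" using y by (intro power_mono) auto
      then have "(y\<^sup>2 + E n) powr s \<le> S"
        unfolding S_def using E[of n] s by (intro powr_mono2) (auto intro: add_mono)
      then have m: "\<bar>(y\<^sup>2 + E n) powr s * e y\<bar> \<le> S * B" "\<bar>(y\<^sup>2 + E n) powr s * deriv e y\<bar> \<le> S * B"
        unfolding abs_mult using b S by (auto intro!: mult_mono)
      then show "\<bar>Z n y\<bar> \<le> C" using b unfolding Z_def C_def by linarith
      \<comment> \<open>The exponent s - 1 is negative, so dropping the shift enlarges the power.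
        The bound becomes independent of n and, after multiplication by y, is the square integrable
        y^(2s-1).\<close>
      have "(y\<^sup>2 + E n) powr (s - 1) \<le> (y\<^sup>2) powr (s - 1)"
        using E[of n] s y by (intro powr_mono2') auto
      also have "(y\<^sup>2) powr (s - 1) = y powr (2 * s - 2)"
        using y powr_powr[of y 2 "s - 1"] by (simp add: algebra_simps)
      finally have "y * (y\<^sup>2 + E n) powr (s - 1) \<le> y * y powr (2 * s - 2)"
        using y by (intro mult_left_mono) auto
      also have "\<dots> = y powr (2 * s - 1)"
        using y powr_add[of y 1 "2 * s - 2"] by simp
      finally have "\<bar>2 * s * (y * (y\<^sup>2 + E n) powr (s - 1)) * e y\<bar> \<le> 2 * 1 * y powr (2 * s - 1) * B"
        unfolding abs_mult using b s y by (intro mult_mono) auto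
      then show "\<bar>Z' n y\<bar> \<le> C + 2 * B * y powr (2 * s - 1)"
        using m b unfolding Z'_def C_def by (simp add: mult_ac)
    qed
    define W0 where "W0 = (\<lambda>y. C * indicator {..R} y :: real)"
    \<comment> \<open>The first term bounds the cutoff derivative times \<open>Z n\<close> together
      with the regular part of \<open>Z' n\<close>; the second bounds the part of
      \<open>Z' n\<close> that is singular at y = 0.\<close>
    define W1 where "W1 = (\<lambda>y. (2 * exp 1 / R * C + C) * indicator {..R} y + 2 * B * (y powr (2 * s - 1) * indicator {..R} y))"
    have W0L: "L2_fun (height_measure s) W0"
      by (rule L2_fun_height_measureI[OF s(2), where B=C and R=R]) (use C in \<open>auto simp: W0_def indicator_def\<close>)
    have W1L: "L2_fun (height_measure s) W1"
      unfolding W1_def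
    proof (rule L2_fun_add)
      show "L2_fun (height_measure s) (\<lambda>y. (2 * exp 1 / R * C + C) * indicator {..R} y)"
        by (rule L2_fun_height_measureI[OF s(2), where B="2 * exp 1 / R * C + C" and R=R])
          (use C R in \<open>auto simp: indicator_def\<close>)
      show "L2_fun (height_measure s) (\<lambda>y. 2 * B * (y powr (2 * s - 1) * indicator {..R} y))"
        by (rule L2_fun_bound[OF L2_fun_height_measure_powr[OF s], where C="2 * B"])
          (use B in \<open>auto simp: abs_mult\<close>)
    qed
    have mW [measurable]: "W0 \<in> borel_measurable borel" "W1 \<in> borel_measurable borel"
      unfolding W0_def W1_def by measurable
    have "(\<lambda>n. ?I (\<eta> n) (deriv (\<eta> n))) \<longlonglongrightarrow>
       ?I (\<lambda>y. cutoff R y * \<theta> y) (\<lambda>y. cutoff' R y * \<theta> y + cutoff R y * \<theta>' y)"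
    proof (rule tendsto_bilinear_tensor[OF G, where ?W0.0=W0 and ?W1.0=W1])
      show "\<eta> n \<in> borel_measurable borel" "deriv (\<eta> n) \<in> borel_measurable borel" for n
        using smooth_on_continuous[OF s\<eta>] smooth_on_real_deriv(2)[OF s\<eta>]
        by (auto intro: borel_measurable_continuous_onI)
      show "(\<lambda>y. cutoff R y * \<theta> y) \<in> borel_measurable borel"
        "(\<lambda>y. cutoff' R y * \<theta> y + cutoff R y * \<theta>' y) \<in> borel_measurable borel" by measurable
      show "L2_fun (cyl_measure s \<Omega>) (\<lambda>p. W0 (snd p) *\<^sub>R g (fst p))"
        by (rule L2_fun_tensor[OF \<Omega>b measurable_vg(2) L2_fun_vg(2) mW(1) W0L])
      show "L2_fun (cyl_measure s \<Omega>) (\<lambda>p. W1 (snd p) *\<^sub>R v (fst p))"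
        by (rule L2_fun_tensor[OF \<Omega>b measurable_vg(1) L2_fun_vg(1) mW(2) W1L])
      fix y :: real assume y: "y > 0"
      have p: "y\<^sup>2 > 0" using y by simp
      have l: "(\<lambda>n. (y\<^sup>2 + E n) powr b) \<longlonglongrightarrow> y powr (2 * b)" for b
      proof -
        have "(\<lambda>n. (y\<^sup>2 + E n) powr b) \<longlonglongrightarrow> (y\<^sup>2 + 0) powr b"
          using p by (intro tendsto_intros E0) auto
        moreover have "(y\<^sup>2) powr b = y powr (2 * b)" using y powr_powr[of y 2 b] by simp
        ultimately show ?thesis by simp
      qed
      have yy: "y * y powr (2 * (s - 1)) = y powr (2 * s - 1)"
        using y powr_add[of y 1 "2 * s - 2"] by (simp add: algebra_simps)
      have Zl: "(\<lambda>n. Z n y) \<longlonglongrightarrow> \<theta> y"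
        unfolding Z_def \<theta>ae[OF less_imp_le[OF y]] by (intro tendsto_intros l)
      have Z'l: "(\<lambda>n. Z' n y) \<longlonglongrightarrow> \<theta>' y"
      proof -
        have "(\<lambda>n. Z' n y) \<longlonglongrightarrow> deriv a y - (2 * s * (y * y powr (2 * (s - 1))) * e y + y powr (2 * s) * deriv e y)"
          unfolding Z'_def by (intro tendsto_intros l)
        then show ?thesis unfolding \<theta>'ae[OF y] yy .
      qed
      show "(\<lambda>n. \<eta> n y) \<longlonglongrightarrow> cutoff R y * \<theta> y"
        unfolding \<eta>_def by (intro tendsto_intros Zl)
      show "(\<lambda>n. deriv (\<eta> n) y) \<longlonglongrightarrow> cutoff' R y * \<theta> y + cutoff R y * \<theta>' y"
        unfolding d\<eta> by (intro tendsto_intros Zl Z'l)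
      fix n
      show "\<bar>\<eta> n y\<bar> \<le> \<bar>W0 y\<bar>"
      proof (cases "y \<le> R")
        case True
        have "\<bar>\<eta> n y\<bar> \<le> 1 * C"
          unfolding \<eta>_def abs_mult using cutoff_le[OF R] bZ[OF y True] y by (intro mult_mono) auto
        then show ?thesis using True C by (simp add: W0_def)
      qed (simp add: \<eta>R)
      show "\<bar>deriv (\<eta> n) y\<bar> \<le> \<bar>W1 y\<bar>"
      proof (cases "y \<le> R")
        case True
        have "\<bar>cutoff' R y * Z n y\<bar> \<le> (2 * exp 1 / R) * C"
          unfolding abs_mult using cutoff'_le[OF R] bZ[OF y True] R by (intro mult_mono) auto
        moreover have "\<bar>cutoff R y * Z' n y\<bar> \<le> 1 * (C + 2 * B * y powr (2 * s - 1))"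
          unfolding abs_mult using cutoff_le[OF R] bZ[OF y True] y by (intro mult_mono) auto
        ultimately have "\<bar>deriv (\<eta> n) y\<bar> \<le> W1 y"
          unfolding d\<eta> W1_def using True by simp
        then show ?thesis by simp
      qed (simp add: d\<eta> cutoff_eq_0[OF R])
    qed
    moreover have "?I (\<eta> n) (deriv (\<eta> n)) = D * \<eta> n 0" for n
      by (rule test[OF s\<eta> R \<eta>R])
    ultimately show ?thesis using LIMSEQ_unique[OF _ \<eta>0] by simp
  qed
  \<comment> \<open>Majorant for the second limit. On the support of the cutoff, y <= n + 1 gives 1
    / (n + 1) <= 2 / (1 + y), which turns the derivative bound 2e / (n + 1) into 4e / (1 +
    y).\<close>
  define W1 where "W1 = (\<lambda>y. 4 * exp 1 * (1 / (1 + y)) + \<bar>\<theta>' y\<bar>)"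
  have mW [measurable]: "W1 \<in> borel_measurable borel" unfolding W1_def by measurable
  have W1L: "L2_fun (height_measure s) W1"
    unfolding W1_def
  proof (rule L2_fun_add)
    show "L2_fun (height_measure s) (\<lambda>y. 4 * exp 1 * (1 / (1 + y)))"
      by (rule L2_fun_bound[OF L2_fun_height_measure_decay[OF s], where C="4 * exp 1"]) (auto simp: abs_mult)
    show "L2_fun (height_measure s) (\<lambda>y. \<bar>\<theta>' y\<bar>)"
      by (rule L2_fun_bound[OF decaying_profile_L2_fun(1)[OF \<theta> \<mu>], where C=1]) auto
  qed
  have "(\<lambda>n. ?I (\<lambda>y. cutoff (Suc n) y * \<theta> y) (\<lambda>y. cutoff' (Suc n) y * \<theta> y + cutoff (Suc n) y * \<theta>' y)) \<longlonglongrightarrow> ?I \<theta> \<theta>'"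
  proof (rule tendsto_bilinear_tensor[OF G, where ?W0.0=\<theta> and ?W1.0=W1])
    show "(\<lambda>y. cutoff (Suc n) y * \<theta> y) \<in> borel_measurable borel"
      "(\<lambda>y. cutoff' (Suc n) y * \<theta> y + cutoff (Suc n) y * \<theta>' y) \<in> borel_measurable borel"
      "\<theta> \<in> borel_measurable borel" "\<theta>' \<in> borel_measurable borel" for n by measurable
    show "L2_fun (cyl_measure s \<Omega>) (\<lambda>p. \<theta> (snd p) *\<^sub>R g (fst p))" by (rule L2_fun_profile_tensor)
    show "L2_fun (cyl_measure s \<Omega>) (\<lambda>p. W1 (snd p) *\<^sub>R v (fst p))"
      by (rule L2_fun_tensor[OF \<Omega>b measurable_vg(1) L2_fun_vg(1) mW W1L])
    fix y :: real assume y: "y > 0"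
    show "(\<lambda>n. cutoff (Suc n) y * \<theta> y) \<longlonglongrightarrow> \<theta> y"
      using tendsto_mult[OF cutoff_tendsto(1)[of y] tendsto_const[of "\<theta> y"]] by simp
    show "(\<lambda>n. cutoff' (Suc n) y * \<theta> y + cutoff (Suc n) y * \<theta>' y) \<longlonglongrightarrow> \<theta>' y"
      using tendsto_add[OF tendsto_mult[OF cutoff_tendsto(2)[of y] tendsto_const[of "\<theta> y"]]
          tendsto_mult[OF cutoff_tendsto(1)[of y] tendsto_const[of "\<theta>' y"]]] by simp
    fix n
    have n: "real (Suc n) > 0" by simp
    have t: "\<bar>\<theta> y\<bar> \<le> 1" using \<theta> y by (simp add: decaying_profile_def)
    have c: "\<bar>cutoff (Suc n) y\<bar> \<le> 1" using cutoff_le[OF n] y by simp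
    show "\<bar>cutoff (Suc n) y * \<theta> y\<bar> \<le> \<bar>\<theta> y\<bar>"
      using mult_right_mono[OF c, of "\<bar>\<theta> y\<bar>"] by (simp add: abs_mult)
    have "\<bar>cutoff' (Suc n) y * \<theta> y\<bar> \<le> 4 * exp 1 * (1 / (1 + y))"
    proof (cases "y \<le> Suc n")
      case True
      have "\<bar>cutoff' (Suc n) y * \<theta> y\<bar> \<le> (2 * exp 1 / Suc n) * 1"
        unfolding abs_mult using cutoff'_le[OF n] t by (intro mult_mono) auto
      also have "1 / real (Suc n) \<le> 2 / (1 + y)" using True y by (simp add: field_simps)
      then have "2 * exp 1 * (1 / real (Suc n)) \<le> 2 * exp 1 * (2 / (1 + y))" by (intro mult_left_mono) auto
      then have "(2 * exp 1 / Suc n) * 1 \<le> 4 * exp 1 * (1 / (1 + y))" by simp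
      finally show ?thesis .
    next
      case False
      then show ?thesis using cutoff_eq_0(2)[OF n, of y] y by simp
    qed
    moreover have "\<bar>cutoff (Suc n) y * \<theta>' y\<bar> \<le> 1 * \<bar>\<theta>' y\<bar>"
      unfolding abs_mult[of "cutoff (Suc n) y"] by (intro mult_right_mono c) auto
    ultimately show "\<bar>cutoff' (Suc n) y * \<theta> y + cutoff (Suc n) y * \<theta>' y\<bar> \<le> \<bar>W1 y\<bar>"
      unfolding W1_def by linarith
  qed
  then have "(\<lambda>n::nat. D) \<longlonglongrightarrow> ?I \<theta> \<theta>'" using step by simp
  then show ?thesis using LIMSEQ_unique tendsto_const by blast
qed

end

text \<open>One integral is evaluated twice. As the limit of the tested equation it equals
  \<open>kappa s\<close> times the integral of F against the eigenfunction; by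
  \<open>bilinear_H10L\<close> it equals \<open>kappa s * \<mu> powr s\<close> times the integral of
  u against it. The factor \<open>kappa s\<close> cancels by positivity. All conclusions concern a
  Borel representative v' of v.\<close>

lemma weak_solution_eigenfunction:
  assumes \<Omega>: "open \<Omega>" "bounded \<Omega>" and s: "0 < s" "s < 1" and \<mu>: "\<mu> \<ge> 0"
    and v: "H10 \<Omega> v g"
    and eigen: "\<And>w gw. H10 \<Omega> w gw \<Longrightarrow> (\<integral>x. g x \<bullet> gw x \<partial>lebesgue_on \<Omega>) = \<mu> * (\<integral>x. v x * w x \<partial>lebesgue_on \<Omega>)"
    and U: "H10L s \<Omega> U G u"
    and weak: "\<And>\<Psi> H \<psi>. H10L s \<Omega> \<Psi> H \<psi> \<Longrightarrow> integrable (lebesgue_on \<Omega>) (\<lambda>x. f x (u x) * \<psi> x) \<and>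
       inverse (kappa s) * (\<integral>p. G p \<bullet> H p \<partial>(cyl_measure s \<Omega>)) = (\<integral>x. F x * \<psi> x \<partial>lebesgue_on \<Omega>)"
  obtains v' where "v' \<in> borel_measurable borel" "AE x in lebesgue_on \<Omega>. v x = v' x"
    "integrable (lebesgue_on \<Omega>) (\<lambda>x. f x (u x) * v' x)"
    "(\<integral>x. F x * v' x \<partial>lebesgue_on \<Omega>) = \<mu> powr s * (\<integral>x. u x * v' x \<partial>lebesgue_on \<Omega>)"
    "L2_fun (lebesgue_on \<Omega>) u" "L2_fun (lebesgue_on \<Omega>) v'"
proof -
  have \<Omega>b: "\<Omega> \<in> sets borel" "\<Omega> \<in> sets lebesgue" using \<Omega> by auto
  note L = H10_L2_fun[OF \<Omega>(1) v]
  obtain v' where v': "v' \<in> borel_measurable borel" "AE x in lebesgue_on \<Omega>. v x = v' x"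
    using lebesgue_on_ex_borel_measurable[OF L2_fun_measurable[OF L(1)] \<Omega>b(2)] by blast
  obtain g' where g': "g' \<in> borel_measurable borel" "AE x in lebesgue_on \<Omega>. g x = g' x" "\<mu> = 0 \<Longrightarrow> g' = (\<lambda>_. 0)"
  proof (cases "\<mu> = 0")
    case True
    \<comment> \<open>The eigenvalue equation tested with v itself shows that g vanishes almost
      everywhere, so its representative can be taken identically zero.\<close>
    have "(\<integral>x. (norm (g x))\<^sup>2 \<partial>lebesgue_on \<Omega>) = 0"
      using eigen[OF v] True by (simp add: power2_norm_eq_inner)
    then have "AE x in lebesgue_on \<Omega>. (norm (g x))\<^sup>2 = 0"
      using integral_nonneg_eq_0_iff_AE[OF L2_fun_integrable_sq[OF L(2)]] by auto
    then show thesis by (intro that[of "\<lambda>_. 0"]) auto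
  next
    case False
    obtain g' where "g' \<in> borel_measurable borel" "AE x in lebesgue_on \<Omega>. g x = g' x"
      using lebesgue_on_ex_borel_measurable[OF L2_fun_measurable[OF L(2)] \<Omega>b(2)] by blast
    then show thesis using that False by blast
  qed
  have H: "H10 \<Omega> v' g'" by (rule H10_cong[OF v v'(2) g'(2) v'(1) g'(1)])
  have eigen': "(\<integral>x. g' x \<bullet> gw x \<partial>lebesgue_on \<Omega>) = \<mu> * (\<integral>x. v' x * w x \<partial>lebesgue_on \<Omega>)" if w: "H10 \<Omega> w gw" for w gw
  proof -
    note mm = L2_fun_measurable[OF H10_L2_fun(1)[OF \<Omega>(1) w]] L2_fun_measurable[OF H10_L2_fun(2)[OF \<Omega>(1) w]]
      L2_fun_measurable[OF L(1)] L2_fun_measurable[OF L(2)]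
      measurable_lebesgue_on_borel[OF v'(1)] measurable_lebesgue_on_borel[OF g'(1)]
    have "(\<integral>x. g' x \<bullet> gw x \<partial>lebesgue_on \<Omega>) = (\<integral>x. g x \<bullet> gw x \<partial>lebesgue_on \<Omega>)"
    proof (rule integral_cong_AE)
      show "AE x in lebesgue_on \<Omega>. g' x \<bullet> gw x = g x \<bullet> gw x" using g'(2) by eventually_elim simp
    qed (intro borel_measurable_inner mm)+
    also have "\<dots> = \<mu> * (\<integral>x. v x * w x \<partial>lebesgue_on \<Omega>)" by (rule eigen[OF w])
    also have "(\<integral>x. v x * w x \<partial>lebesgue_on \<Omega>) = (\<integral>x. v' x * w x \<partial>lebesgue_on \<Omega>)"
    proof (rule integral_cong_AE)
      show "AE x in lebesgue_on \<Omega>. v x * w x = v' x * w x" using v'(2) by eventually_elim simp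
    qed (intro borel_measurable_times mm)+
    finally show ?thesis .
  qed
  obtain \<theta> q a e where \<theta>: "decaying_profile s (kappa s) \<mu> \<theta> q" and ae: "smooth_on UNIV a" "smooth_on UNIV e"
    "\<And>y. y \<ge> 0 \<Longrightarrow> \<theta> y = a y - y powr (2 * s) * e y"
    using smooth_decaying_profile_exists[OF s \<mu>] by metis
  interpret eigen_profile \<Omega> s "kappa s" \<mu> v' g' \<theta> q
    by unfold_locales (fact \<Omega> s \<mu> H v' g' eigen' \<theta>)+
  note LU = H10L_L2_fun[OF U]
  define D where "D = (\<integral>x. F x * v' x \<partial>lebesgue_on \<Omega>)"
  have \<kappa>: "kappa s > 0" by (rule kappa_pos[OF s])
  have I: "(\<integral>p. G p \<bullet> (\<theta> (snd p) *\<^sub>R g' (fst p), \<theta>' (snd p) *\<^sub>R v' (fst p)) \<partial>cyl_measure s \<Omega>) = kappa s * D"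
  proof (rule test_identity_profile[OF LU(1) ae])
    fix \<eta> :: "real \<Rightarrow> real" and R :: real
    assume \<eta>: "smooth_on UNIV \<eta>" "R > 0" "\<And>y. y \<ge> R \<Longrightarrow> \<eta> y = 0"
    have "inverse (kappa s) * (\<integral>p. G p \<bullet> (\<eta> (snd p) *\<^sub>R g' (fst p), deriv \<eta> (snd p) *\<^sub>R v' (fst p)) \<partial>cyl_measure s \<Omega>)
      = (\<integral>x. F x * (v' x * \<eta> 0) \<partial>lebesgue_on \<Omega>)"
      using weak[OF H10L_tensor[OF \<Omega>(1) s(2) H v'(1) g'(1) \<eta>(1,3,2)]] by simp
    also have "\<dots> = D * \<eta> 0" by (simp add: D_def mult.assoc[symmetric])
    finally show "(\<integral>p. G p \<bullet> (\<eta> (snd p) *\<^sub>R g' (fst p), deriv \<eta> (snd p) *\<^sub>R v' (fst p)) \<partial>cyl_measure s \<Omega>)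
      = kappa s * D * \<eta> 0"
      using \<kappa> by (simp add: field_simps)
  qed
  with bilinear_H10L[OF U] \<kappa> have D: "D = \<mu> powr s * (\<integral>x. u x * v' x \<partial>lebesgue_on \<Omega>)" by simp
  have int: "integrable (lebesgue_on \<Omega>) (\<lambda>x. f x (u x) * v' x)"
  proof -
    \<comment> \<open>A single admissible test function with trace v', since \<open>cutoff 1\<close>
      equals 1 at y = 0; the weak formulation then supplies integrability against v'.\<close>
    have t: "H10L s \<Omega> (\<lambda>p. cutoff 1 (snd p) *\<^sub>R v' (fst p))
       (\<lambda>p. (cutoff 1 (snd p) *\<^sub>R g' (fst p), deriv (cutoff 1) (snd p) *\<^sub>R v' (fst p))) (\<lambda>x. v' x * cutoff 1 0)"
      by (rule H10L_tensor[OF \<Omega>(1) s(2) H v'(1) g'(1) cutoff_smooth, of 1]) (auto simp: cutoff_eq_0)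
    then show ?thesis using weak[OF t] by (simp add: cutoff_0)
  qed
  show thesis
    by (rule that[OF v' int _ LU(2) L2_fun_vg(1)]) (use D in \<open>simp add: D_def\<close>)
qed

section \<open>The slope condition and the conclusion\<close>

lemma locally_lipschitz_on_continuous:
  assumes "locally_lipschitz_on S f"
  shows "continuous_on S f"
  unfolding continuous_on_eq_continuous_within
proof
  fix p assume p: "p \<in> S"
  then obtain e L where e: "e > 0" and L: "L-lipschitz_on (ball p e \<inter> S) f"
    using assms unfolding locally_lipschitz_on_def by blast
  have "continuous (at p within ball p e \<inter> S) f"
    using lipschitz_on_continuous_on[OF L] p e by (auto simp: continuous_on_eq_continuous_within)
  moreover have "at p within ball p e \<inter> S = at p within S"
    using e by (intro at_within_nhd[of p "ball p e"]) auto
  ultimately show "continuous (at p within S) f" by simp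
qed

text \<open>On both tails f(x, \<xi>) >= c \<xi>: for \<xi> < 0 an upper bound on the quotient turns
  into a lower bound on f. Between the tails f is bounded by M on the compact set
  \<open>closure \<Omega> \<times> {-R..R}\<close>, which gives C = M + |c| R.\<close>

lemma uniform_slopes_lower_bound:
  fixes f :: "'a::euclidean_space \<Rightarrow> real \<Rightarrow> real"
  assumes \<Omega>: "open \<Omega>" "bounded \<Omega>"
    and f: "continuous_on (closure \<Omega> \<times> UNIV) (\<lambda>(x, \<xi>). f x \<xi>)"
    and sl: "uniform_slopes_separated_by \<Omega> f c"
  obtains C where "AE x in lebesgue_on \<Omega>. \<forall>\<xi>. c * \<xi> - f x \<xi> \<le> C"
proof -
  obtain a b R where ab: "a < c" "c < b" "R > 0" and
    AE: "AE x in lebesgue_on \<Omega>. (\<forall>\<xi>. \<xi> \<le> - R \<longrightarrow> f x \<xi> / \<xi> \<le> a) \<and> (\<forall>\<xi>. \<xi> \<ge> R \<longrightarrow> f x \<xi> / \<xi> \<ge> b)"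
    using sl unfolding uniform_slopes_separated_by_def by blast
  have "compact (closure \<Omega> \<times> {-R..R})"
    using \<Omega>(2) by (intro compact_Times) auto
  moreover have "continuous_on (closure \<Omega> \<times> {-R..R}) (\<lambda>(x, \<xi>). f x \<xi>)"
    by (rule continuous_on_subset[OF f]) auto
  ultimately obtain M where M: "M > 0" "\<And>p. p \<in> closure \<Omega> \<times> {-R..R} \<Longrightarrow> norm ((\<lambda>(x, \<xi>). f x \<xi>) p) \<le> M"
    using continuous_compact_bounded by blast
  have "AE x in lebesgue_on \<Omega>. x \<in> \<Omega>" by (rule AE_I2) (simp add: space_restrict_space)
  with AE have "AE x in lebesgue_on \<Omega>. \<forall>\<xi>. c * \<xi> - f x \<xi> \<le> M + \<bar>c\<bar> * R"
  proof eventually_elim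
    case (elim x)
    show ?case
    proof
      fix \<xi>
      have nn: "0 \<le> M + \<bar>c\<bar> * R" using M ab by simp
      consider "\<xi> \<le> - R" | "\<xi> \<ge> R" | "\<bar>\<xi>\<bar> \<le> R" by linarith
      then show "c * \<xi> - f x \<xi> \<le> M + \<bar>c\<bar> * R"
      proof cases
        case 1
        then have "f x \<xi> / \<xi> \<le> c" "\<xi> < 0" using elim ab by force+
        then have "c * \<xi> \<le> f x \<xi>" by (simp add: divide_le_eq)
        then show ?thesis using nn by linarith
      next
        case 2
        then have "c \<le> f x \<xi> / \<xi>" "\<xi> > 0" using elim ab by force+
        then have "c * \<xi> \<le> f x \<xi>" by (simp add: le_divide_eq)
        then show ?thesis using nn by linarith
      next
        case 3
        have "(x, \<xi>) \<in> closure \<Omega> \<times> {-R..R}" using elim 3 closure_subset by auto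
        from M(2)[OF this] have "\<bar>f x \<xi>\<bar> \<le> M" by simp
        moreover have "c * \<xi> \<le> \<bar>c\<bar> * R"
          using mult_mono[OF order.refl 3, of "\<bar>c\<bar>"] abs_ge_self[of "c * \<xi>"] by (simp add: abs_mult)
        ultimately show ?thesis by linarith
      qed
    qed
  qed
  then show thesis by (rule that)
qed

theorem mainTheorem3:
  fixes s :: real
    and \<Omega> :: "(real ^ 'n) set"
    and lam :: "nat \<Rightarrow> real"
    and \<phi> :: "nat \<Rightarrow> real ^ 'n \<Rightarrow> real"
    and f :: "real ^ 'n \<Rightarrow> real \<Rightarrow> real"
  assumes "0 < s" and "s < 1"
    and "real CARD('n) > 2 * s"
    and "smooth_bounded_domain \<Omega>"
    and "dirichlet_eigensystem \<Omega> lam \<phi>"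
    and "locally_lipschitz_on (closure \<Omega> \<times> UNIV) (\<lambda>(x, \<xi>). f x \<xi>)"
    and "uniform_slopes_separated_by \<Omega> f (lam 1 powr s)"
  shows "\<exists>\<tau>::real. \<forall>h \<in> Linfty \<Omega>. (\<integral>x. h x * \<phi> 1 x \<partial>(lebesgue_on \<Omega>)) = 0 \<longrightarrow>
           (\<forall>t>\<tau>. \<not> (\<exists>U. weak_solution s \<Omega> f (\<phi> 1) t h U))"
proof -
  let ?M = "lebesgue_on \<Omega>"
  define \<mu> where "\<mu> = lam 1"
  define v where "v = \<phi> 1"
  have \<Omega>: "open \<Omega>" "bounded \<Omega>" using assms(4) by (auto simp: smooth_bounded_domain_def)
  have sys: "dirichlet_eigenpair \<Omega> \<mu> v" "(\<integral>x. v x * v x \<partial>?M) = 1" "AE x in ?M. v x > 0"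
    using assms(5) by (auto simp: dirichlet_eigensystem_def \<mu>_def v_def)
  obtain g where v: "H10 \<Omega> v g" and
    eigen: "\<And>w gw. H10 \<Omega> w gw \<Longrightarrow> (\<integral>x. g x \<bullet> gw x \<partial>?M) = \<mu> * (\<integral>x. v x * w x \<partial>?M)"
    using sys(1) unfolding dirichlet_eigenpair_def by blast
  \<comment> \<open>The normalised eigenfunction is tested with itself.\<close>
  have "\<mu> = (\<integral>x. g x \<bullet> g x \<partial>?M)" using eigen[OF v] sys(2) by simp
  then have \<mu>: "\<mu> \<ge> 0" by simp
  obtain C where C: "AE x in ?M. \<forall>\<xi>. \<mu> powr s * \<xi> - f x \<xi> \<le> C"
    using uniform_slopes_lower_bound[OF \<Omega> locally_lipschitz_on_continuous[OF assms(6)] assms(7)[folded \<mu>_def]] .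
  have one: "L2_fun ?M (\<lambda>x. 1::real)"
  proof (rule L2_funI)
    have "emeasure ?M (space ?M) < \<infinity>"
      using emeasure_bounded_finite[OF \<Omega>(2)] \<Omega>(1)
      by (simp add: emeasure_restrict_space space_restrict_space)
    then show "integrable ?M (\<lambda>x. (norm (1::real))\<^sup>2)"
      using integrable_indicator_iff[of ?M "space ?M"] by (simp add: integrable_iff_bounded)
  qed simp
  note Lv = H10_L2_fun(1)[OF \<Omega>(1) v]
  \<comment> \<open>The threshold is C times the integral of the first eigenfunction; C was fixed
    before h, which makes it independent of h.\<close>
  have "\<not> t > C * (\<integral>x. v x \<partial>?M)"
    if h: "h \<in> Linfty \<Omega>" "(\<integral>x. h x * v x \<partial>?M) = 0" and U: "weak_solution s \<Omega> f v t h U" for h t U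
  proof -
    from U obtain G u where GU: "H10L s \<Omega> U G u" and
      weak: "\<And>\<Psi> H \<psi>. H10L s \<Omega> \<Psi> H \<psi> \<Longrightarrow> integrable ?M (\<lambda>x. f x (u x) * \<psi> x) \<and>
           inverse (kappa s) * (\<integral>p. G p \<bullet> H p \<partial>(cyl_measure s \<Omega>)) =
             (\<integral>x. (f x (u x) + t * v x + h x) * \<psi> x \<partial>?M)"
      unfolding weak_solution_def by blast
    obtain w where w: "w \<in> borel_measurable borel" "AE x in ?M. v x = w x"
      "integrable ?M (\<lambda>x. f x (u x) * w x)"
      "(\<integral>x. (f x (u x) + t * v x + h x) * w x \<partial>?M) = \<mu> powr s * (\<integral>x. u x * w x \<partial>?M)"
      "L2_fun ?M u" "L2_fun ?M w"
    proof (rule weak_solution_eigenfunction[where f=f and u=u and G=G and F="\<lambda>x. f x (u x) + t * v x + h x",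
          OF \<Omega> assms(1,2) \<mu> v _ GU], goal_cases)
      case (1 w gw)
      show ?case by (rule eigen[OF 1(2)])
    next
      case (2 \<Psi> H \<psi>)
      show ?case by (rule weak[OF 2(2)])
    next
      case (3 w)
      show ?case by (rule 3(1)[OF 3(2-)])
    qed
    have hL: "L2_fun ?M h"
    proof -
      obtain M where "AE x in ?M. \<bar>h x\<bar> \<le> M" "h \<in> borel_measurable ?M" using h(1) by (auto simp: Linfty_def)
      then show ?thesis by (intro L2_fun_bound[OF one, of h M]) auto
    qed
    have mb: "v \<in> borel_measurable ?M" "w \<in> borel_measurable ?M" "h \<in> borel_measurable ?M" "u \<in> borel_measurable ?M"
      using Lv w(5,6) hL by (auto simp: L2_fun_def)
    have i: "integrable ?M (\<lambda>x. v x * w x)" "integrable ?M (\<lambda>x. h x * w x)" "integrable ?M (\<lambda>x. u x * w x)"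
      "integrable ?M w"
      using L2_fun_integrable_inner[OF Lv w(6)] L2_fun_integrable_inner[OF hL w(6)]
        L2_fun_integrable_inner[OF w(5,6)] L2_fun_integrable_inner[OF one w(6)] by simp_all
    have vw: "(\<integral>x. v x * w x \<partial>?M) = 1"
      unfolding sys(2)[symmetric]
    proof (rule integral_cong_AE)
      show "AE x in ?M. v x * w x = v x * v x" using w(2) by eventually_elim simp
    qed (use mb in auto)
    have hw: "(\<integral>x. h x * w x \<partial>?M) = 0"
      unfolding h(2)[symmetric]
    proof (rule integral_cong_AE)
      show "AE x in ?M. h x * w x = h x * v x" using w(2) by eventually_elim simp
    qed (use mb in auto)
    have wv: "(\<integral>x. w x \<partial>?M) = (\<integral>x. v x \<partial>?M)"
    proof (rule integral_cong_AE)
      show "AE x in ?M. w x = v x" using w(2) by eventually_elim simp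
    qed (use mb in auto)
    have "(\<integral>x. (f x (u x) + t * v x + h x) * w x \<partial>?M)
        = (\<integral>x. f x (u x) * w x + t * (v x * w x) + h x * w x \<partial>?M)"
      by (simp add: algebra_simps)
    also have "\<dots> = (\<integral>x. f x (u x) * w x \<partial>?M) + t"
      using w(3) i vw hw by simp
    \<comment> \<open>The normalisation of the eigenfunction gives t the coefficient 1, and
      orthogonality removes h.\<close>
    finally have "t = \<mu> powr s * (\<integral>x. u x * w x \<partial>?M) - (\<integral>x. f x (u x) * w x \<partial>?M)"
      using w(4) by simp
    also have "\<dots> = (\<integral>x. \<mu> powr s * (u x * w x) - f x (u x) * w x \<partial>?M)"
      using w(3) i by simp
    also have "\<dots> \<le> (\<integral>x. C * w x \<partial>?M)"
    proof (rule integral_mono_AE)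
      \<comment> \<open>The representative w agrees almost everywhere with the positive first
        eigenfunction, so multiplying by it preserves the pointwise bound.\<close>
      show "AE x in ?M. \<mu> powr s * (u x * w x) - f x (u x) * w x \<le> C * w x"
        using C w(2) sys(3)
      proof eventually_elim
        case (elim x)
        then have "(\<mu> powr s * u x - f x (u x)) * w x \<le> C * w x"
          by (intro mult_right_mono) auto
        then show ?case by (simp add: algebra_simps)
      qed
    qed (use w(3) i in auto)
    also have "\<dots> = C * (\<integral>x. v x \<partial>?M)" using wv by simp
    finally show ?thesis by simp
  qed
  then show ?thesis unfolding v_def by blast
qed

end
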